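(* Let $c>0$ and $\alpha\ge0$, and let $(\nu_N)$ be a sequence with $\nu_N=\alpha N\cdot(1+o(1))$ as $N\to\infty$. Let $$Q_N(\zeta)=-\tfrac1N\log\Bigl[K_{\nu_N}\bigl(\tfrac{N^2|\zeta|}{c^2}\bigr)\cdot|\zeta|^{\nu_N}\Bigr]-\Bigl(\tfrac N{c^2}-1\Bigr)\operatorname{Re}\zeta,\qquad\zeta\in\mathbb{C},$$ where $K_\nu$ is the modified Bessel function of the second kind. Let $\{\zeta_j\}_1^N$ be a random sample from the Gibbs measure associated with $Q_N$ (at $\beta=1$), let $\mathbf{R}_N$ be its $1$-point function, and let $c_N(\xi)=\tfrac1N\int_{\mathbb{R}}\mathbf{R}_N(\xi+i\eta)\,d\eta$. Then $\tfrac1\pi c_N\to\sigma_{\mathrm{MP}(\alpha)}$ in the weak sense of measures as $N\to\infty$, where $$\sigma_{\mathrm{MP}(\alpha)}(\xi)=\frac1{2\pi\xi}\sqrt{(\lambda_+-\xi)(\xi-\lambda_-)}\cdot\mathbf{1}_{[\lambda_-,\lambda_+]}(\xi),\qquad\lambda_\pm=(\sqrt{\alpha+1}\pm1)^2.$$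
   Context: $dA(\zeta)=\tfrac1\pi\,d\xi\,d\eta$ ($\zeta=\xi+i\eta$) is normalized Lebesgue measure on $\mathbb{C}$ and $dA_N=(dA)^{\otimes N}$. For a potential $Q_N$ put $H_N=\sum_{j\ne k}\log\frac1{|\zeta_j-\zeta_k|}+N\sum_{j=1}^NQ_N(\zeta_j)$. The Gibbs measure at $\beta=1$ is $d\mathbf{P}_N=\frac1{Z_N}e^{-H_N}\,dA_N$ on $\mathbb{C}^N$, with $Z_N$ the normalizing constant. The $1$-point function is $\mathbf{R}_N(\zeta)=\lim_{\varepsilon\to0}\varepsilon^{-2}\,\mathbf{E}_N[\#(\{\zeta_j\}_1^N\cap D(\zeta,\varepsilon))]$, where $D(\zeta,\varepsilon)$ is the open disc with center $\zeta$ and radius $\varepsilon$. *)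

theory Defs
  imports "HOL-Probability.Probability"
begin

definition dA :: "complex measure" where
  "dA = density lborel (\<lambda>_. ennreal (1 / pi))"

(* A configuration in \<complex>^N is an extensional function on {..<N}. *)
definition dA_prod :: "nat \<Rightarrow> (nat \<Rightarrow> complex) measure" where
  "dA_prod N = (\<Pi>\<^sub>M j\<in>{..<N}. dA)"

(* Since ln 0 = 0 in HOL, the interaction term is 0 instead of +\<infinity> where two points
   coincide; such configurations form a null set. *)
definition hamiltonian :: "nat \<Rightarrow> (complex \<Rightarrow> real) \<Rightarrow> (nat \<Rightarrow> complex) \<Rightarrow> real" where
  "hamiltonian N Q \<zeta> =
     (\<Sum>j<N. \<Sum>k\<in>{..<N} - {j}. ln (1 / cmod (\<zeta> j - \<zeta> k))) + real N * (\<Sum>j<N. Q (\<zeta> j))"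

definition partition_fun :: "nat \<Rightarrow> (complex \<Rightarrow> real) \<Rightarrow> ennreal" where
  "partition_fun N Q = (\<integral>\<^sup>+ \<zeta>. ennreal (exp (- hamiltonian N Q \<zeta>)) \<partial>dA_prod N)"

definition gibbs :: "nat \<Rightarrow> (complex \<Rightarrow> real) \<Rightarrow> (nat \<Rightarrow> complex) measure" where
  "gibbs N Q =
     density (dA_prod N) (\<lambda>\<zeta>. ennreal (exp (- hamiltonian N Q \<zeta>)) / partition_fun N Q)"

(* Points are counted with multiplicity; they are almost surely distinct. *)
definition one_point :: "nat \<Rightarrow> (complex \<Rightarrow> real) \<Rightarrow> complex \<Rightarrow> real" where
  "one_point N Q z =
     Lim (at_right 0)
       (\<lambda>\<epsilon>. (\<integral>\<zeta>. real (card {j\<in>{..<N}. \<zeta> j \<in> ball z \<epsilon>}) \<partial>gibbs N Q) / \<epsilon>\<^sup>2)"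

definition cross_section :: "nat \<Rightarrow> (complex \<Rightarrow> real) \<Rightarrow> real \<Rightarrow> real" where
  "cross_section N Q \<xi> = (1 / real N) * (\<integral>\<eta>. one_point N Q (Complex \<xi> \<eta>) \<partial>lborel)"

(* The modified Bessel function of the second kind, for real order and x > 0, by its
   integral representation (DLMF 10.32.9). *)
definition bessel_K :: "real \<Rightarrow> real \<Rightarrow> real" where
  "bessel_K \<nu> x = (LBINT t:{0..}. exp (- x * cosh t) * cosh (\<nu> * t))"

(* The value at 0 is an artefact of totality (for instance bessel_K \<nu> 0 = 0); it is
   irrelevant since {0} is a null set.  The N-particle Gibbs measure of this potential has
   finite partition function if and only if \<nu> > -1 and N > c^2 / 2, for N \<ge> 1. *)
definition wishart_potential :: "real \<Rightarrow> real \<Rightarrow> nat \<Rightarrow> complex \<Rightarrow> real" where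
  "wishart_potential c \<nu> N z =
     - (1 / real N) * ln (bessel_K \<nu> ((real N)\<^sup>2 * cmod z / c\<^sup>2) * cmod z powr \<nu>)
     - (real N / c\<^sup>2 - 1) * Re z"

definition mp_edge_plus :: "real \<Rightarrow> real" where
  "mp_edge_plus \<alpha> = (sqrt (\<alpha> + 1) + 1)\<^sup>2"

definition mp_edge_minus :: "real \<Rightarrow> real" where
  "mp_edge_minus \<alpha> = (sqrt (\<alpha> + 1) - 1)\<^sup>2"

definition mp_density :: "real \<Rightarrow> real \<Rightarrow> real" where
  "mp_density \<alpha> \<xi> =
     1 / (2 * pi * \<xi>) * sqrt ((mp_edge_plus \<alpha> - \<xi>) * (\<xi> - mp_edge_minus \<alpha>))
       * indicator {mp_edge_minus \<alpha>..mp_edge_plus \<alpha>} \<xi>"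

definition density_measure :: "(real \<Rightarrow> real) \<Rightarrow> real measure" where
  "density_measure f = density lborel (\<lambda>x. ennreal (f x))"

(* weak_conv_m is convergence of distribution functions at continuity points of the limit;
   for probability measures on the line it is weak convergence, hence the requirement that
   the measures be eventually probability measures. *)
definition densities_converge_weakly :: "(nat \<Rightarrow> real \<Rightarrow> real) \<Rightarrow> (real \<Rightarrow> real) \<Rightarrow> bool" where
  "densities_converge_weakly f g \<longleftrightarrow>
     (\<forall>\<^sub>F N in sequentially. real_distribution (density_measure (f N))) \<and>
     weak_conv_m (\<lambda>N. density_measure (f N)) (density_measure g)"

end

theory Submission
  imports Defs "Jordan_Normal_Form.Determinant"
begin

text \<open>
The particles form a determinantal process, so the one-point function is determined by the
orthogonal polynomials of the weight \<open>w = exp (- N Q)\<close>.  Put \<open>a = N\<^sup>2 / c\<^sup>2\<close>,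
\<open>\<tau> = 1 - c\<^sup>2 / N\<close> and \<open>\<kappa> = N - c\<^sup>2 / 2\<close>.

The Bessel function is a mixture of Gaussians: writing \<open>K\<^sub>\<nu>(a r) r\<^sup>\<nu>\<close> as
\<open>1/2 \<integral> s powr (\<nu> - 1) exp (- (a/2) (s + r\<^sup>2 / s)) ds\<close> over \<open>s > 0\<close> and completing the square
shows that \<open>w dA\<close> is a multiple of the law of \<open>Z = \<tau> s + sqrt (s / a) (X + \<i> Y)\<close>, where \<open>s\<close> has the
gamma law with shape \<open>\<nu> + 1\<close> and rate \<open>\<kappa>\<close>, and \<open>X\<close>, \<open>Y\<close> are standard normal and all three are
independent (\<open>bessel_K_mixture\<close>, \<open>law_eq_density\<close>).  Integration by parts in \<open>X\<close>, \<open>Y\<close> and \<open>s\<close>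
gives recurrences for the moments \<open>E Z\<^sup>i (cnj Z)\<^sup>j\<close>, and these identify the orthogonal polynomials
as rescaled Laguerre polynomials (\<open>pairing_laguerre\<close>, \<open>law_orth\<close>).  When normalized, they satisfy
\<open>z p\<^sub>k = A\<^sub>k\<^sub>+\<^sub>1 p\<^sub>k\<^sub>+\<^sub>1 + d\<^sub>k p\<^sub>k + \<tau>\<^sup>2 A\<^sub>k p\<^sub>k\<^sub>-\<^sub>1\<close> with \<open>A\<^sub>k = sqrt (k (k + \<nu>)) / \<kappa>\<close> and
\<open>d\<^sub>k = \<tau> (2k + \<nu> + 1) / \<kappa>\<close>.

The function \<open>c\<^sub>N / \<pi>\<close> is the density of \<open>Re z\<close> under the probability measure proportional to
\<open>(\<Sum>k<N. |p\<^sub>k|\<^sup>2) w dA\<close> (\<open>one_point_eq_intensity\<close>, \<open>density_measure_section\<close>).  Its moments follow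
from \<open>(Re z)\<^sup>m = ((z + cnj z) / 2)\<^sup>m\<close> and the recurrence.  If \<open>k / N\<close> tends to \<open>x\<close>, then near the
index \<open>k\<close> the coefficients \<open>A\<close> and \<open>d\<close> tend to the constants \<open>sqrt (x (x + \<alpha>))\<close> and \<open>2x + \<alpha>\<close>,
while \<open>\<tau>\<^sup>2\<close> tends to 1.  Hence the moments under \<open>|p\<^sub>k|\<^sup>2 w dA\<close> tend to those of
\<open>2x + \<alpha> + 2 sqrt (x (x + \<alpha>)) cos t\<close> with \<open>t\<close> uniform (\<open>jacobi_moment_tendsto\<close>), an arcsine law,
and the average over \<open>k < N\<close> becomes an integral over \<open>x\<close> in \<open>(0, 1)\<close> (\<open>moments_tendsto\<close>).

Finally, this mixture of arcsine laws is the Marchenko-Pastur law.  Its density at \<open>\<xi>\<close> is the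
integral over \<open>x\<close> of \<open>1 / (\<pi> sqrt (4x (x + \<alpha>) - (\<xi> - 2x - \<alpha>)\<^sup>2))\<close>; the radicand equals
\<open>4x \<xi> - (\<xi> - \<alpha>)\<^sup>2\<close> and is linear in \<open>x\<close>, so the integral is elementary
(\<open>density_measure_mp_eq_distr\<close>).  Since the limit has compact support, convergence of all moments
implies weak convergence (\<open>weak_conv_m_of_moments\<close>).\<close>

section \<open>Determinants of monic polynomial values\<close>

definition eval_mat :: "nat \<Rightarrow> (nat \<Rightarrow> 'a::idom poly) \<Rightarrow> (nat \<Rightarrow> 'a) \<Rightarrow> 'a Matrix.mat" where
  "eval_mat n q x = Matrix.mat n n (\<lambda>(i, j). poly (q j) (x i))"

lemma eval_mat_carrier: "eval_mat n q x \<in> carrier_mat n n"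
  by (simp add: eval_mat_def)

lemma row_eval_mat_cong:
  assumes "i < n" "j < n" "x i = x j"
  shows "Matrix.row (eval_mat n q x) i = Matrix.row (eval_mat n q x) j"
  using assms by (intro eq_vecI) (auto simp: eval_mat_def)

lemma mat_delete_eval_mat:
  assumes "j \<le> n" and "\<And>i. i < n \<Longrightarrow> x i = y i"
  shows "mat_delete (eval_mat (Suc n) q x) n j = mat_delete (eval_mat (Suc n) q y) n j"
  using assms by (intro eq_matI) (auto simp: eval_mat_def mat_delete_def)

lemma mat_delete_eval_mat_last:
  "mat_delete (eval_mat (Suc n) q x) n n = eval_mat n q x"
  by (intro eq_matI) (auto simp: eval_mat_def mat_delete_def)

text \<open>Monic polynomials give the same determinant as the powers in the Vandermonde matrix.  As a function
of the last node the determinant is, by expansion along the last row, a polynomial of degree at most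
\<open>n\<close>.  The other nodes are roots of it, since two rows agree there, and its coefficient of degree \<open>n\<close>
is the determinant for the first \<open>n\<close> nodes.\<close>

lemma det_eval_monic:
  fixes q :: "nat \<Rightarrow> 'a::idom poly"
  assumes "\<And>k. k < n \<Longrightarrow> degree (q k) = k" "\<And>k. k < n \<Longrightarrow> coeff (q k) k = 1"
  shows "Determinant.det (eval_mat n q x) = (\<Prod>i<n. \<Prod>j<i. x i - x j)"
  using assms
proof (induction n)
  case 0
  show ?case by (simp add: eval_mat_def det_dim_zero)
next
  case (Suc n)
  have IH: "Determinant.det (eval_mat n q x) = (\<Prod>i<n. \<Prod>j<i. x i - x j)"
    by (rule Suc.IH) (auto simp: Suc.prems)
  show ?case
  proof (cases "inj_on x {..n}")
    case False
    then obtain i j where ij: "i < j" "j \<le> n" "x i = x j"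
      by (auto simp: inj_on_def) (metis linorder_neqE_nat)
    have "Determinant.det (eval_mat (Suc n) q x) = 0"
      by (rule Determinant.det_identical_rows[OF eval_mat_carrier, of i j])
         (use ij in \<open>auto intro!: row_eval_mat_cong\<close>)
    moreover have "(\<Prod>i<Suc n. \<Prod>j<i. x i - x j) = 0"
    proof (rule prod_zero)
      have "(\<Prod>k<j. x j - x k) = 0"
        by (rule prod_zero) (use ij in \<open>auto intro!: bexI[of _ i]\<close>)
      then show "\<exists>a\<in>{..<Suc n}. (\<Prod>k<a. x a - x k) = 0"
        using ij by auto
    qed simp
    ultimately show ?thesis by simp
  next
    case True
    \<comment> \<open>The determinant as a polynomial in the last node: the cofactors along the last row do not involve it.\<close>
    define D where "D = (\<Sum>j<Suc n. Polynomial.smult (cofactor (eval_mat (Suc n) q x) n j) (q j))"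
    have D: "Determinant.det (eval_mat (Suc n) q (x(n := y))) = poly D y" for y
    proof -
      have "Determinant.det (eval_mat (Suc n) q (x(n := y))) =
         (\<Sum>j<Suc n. eval_mat (Suc n) q (x(n := y)) $$ (n, j) * cofactor (eval_mat (Suc n) q (x(n := y))) n j)"
        by (rule laplace_expansion_row[OF eval_mat_carrier]) simp
      also have "\<dots> = (\<Sum>j<Suc n. poly (q j) y * cofactor (eval_mat (Suc n) q x) n j)"
        using mat_delete_eval_mat[of _ n "x(n := y)" x q]
        by (intro sum.cong) (auto simp: eval_mat_def cofactor_def)
      finally show ?thesis
        by (simp add: D_def poly_sum mult.commute)
    qed
    have root: "poly D (x i) = 0" if "i < n" for i
      unfolding D[symmetric] using that
      by (intro Determinant.det_identical_rows[OF eval_mat_carrier, of i n])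
         (auto intro!: row_eval_mat_cong)
    have degD: "degree D \<le> n"
      unfolding D_def using Suc.prems(1)
      by (intro degree_sum_le) (auto intro!: order_trans[OF degree_smult_le])
    have coeffD: "coeff D n = (\<Prod>i<n. \<Prod>j<i. x i - x j)"
    proof -
      have "coeff D n = (\<Sum>j<Suc n. cofactor (eval_mat (Suc n) q x) n j * coeff (q j) n)"
        by (simp add: D_def coeff_sum)
      also have "\<dots> = (\<Sum>j\<in>{n}. cofactor (eval_mat (Suc n) q x) n j * coeff (q j) n)"
        using Suc.prems(1) by (intro sum.mono_neutral_right) (auto intro!: coeff_eq_0)
      also have "\<dots> = Determinant.det (eval_mat n q x)"
        using Suc.prems(2) by (simp add: cofactor_def mat_delete_eval_mat_last)
      finally show ?thesis by (simp add: IH)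
    qed
    define E where "E = (\<Prod>i<n. [:- x i, 1:])"
    have degE: "degree E = n" unfolding E_def by (subst degree_prod_eq_sum_degree) auto
    have lcE: "coeff E n = 1"
      using lead_coeff_prod[of "\<lambda>i. [:- x i, 1:]" "{..<n}"] degE by (simp add: E_def)
    define F where "F = D - Polynomial.smult (coeff D n) E"
    have "F = 0"
    proof (rule ccontr)
      assume F: "F \<noteq> 0"
      have "degree F \<le> n" unfolding F_def using degD degE
        by (intro degree_diff_le) (auto intro: order_trans[OF degree_smult_le])
      moreover have "coeff F n = 0" by (simp add: F_def lcE)
      ultimately have lt: "degree F < n"
        using F by (metis le_neq_implies_less leading_coeff_0_iff)
      have "x ` {..<n} \<subseteq> {y. poly F y = 0}"
        by (auto simp: F_def root E_def poly_prod intro!: disjI2 prod_zero)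
      then have "card (x ` {..<n}) \<le> card {y. poly F y = 0}"
        using F by (intro card_mono poly_roots_finite)
      moreover have "card (x ` {..<n}) = n"
        using True by (subst card_image) (auto intro: inj_on_subset)
      ultimately show False
        using card_poly_roots_bound[OF F] lt by simp
    qed
    then have "D = Polynomial.smult (coeff D n) E" by (simp add: F_def)
    then have "poly D (x n) = coeff D n * poly E (x n)"
      by (metis poly_smult)
    also have "poly E (x n) = (\<Prod>i<n. x n - x i)"
      by (simp add: E_def poly_prod)
    finally have "poly D (x n) = coeff D n * (\<Prod>i<n. x n - x i)" .
    with D[of "x n"] coeffD show ?thesis by simp
  qed
qed

section \<open>The one-point function of an orthogonal polynomial ensemble\<close>

lemma sets_dA [measurable_cong, simp]: "sets dA = sets borel" by (simp add: dA_def)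
lemma space_dA [simp]: "space dA = UNIV" by (simp add: dA_def)

lemma nn_integral_dA:
  "f \<in> borel_measurable borel \<Longrightarrow> (\<integral>\<^sup>+z. f z \<partial>dA) = ennreal (1 / pi) * (\<integral>\<^sup>+z. f z \<partial>lborel)"
  unfolding dA_def by (subst nn_integral_density) (auto simp: nn_integral_cmult)

lemma sigma_finite_dA: "sigma_finite_measure dA"
  unfolding dA_def by (subst sigma_finite_measure.sigma_finite_iff_density_finite[OF sigma_finite_lborel]) auto

interpretation dA: sigma_finite_measure dA by (rule sigma_finite_dA)
interpretation dAs: product_sigma_finite "\<lambda>_::nat. dA" ..

lemma AE_dA_neq: "AE z in dA. z \<noteq> c"
  unfolding dA_def by (subst AE_density) (auto intro: AE_lborel_singleton)

lemma sets_dA_prod [measurable_cong]: "sets (dA_prod N) = sets (\<Pi>\<^sub>M j\<in>{..<N}. borel)"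
  unfolding dA_prod_def by (intro sets_PiM_cong) auto

text \<open>Where two points coincide, \<open>ln 0 = 0\<close> makes the Boltzmann factor differ from the squared Vandermonde
determinant; such configurations are negligible.\<close>

lemma AE_dA_prod_distinct:
  assumes jk: "j < N" "k < N" "j \<noteq> k"
  shows "AE \<zeta> in dA_prod N. \<zeta> j \<noteq> \<zeta> k"
proof -
  let ?I = "{..<N} - {j}"
  have I: "insert j ?I = {..<N}" using jk by auto
  have m: "(\<lambda>\<zeta>. indicator {\<zeta>. \<zeta> j = \<zeta> k} \<zeta> :: ennreal) \<in> borel_measurable (Pi\<^sub>M {..<N} (\<lambda>_. dA))"
  proof -
    have [measurable]: "(\<lambda>\<zeta>. \<zeta> j :: complex) \<in> borel_measurable (Pi\<^sub>M {..<N} (\<lambda>_. borel))"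
         "(\<lambda>\<zeta>. \<zeta> k :: complex) \<in> borel_measurable (Pi\<^sub>M {..<N} (\<lambda>_. borel))"
      using jk by (auto intro!: measurable_component_singleton)
    have eq: "indicator {\<zeta>. \<zeta> j = \<zeta> k} \<zeta> = (indicator {0} (\<zeta> j - \<zeta> k) :: ennreal)" for \<zeta> :: "nat \<Rightarrow> complex"
      by (simp add: indicator_def)
    show ?thesis unfolding eq by measurable
  qed
  have "(\<integral>\<^sup>+\<zeta>. indicator {\<zeta>. \<zeta> j = \<zeta> k} \<zeta> \<partial>dA_prod N) =
      (\<integral>\<^sup>+x. (\<integral>\<^sup>+y. indicator {\<zeta>. \<zeta> j = \<zeta> k} (x(j := y)) \<partial>dA) \<partial>Pi\<^sub>M ?I (\<lambda>_. dA))"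
    unfolding dA_prod_def
    using dAs.product_nn_integral_insert[of ?I j "\<lambda>\<zeta>. indicator {\<zeta>. \<zeta> j = \<zeta> k} \<zeta>", unfolded I, OF _ _ m]
    by simp
  also have "\<dots> = (\<integral>\<^sup>+x. 0 \<partial>Pi\<^sub>M ?I (\<lambda>_. dA))"
  proof (intro nn_integral_cong)
    fix x :: "nat \<Rightarrow> complex"
    have "(\<integral>\<^sup>+y. indicator {\<zeta>. \<zeta> j = \<zeta> k} (x(j := y)) \<partial>dA) = (\<integral>\<^sup>+y. 0 \<partial>dA)"
    proof (rule nn_integral_cong_AE)
      show "AE y in dA. indicator {\<zeta>. \<zeta> j = \<zeta> k} (x(j := y)) = (0 :: ennreal)"
        using AE_dA_neq[of "x k"] by eventually_elim (use jk in \<open>auto simp: indicator_def\<close>)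
    qed
    then show "(\<integral>\<^sup>+y. indicator {\<zeta>. \<zeta> j = \<zeta> k} (x(j := y)) \<partial>dA) = 0" by simp
  qed
  finally have "(\<integral>\<^sup>+\<zeta>. indicator {\<zeta>. \<zeta> j = \<zeta> k} \<zeta> \<partial>dA_prod N) = 0" by simp
  then have "AE \<zeta> in dA_prod N. (indicator {\<zeta>. \<zeta> j = \<zeta> k} \<zeta> :: ennreal) = 0"
    using m by (subst (asm) nn_integral_0_iff_AE) (auto simp: dA_prod_def)
  then show ?thesis by eventually_elim (auto simp: indicator_def split: if_splits)
qed

lemma prod_offdiag:
  fixes f :: "nat \<Rightarrow> nat \<Rightarrow> real"
  assumes "\<And>j k. f j k = f k j"
  shows "(\<Prod>j<N. \<Prod>k\<in>{..<N} - {j}. f j k) = (\<Prod>j<N. \<Prod>k<j. f j k)\<^sup>2"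
proof (induction N)
  case (Suc N)
  have "(\<Prod>j<Suc N. \<Prod>k\<in>{..<Suc N} - {j}. f j k) = (\<Prod>j<N. \<Prod>k\<in>{..<Suc N} - {j}. f j k) * (\<Prod>k\<in>{..<Suc N} - {N}. f N k)"
    by simp
  also have "{..<Suc N} - {N} = {..<N}" by auto
  also have "(\<Prod>j<N. \<Prod>k\<in>{..<Suc N} - {j}. f j k) = (\<Prod>j<N. f j N * (\<Prod>k\<in>{..<N} - {j}. f j k))"
  proof (intro prod.cong refl)
    fix j assume "j \<in> {..<N}"
    then have "{..<Suc N} - {j} = insert N ({..<N} - {j})" by auto
    then show "(\<Prod>k\<in>{..<Suc N} - {j}. f j k) = f j N * (\<Prod>k\<in>{..<N} - {j}. f j k)" by simp
  qed
  also have "\<dots> = (\<Prod>k<N. f N k) * (\<Prod>j<N. \<Prod>k<j. f j k)\<^sup>2"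
    by (simp add: prod.distrib Suc.IH assms[of _ N])
  finally show ?case by (simp add: power2_eq_square mult_ac)
qed simp

text \<open>At \<open>\<beta> = 1\<close> every unordered pair contributes its distance twice, so that the Boltzmann factor is the square
of a Vandermonde determinant, in which the powers may be replaced by the orthogonal polynomials.\<close>

lemma exp_neg_hamiltonian:
  assumes "\<And>j k. j < N \<Longrightarrow> k < N \<Longrightarrow> j \<noteq> k \<Longrightarrow> \<zeta> j \<noteq> \<zeta> k"
    and q: "\<And>k. k < N \<Longrightarrow> degree (q k) = k" "\<And>k. k < N \<Longrightarrow> coeff (q k) k = 1"
  shows "exp (- hamiltonian N Q \<zeta>) =
     (cmod (Determinant.det (eval_mat N q \<zeta>)))\<^sup>2 * (\<Prod>j<N. exp (- real N * Q (\<zeta> j)))"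
proof -
  have "exp (- hamiltonian N Q \<zeta>) = (\<Prod>j<N. \<Prod>k\<in>{..<N} - {j}. exp (- ln (1 / cmod (\<zeta> j - \<zeta> k)))) * (\<Prod>j<N. exp (- real N * Q (\<zeta> j)))"
    by (simp add: hamiltonian_def exp_sum[symmetric] sum_negf[symmetric] exp_add[symmetric] sum_distrib_left del: sum_negf)
  also have "(\<Prod>j<N. \<Prod>k\<in>{..<N} - {j}. exp (- ln (1 / cmod (\<zeta> j - \<zeta> k)))) = (\<Prod>j<N. \<Prod>k\<in>{..<N} - {j}. cmod (\<zeta> j - \<zeta> k))"
    using assms(1) by (intro prod.cong refl) (simp add: ln_div)
  also have "\<dots> = (\<Prod>j<N. \<Prod>k<j. cmod (\<zeta> j - \<zeta> k))\<^sup>2"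
    by (rule prod_offdiag) (rule norm_minus_commute)
  also have "(\<Prod>j<N. \<Prod>k<j. cmod (\<zeta> j - \<zeta> k)) = cmod (Determinant.det (eval_mat N q \<zeta>))"
    by (subst det_eval_monic[OF q]) (simp_all add: prod_norm[symmetric])
  finally show ?thesis .
qed

locale orthogonal_polys =
  fixes N :: nat and w :: "complex \<Rightarrow> real" and q :: "nat \<Rightarrow> complex poly" and H :: "nat \<Rightarrow> real"
  assumes N: "N > 0"
    and w_meas [measurable]: "w \<in> borel_measurable borel"
    and w_nonneg: "\<And>z. w z \<ge> 0"
    and q_degree: "\<And>k. k < N \<Longrightarrow> degree (q k) = k" and q_monic: "\<And>k. k < N \<Longrightarrow> coeff (q k) k = 1"
    and int: "\<And>j k. j < N \<Longrightarrow> k < N \<Longrightarrow> integrable dA (\<lambda>z. poly (q j) z * cnj (poly (q k) z) * of_real (w z))"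
    and orth: "\<And>j k. j < N \<Longrightarrow> k < N \<Longrightarrow> (\<integral>z. poly (q j) z * cnj (poly (q k) z) * of_real (w z) \<partial>dA) = (if j = k then of_real (H k) else 0)"
    and H_pos: "\<And>k. k < N \<Longrightarrow> H k > 0"
begin

abbreviation perms where "perms \<equiv> {\<sigma>. \<sigma> permutes {0..<N}}"

definition mass :: "complex set \<Rightarrow> nat \<Rightarrow> real" where
  "mass B k = (\<integral>z. indicator B z * ((cmod (poly (q k) z))\<^sup>2 * w z) \<partial>dA)"

text \<open>The factor belonging to the coordinate \<open>i\<close> in the product of the \<open>\<sigma>\<close> term of the Leibniz expansion of the
determinant with the conjugate of the \<open>\<pi>\<close> term.  The coordinate \<open>j\<close> is the one tested for membership
in \<open>B\<close>.\<close>

definition F :: "complex set \<Rightarrow> nat \<Rightarrow> (nat \<Rightarrow> nat) \<Rightarrow> (nat \<Rightarrow> nat) \<Rightarrow> nat \<Rightarrow> complex \<Rightarrow> complex" where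
  "F B j \<sigma> \<pi> i z = poly (q (\<sigma> i)) z * cnj (poly (q (\<pi> i)) z) * of_real (w z) * (if i = j then indicator B z else 1)"

lemma perm_less: "\<sigma> \<in> perms \<Longrightarrow> i < N \<Longrightarrow> \<sigma> i < N"
  using permutes_in_image[of \<sigma> "{0..<N}" i] by simp

lemma integrable_sq: "k < N \<Longrightarrow> integrable dA (\<lambda>z. (cmod (poly (q k) z))\<^sup>2 * w z)"
proof -
  assume k: "k < N"
  have "integrable dA (\<lambda>z. norm (poly (q k) z * cnj (poly (q k) z) * of_real (w z)))"
    using int[OF k k] by (rule integrable_norm)
  then show ?thesis by (simp add: norm_mult power2_eq_square w_nonneg)
qed

lemma integrable_F:
  assumes B: "B \<in> sets borel" and "\<sigma> \<in> perms" "\<pi> \<in> perms" "i < N"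
  shows "integrable dA (F B j \<sigma> \<pi> i)"
proof (cases "i = j")
  case False
  then show ?thesis unfolding F_def using int[of "\<sigma> i" "\<pi> i"] assms perm_less by simp
next
  case True
  have "integrable dA (\<lambda>z. indicator B z *\<^sub>R (poly (q (\<sigma> i)) z * cnj (poly (q (\<pi> i)) z) * of_real (w z)))"
    using int[of "\<sigma> i" "\<pi> i"] assms perm_less by (intro integrable_mult_indicator) auto
  moreover have "F B j \<sigma> \<pi> i = (\<lambda>z. indicator B z *\<^sub>R (poly (q (\<sigma> i)) z * cnj (poly (q (\<pi> i)) z) * of_real (w z)))"
    using True by (auto simp: F_def fun_eq_iff indicator_def)
  ultimately show ?thesis by simp
qed

lemma integral_F_neq: "\<sigma> \<in> perms \<Longrightarrow> \<pi> \<in> perms \<Longrightarrow> i < N \<Longrightarrow> i \<noteq> j \<Longrightarrow> integral\<^sup>L dA (F B j \<sigma> \<pi> i) = (if \<sigma> i = \<pi> i then of_real (H (\<sigma> i)) else 0)"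
  unfolding F_def using orth[of "\<sigma> i" "\<pi> i"] perm_less by simp

lemma integral_F_eq: "\<sigma> \<in> perms \<Longrightarrow> j < N \<Longrightarrow> integral\<^sup>L dA (F B j \<sigma> \<sigma> j) = of_real (mass B (\<sigma> j))"
proof -
  have "F B j \<sigma> \<sigma> j = (\<lambda>z. of_real (indicator B z * ((cmod (poly (q (\<sigma> j)) z))\<^sup>2 * w z)))"
    by (auto simp: F_def fun_eq_iff indicator_def complex_norm_square[symmetric] simp del: of_real_power)
  then show ?thesis unfolding mass_def by (simp only: integral_complex_of_real)
qed

text \<open>Orthogonality in all coordinates but \<open>j\<close> forces \<open>\<sigma>\<close> and \<open>\<pi>\<close> to agree off \<open>j\<close>, and then they are equal
because they are permutations.  Thus only the diagonal of the double Leibniz sum survives.\<close>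

lemma integral_prod_F:
  assumes B: "B \<in> sets borel" and \<sigma>: "\<sigma> \<in> perms" and \<pi>: "\<pi> \<in> perms" and j: "j < N"
  shows "(\<integral>\<zeta>. (\<Prod>i<N. F B j \<sigma> \<pi> i (\<zeta> i)) \<partial>dA_prod N) =
     (if \<sigma> = \<pi> then of_real ((\<Prod>k<N. H k) * (mass B (\<sigma> j) / H (\<sigma> j))) else 0)"
proof -
  have "(\<integral>\<zeta>. (\<Prod>i<N. F B j \<sigma> \<pi> i (\<zeta> i)) \<partial>dA_prod N) = (\<Prod>i<N. integral\<^sup>L dA (F B j \<sigma> \<pi> i))"
    unfolding dA_prod_def using integrable_F[OF B \<sigma> \<pi>] by (intro dAs.product_integral_prod) auto
  also have "\<dots> = (if \<sigma> = \<pi> then of_real ((\<Prod>k<N. H k) * (mass B (\<sigma> j) / H (\<sigma> j))) else 0)"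
  proof (cases "\<sigma> = \<pi>")
    case False
    have "\<exists>i<N. i \<noteq> j \<and> \<sigma> i \<noteq> \<pi> i"
    proof (rule ccontr)
      assume *: "\<not> ?thesis"
      have out: "\<sigma> i = i" "\<pi> i = i" if "i \<ge> N" for i
        using \<sigma> \<pi> that by (auto simp: permutes_def)
      have eq: "\<sigma> i = \<pi> i" if "i \<noteq> j" for i using * out that by (cases "i < N") auto
      have bij: "bij \<sigma>" "bij \<pi>" using \<sigma> \<pi> by (auto intro: permutes_bij)
      obtain i where i: "\<pi> i = \<sigma> j" using bij(2) by (metis bij_pointE)
      have "\<sigma> j = \<pi> j"
      proof (cases "i = j")
        case False
        then have "\<sigma> i = \<sigma> j" using eq i by simp
        then show ?thesis using False bij(1) by (metis bij_pointE)
      qed (use i in simp)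
      then have "\<sigma> = \<pi>" using eq by (metis ext)
      then show False using \<open>\<sigma> \<noteq> \<pi>\<close> by simp
    qed
    then obtain i where i: "i < N" "i \<noteq> j" "\<sigma> i \<noteq> \<pi> i" by auto
    then have "integral\<^sup>L dA (F B j \<sigma> \<pi> i) = 0" using integral_F_neq \<sigma> \<pi> by simp
    then have "(\<Prod>i<N. integral\<^sup>L dA (F B j \<sigma> \<pi> i)) = 0" using i by (intro prod_zero) auto
    then show ?thesis using False by simp
  next
    case True
    have "(\<Prod>i<N. integral\<^sup>L dA (F B j \<sigma> \<sigma> i)) = integral\<^sup>L dA (F B j \<sigma> \<sigma> j) * (\<Prod>i\<in>{..<N} - {j}. integral\<^sup>L dA (F B j \<sigma> \<sigma> i))"
      using j by (intro prod.remove) auto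
    also have "(\<Prod>i\<in>{..<N} - {j}. integral\<^sup>L dA (F B j \<sigma> \<sigma> i)) = (\<Prod>i\<in>{..<N} - {j}. of_real (H (\<sigma> i)))"
      using \<sigma> by (intro prod.cong refl) (auto simp: integral_F_neq)
    also have "\<dots> = of_real (\<Prod>i\<in>{..<N} - {j}. H (\<sigma> i))" by simp
    also have "(\<Prod>i\<in>{..<N} - {j}. H (\<sigma> i)) = (\<Prod>i<N. H (\<sigma> i)) / H (\<sigma> j)"
      using j H_pos[OF perm_less[OF \<sigma> j]] by (subst prod.remove[of "{..<N}" j]) auto
    also have "(\<Prod>i<N. H (\<sigma> i)) = (\<Prod>k<N. H k)"
    proof -
      have "bij_betw \<sigma> {..<N} {..<N}"
        using \<sigma> permutes_imp_bij[of \<sigma> "{0..<N}"] by (simp add: atLeast0LessThan)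
      then show ?thesis by (rule prod.reindex_bij_betw)
    qed
    finally show ?thesis using True \<sigma> j by (simp add: integral_F_eq mult.commute)
  qed
  finally show ?thesis .
qed

lemma det_sq_expand:
  "of_real ((cmod (Determinant.det (eval_mat N q \<zeta>)))\<^sup>2 * (\<Prod>i<N. w (\<zeta> i)) * indicator B (\<zeta> j)) =
    (\<Sum>\<sigma>\<in>perms. \<Sum>\<pi>\<in>perms. of_int (sign \<sigma> * sign \<pi>) * (\<Prod>i<N. F B j \<sigma> \<pi> i (\<zeta> i)))" if j: "j < N"
proof -
  have d: "Determinant.det (eval_mat N q \<zeta>) = (\<Sum>\<sigma>\<in>perms. of_int (sign \<sigma>) * (\<Prod>i<N. poly (q (\<sigma> i)) (\<zeta> i)))"
    unfolding Determinant.det_def eval_mat_def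
    by (auto simp: atLeast0LessThan intro!: sum.cong prod.cong dest!: perm_less[unfolded mem_Collect_eq atLeast0LessThan])
  have c: "(\<Prod>i<N. (if i = j then indicator B (\<zeta> i) else 1)) = (indicator B (\<zeta> j) :: complex)"
    using j by (simp add: prod.If_cases)
  have "of_real ((cmod (Determinant.det (eval_mat N q \<zeta>)))\<^sup>2 * (\<Prod>i<N. w (\<zeta> i)) * indicator B (\<zeta> j)) =
     (Determinant.det (eval_mat N q \<zeta>) * cnj (Determinant.det (eval_mat N q \<zeta>))) * (\<Prod>i<N. of_real (w (\<zeta> i))) * (indicator B (\<zeta> j) :: complex)"
  proof -
    have "of_real (indicator B (\<zeta> j)) = (indicator B (\<zeta> j) :: complex)" by (simp add: indicator_def)
    then show ?thesis by (simp only: of_real_mult complex_norm_square of_real_prod)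
  qed
  also have "\<dots> = (\<Sum>\<sigma>\<in>perms. \<Sum>\<pi>\<in>perms. (of_int (sign \<sigma>) * (\<Prod>i<N. poly (q (\<sigma> i)) (\<zeta> i))) *
       (of_int (sign \<pi>) * (\<Prod>i<N. cnj (poly (q (\<pi> i)) (\<zeta> i)))) * (\<Prod>i<N. of_real (w (\<zeta> i))) * indicator B (\<zeta> j))"
    unfolding d cnj_sum complex_cnj_mult cnj_prod complex_cnj_of_int sum_product
    by (simp only: sum_distrib_right)
  also have "\<dots> = (\<Sum>\<sigma>\<in>perms. \<Sum>\<pi>\<in>perms. of_int (sign \<sigma> * sign \<pi>) * (\<Prod>i<N. F B j \<sigma> \<pi> i (\<zeta> i)))"
    unfolding c[symmetric] F_def by (intro sum.cong refl) (simp add: prod.distrib mult_ac)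
  finally show ?thesis .
qed

lemma finite_perms: "finite perms" by (rule finite_permutations) simp

lemma integral_det_sq:
  assumes B: "B \<in> sets borel" and j: "j < N"
  shows "integrable (dA_prod N) (\<lambda>\<zeta>. (cmod (Determinant.det (eval_mat N q \<zeta>)))\<^sup>2 * (\<Prod>i<N. w (\<zeta> i)) * indicator B (\<zeta> j))"
    and "(\<integral>\<zeta>. (cmod (Determinant.det (eval_mat N q \<zeta>)))\<^sup>2 * (\<Prod>i<N. w (\<zeta> i)) * indicator B (\<zeta> j) \<partial>dA_prod N) =
       (\<Sum>\<sigma>\<in>perms. (\<Prod>k<N. H k) * (mass B (\<sigma> j) / H (\<sigma> j)))"
proof -
  let ?G = "\<lambda>\<zeta>. (cmod (Determinant.det (eval_mat N q \<zeta>)))\<^sup>2 * (\<Prod>i<N. w (\<zeta> i)) * indicator B (\<zeta> j)"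
  have I: "integrable (dA_prod N) (\<lambda>\<zeta>. \<Prod>i<N. F B j \<sigma> \<pi> i (\<zeta> i))" if "\<sigma> \<in> perms" "\<pi> \<in> perms" for \<sigma> \<pi>
    unfolding dA_prod_def using integrable_F[OF B that] by (intro dAs.product_integrable_prod) auto
  have "integrable (dA_prod N) (\<lambda>\<zeta>. complex_of_real (?G \<zeta>))"
    unfolding det_sq_expand[OF j] using I
    by (intro Bochner_Integration.integrable_sum integrable_mult_right) auto
  then show 1: "integrable (dA_prod N) ?G" unfolding complex_of_real_integrable_eq .
  have "complex_of_real (\<integral>\<zeta>. ?G \<zeta> \<partial>dA_prod N) = (\<integral>\<zeta>. complex_of_real (?G \<zeta>) \<partial>dA_prod N)"
    by (rule integral_complex_of_real[symmetric])
  also have "\<dots> = (\<Sum>\<sigma>\<in>perms. \<Sum>\<pi>\<in>perms. of_int (sign \<sigma> * sign \<pi>) * (\<integral>\<zeta>. (\<Prod>i<N. F B j \<sigma> \<pi> i (\<zeta> i)) \<partial>dA_prod N))"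
    unfolding det_sq_expand[OF j] using I
    by (subst Bochner_Integration.integral_sum, (intro Bochner_Integration.integrable_sum integrable_mult_right; auto),
        intro sum.cong refl, subst Bochner_Integration.integral_sum, (intro integrable_mult_right; auto), simp)
  also have "\<dots> = (\<Sum>\<sigma>\<in>perms. \<Sum>\<pi>\<in>perms. if \<pi> = \<sigma> then of_real ((\<Prod>k<N. H k) * (mass B (\<sigma> j) / H (\<sigma> j))) else 0)"
  proof (intro sum.cong refl)
    fix \<sigma> \<pi> assume s: "\<sigma> \<in> perms" "\<pi> \<in> perms"
    have "of_int (sign \<sigma>) * of_int (sign \<sigma>) = (1 :: complex)" by (simp add: sign_def)
    then show "of_int (sign \<sigma> * sign \<pi>) * (\<integral>\<zeta>. (\<Prod>i<N. F B j \<sigma> \<pi> i (\<zeta> i)) \<partial>dA_prod N) =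
      (if \<pi> = \<sigma> then of_real ((\<Prod>k<N. H k) * (mass B (\<sigma> j) / H (\<sigma> j))) else 0)"
      unfolding integral_prod_F[OF B s j] by auto
  qed
  also have "\<dots> = of_real (\<Sum>\<sigma>\<in>perms. (\<Prod>k<N. H k) * (mass B (\<sigma> j) / H (\<sigma> j)))"
    using finite_perms by (simp add: sum.delta)
  finally show "(\<integral>\<zeta>. ?G \<zeta> \<partial>dA_prod N) = (\<Sum>\<sigma>\<in>perms. (\<Prod>k<N. H k) * (mass B (\<sigma> j) / H (\<sigma> j)))"
    by (simp only: of_real_eq_iff)
qed

lemma mass_UNIV: "k < N \<Longrightarrow> mass UNIV k = H k"
proof -
  assume k: "k < N"
  have "complex_of_real (mass UNIV k) = (\<integral>z. of_real ((cmod (poly (q k) z))\<^sup>2 * w z) \<partial>dA)"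
    unfolding mass_def by (subst integral_complex_of_real) simp
  also have "\<dots> = of_real (H k)"
    using orth[OF k k] by (simp only: complex_norm_square of_real_mult simp_thms if_True)
  finally show ?thesis by simp
qed

text \<open>Each permutation \<open>\<sigma>\<close> contributes to the event \<open>\<zeta> j \<in> B\<close> an amount that depends on \<open>\<sigma> j\<close> alone.  Summed over
all \<open>j\<close>, this amount is the same for every permutation, so that the sum over permutations only
cancels the normalizing constant.  In this way the expected number of particles is obtained without
computing the correlation kernel.\<close>

lemma count_intensity:
  assumes B[measurable]: "B \<in> sets borel" and Q: "\<And>z. w z = exp (- real N * Q z)" and Qm[measurable]: "Q \<in> borel_measurable borel"
  shows "(\<integral>\<zeta>. real (card {j\<in>{..<N}. \<zeta> j \<in> B}) \<partial>gibbs N Q) = (\<Sum>k<N. mass B k / H k)"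
proof -
  let ?D = "\<lambda>\<zeta>. (cmod (Determinant.det (eval_mat N q \<zeta>)))\<^sup>2 * (\<Prod>i<N. w (\<zeta> i))"
  let ?E = "\<lambda>\<zeta>. exp (- hamiltonian N Q \<zeta>)"
  define c where "c = (\<Prod>k<N. H k)"
  define n where "n = real (card perms)"
  have c: "c > 0" unfolding c_def using H_pos by (intro prod_pos) auto
  have n: "n > 0" unfolding n_def using finite_perms permutes_id[of "{0..<N}"] by (auto simp: card_gt_0_iff simp del: permutes_id)
  have [measurable]: "(\<lambda>\<zeta>. \<zeta> j) \<in> borel_measurable (Pi\<^sub>M {..<N} (\<lambda>_. borel))" if "j < N" for j
    using that by (intro measurable_component_singleton) auto
  have Em[measurable]: "?E \<in> borel_measurable (dA_prod N)"
    unfolding hamiltonian_def by measurable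
  have AE: "AE \<zeta> in dA_prod N. ?E \<zeta> = ?D \<zeta>"
  proof -
    have "AE \<zeta> in dA_prod N. \<forall>j\<in>{..<N}. \<forall>k\<in>{..<N}. j \<noteq> k \<longrightarrow> \<zeta> j \<noteq> \<zeta> k"
      by (intro AE_finite_allI) (auto simp: AE_dA_prod_distinct)
    then show ?thesis
      by eventually_elim (subst exp_neg_hamiltonian, auto simp: Q q_degree q_monic)
  qed
  have intEB: "integrable (dA_prod N) (\<lambda>\<zeta>. ?E \<zeta> * indicator B (\<zeta> j))"
    and valEB: "(\<integral>\<zeta>. ?E \<zeta> * indicator B (\<zeta> j) \<partial>dA_prod N) = (\<Sum>\<sigma>\<in>perms. c * (mass B (\<sigma> j) / H (\<sigma> j)))"
    if j: "j < N" and B[measurable]: "B \<in> sets borel" for j B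
  proof -
    have m: "(\<lambda>\<zeta>. ?E \<zeta> * indicator B (\<zeta> j)) \<in> borel_measurable (dA_prod N)"
      using j by measurable
    have m': "(\<lambda>\<zeta>. ?D \<zeta> * indicator B (\<zeta> j)) \<in> borel_measurable (dA_prod N)"
      using integral_det_sq(1)[OF B j] by auto
    have ae: "AE \<zeta> in dA_prod N. ?E \<zeta> * indicator B (\<zeta> j) = ?D \<zeta> * indicator B (\<zeta> j)"
      using AE by eventually_elim simp
    show "integrable (dA_prod N) (\<lambda>\<zeta>. ?E \<zeta> * indicator B (\<zeta> j))"
      using integrable_cong_AE[OF m m' ae] integral_det_sq(1)[OF B j] by simp
    show "(\<integral>\<zeta>. ?E \<zeta> * indicator B (\<zeta> j) \<partial>dA_prod N) = (\<Sum>\<sigma>\<in>perms. c * (mass B (\<sigma> j) / H (\<sigma> j)))"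
      using integral_cong_AE[OF m m' ae] integral_det_sq(2)[OF B j] by (simp add: c_def)
  qed
  have intE: "integrable (dA_prod N) ?E" using intEB[OF N, of UNIV] by simp
  have valE: "(\<integral>\<zeta>. ?E \<zeta> \<partial>dA_prod N) = n * c"
  proof -
    have "(\<integral>\<zeta>. ?E \<zeta> \<partial>dA_prod N) = (\<Sum>\<sigma>\<in>perms. c * (mass UNIV (\<sigma> 0) / H (\<sigma> 0)))"
      using valEB[OF N, of UNIV] by simp
    also have "\<dots> = (\<Sum>\<sigma>\<in>perms. c)"
    proof (intro sum.cong refl)
      fix \<sigma> assume "\<sigma> \<in> perms"
      then show "c * (mass UNIV (\<sigma> 0) / H (\<sigma> 0)) = c"
        using mass_UNIV[OF perm_less[OF _ N]] H_pos[OF perm_less[OF _ N]] by (metis less_irrefl div_self mult.right_neutral)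
    qed
    finally show ?thesis by (simp add: n_def)
  qed
  have part: "partition_fun N Q = ennreal (n * c)"
    unfolding partition_fun_def using intE valE by (subst nn_integral_eq_integral) auto
  have dens: "gibbs N Q = density (dA_prod N) (\<lambda>\<zeta>. ennreal (?E \<zeta> / (n * c)))"
    unfolding gibbs_def part using n c by (simp add: divide_ennreal)
  have card_eq: "real (card {j\<in>{..<N}. \<zeta> j \<in> B}) = (\<Sum>j<N. indicator B (\<zeta> j))" for \<zeta> :: "nat \<Rightarrow> complex"
  proof -
    have "real (card {j\<in>{..<N}. \<zeta> j \<in> B}) = (\<Sum>j\<in>{j\<in>{..<N}. \<zeta> j \<in> B}. 1)" by simp
    also have "\<dots> = (\<Sum>j<N. indicator B (\<zeta> j))" by (simp add: indicator_def sum.If_cases Int_def)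
    finally show ?thesis .
  qed
  have "(\<integral>\<zeta>. real (card {j\<in>{..<N}. \<zeta> j \<in> B}) \<partial>gibbs N Q) = (\<integral>\<zeta>. ?E \<zeta> / (n * c) * (\<Sum>j<N. indicator B (\<zeta> j)) \<partial>dA_prod N)"
    unfolding dens card_eq using n c by (subst integral_real_density) auto
  also have "\<dots> = (\<integral>\<zeta>. (\<Sum>j<N. (?E \<zeta> * indicator B (\<zeta> j)) / (n * c)) \<partial>dA_prod N)"
    by (intro Bochner_Integration.integral_cong refl) (simp add: sum_distrib_left)
  also have "\<dots> = (\<Sum>j<N. (\<Sum>\<sigma>\<in>perms. c * (mass B (\<sigma> j) / H (\<sigma> j))) / (n * c))"
    using intEB valEB by (subst Bochner_Integration.integral_sum) auto
  also have "\<dots> = (\<Sum>\<sigma>\<in>perms. \<Sum>j<N. (mass B (\<sigma> j) / H (\<sigma> j)) / n)"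
    unfolding sum_divide_distrib using c n by (subst sum.swap) (simp add: field_simps)
  also have "\<dots> = (\<Sum>\<sigma>\<in>perms. (\<Sum>k<N. mass B k / H k) / n)"
  proof (intro sum.cong refl)
    fix \<sigma> assume "\<sigma> \<in> perms"
    then have "bij_betw \<sigma> {..<N} {..<N}"
      using permutes_imp_bij[of \<sigma> "{0..<N}"] by (simp add: atLeast0LessThan)
    from sum.reindex_bij_betw[OF this, of "\<lambda>k. mass B k / H k / n"]
    show "(\<Sum>j<N. (mass B (\<sigma> j) / H (\<sigma> j)) / n) = (\<Sum>k<N. mass B k / H k) / n"
      by (simp add: sum_divide_distrib)
  qed
  also have "\<dots> = (\<Sum>k<N. mass B k / H k)" using n by (simp add: n_def)
  finally show ?thesis .
qed

definition intensity :: "complex \<Rightarrow> real" where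
  "intensity z = (\<Sum>k<N. (cmod (poly (q k) z))\<^sup>2 / H k) * w z"

lemma intensity_measurable [measurable]: "intensity \<in> borel_measurable borel"
proof -
  have [measurable]: "(\<lambda>z. poly (q k) z) \<in> borel_measurable borel" for k
    by (intro borel_measurable_continuous_onI continuous_intros)
  show ?thesis unfolding intensity_def by measurable
qed

lemma intensity_nonneg: "intensity z \<ge> 0"
  unfolding intensity_def using w_nonneg H_pos
  by (intro mult_nonneg_nonneg sum_nonneg divide_nonneg_nonneg) (auto simp: less_imp_le)

lemma integrable_intensity: "integrable dA intensity"
proof -
  have "integrable dA (\<lambda>z. \<Sum>k<N. ((cmod (poly (q k) z))\<^sup>2 * w z) / H k)"
    by (intro Bochner_Integration.integrable_sum integrable_divide integrable_sq) auto
  moreover have "intensity = (\<lambda>z. \<Sum>k<N. ((cmod (poly (q k) z))\<^sup>2 * w z) / H k)"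
    by (simp add: fun_eq_iff intensity_def sum_distrib_right)
  ultimately show ?thesis by simp
qed

lemma sum_mass: "B \<in> sets borel \<Longrightarrow> (\<Sum>k<N. mass B k / H k) = (\<integral>z. indicator B z * intensity z \<partial>dA)"
proof -
  assume B: "B \<in> sets borel"
  have I: "integrable dA (\<lambda>z. indicator B z * ((cmod (poly (q k) z))\<^sup>2 * w z))" if "k < N" for k
    using integrable_mult_indicator[of B dA, OF _ integrable_sq[OF that]] B by simp
  have "(\<Sum>k<N. mass B k / H k) = (\<integral>z. (\<Sum>k<N. indicator B z * ((cmod (poly (q k) z))\<^sup>2 * w z) / H k) \<partial>dA)"
    unfolding mass_def using I by (subst Bochner_Integration.integral_sum) auto
  also have "\<dots> = (\<integral>z. indicator B z * intensity z \<partial>dA)"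
    unfolding intensity_def by (intro Bochner_Integration.integral_cong refl) (simp add: sum_distrib_left sum_distrib_right field_simps)
  finally show ?thesis .
qed

text \<open>The disc of radius \<open>\<epsilon>\<close> has normalized area \<open>\<epsilon>\<^sup>2\<close>, so the limit defining the one-point function is the
derivative of the expected number of particles with respect to \<open>dA\<close>, taken at a point of continuity.\<close>

lemma one_point_eq_intensity:
  assumes Q: "\<And>z. w z = exp (- real N * Q z)" and Qm: "Q \<in> borel_measurable borel" and cont: "isCont w z"
  shows "one_point N Q z = intensity z"
proof -
  let ?C = "\<lambda>e. \<integral>\<zeta>. real (card {j\<in>{..<N}. \<zeta> j \<in> ball z e}) \<partial>gibbs N Q"
  have ci: "isCont intensity z"
    unfolding intensity_def using cont H_pos by (intro continuous_intros) (auto simp: less_imp_neq[symmetric])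
  have vol: "measure dA (ball z e) = e\<^sup>2" if "e > 0" for e
  proof -
    have "emeasure dA (ball z e) = ennreal (1 / pi) * emeasure lborel (ball z e)"
      unfolding dA_def by (subst emeasure_density) (auto simp: nn_integral_cmult_indicator)
    also have "\<dots> = ennreal (e\<^sup>2)"
      using that by (simp add: emeasure_ball unit_ball_vol_numeral(1) ennreal_mult[symmetric] unit_ball_vol_2)
    finally show ?thesis by (simp add: measure_def)
  qed
  have "((\<lambda>e. ?C e / e\<^sup>2) \<longlongrightarrow> intensity z) (at_right 0)"
  proof (rule tendstoI)
    fix d :: real assume d: "d > 0"
    then obtain r where r: "r > 0" "\<And>y. dist y z < r \<Longrightarrow> dist (intensity y) (intensity z) < d / 2"
      using ci unfolding continuous_at_eps_delta by (metis half_gt_zero)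
    have "\<bar>?C e / e\<^sup>2 - intensity z\<bar> < d"
      if e: "0 < e" "e < r" for e
    proof -
      have ib: "integrable dA (\<lambda>y. indicator (ball z e) y * intensity y)"
        using integrable_mult_indicator[of "ball z e" dA, OF _ integrable_intensity] by simp
      have fin: "emeasure dA (ball z e) < \<infinity>"
      proof -
        have "emeasure dA (ball z e) = ennreal (1 / pi) * emeasure lborel (ball z e)"
          unfolding dA_def by (subst emeasure_density) (auto simp: nn_integral_cmult_indicator)
        then show ?thesis using emeasure_bounded_finite[of "ball z e"] by (simp add: ennreal_mult_less_top)
      qed
      have ic: "integrable dA (\<lambda>y. indicator (ball z e) y * c)" for c :: real
        using fin by (intro integrable_mult_left) (auto simp: integrable_indicator_iff)
      have "?C e = (\<integral>y. indicator (ball z e) y * intensity y \<partial>dA)"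
        using count_intensity[OF _ Q Qm, of "ball z e"] sum_mass[of "ball z e"] by simp
      also have "\<dots> = (\<integral>y. indicator (ball z e) y * intensity z \<partial>dA) + (\<integral>y. indicator (ball z e) y * (intensity y - intensity z) \<partial>dA)"
        using ib ic by (subst Bochner_Integration.integral_add[symmetric]) (auto simp: right_diff_distrib)
      also have "(\<integral>y. indicator (ball z e) y * intensity z \<partial>dA) = e\<^sup>2 * intensity z"
        using e vol by simp
      finally have eq: "?C e - e\<^sup>2 * intensity z
          = (\<integral>y. indicator (ball z e) y * (intensity y - intensity z) \<partial>dA)" by simp
      have "\<bar>\<integral>y. indicator (ball z e) y * (intensity y - intensity z) \<partial>dA\<bar> \<le> (\<integral>y. indicator (ball z e) y * (d / 2) \<partial>dA)"
      proof (rule order_trans[OF integral_abs_bound], rule integral_mono)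
        show "integrable dA (\<lambda>y. \<bar>indicator (ball z e) y * (intensity y - intensity z)\<bar>)"
          using ib ic by (intro integrable_abs) (auto simp: right_diff_distrib)
        show "\<bar>indicator (ball z e) y * (intensity y - intensity z)\<bar> \<le> indicator (ball z e) y * (d / 2)" for y
          using r(2)[of y] e by (auto simp: indicator_def dist_real_def dist_commute)
      qed (rule ic)
      also have "\<dots> = e\<^sup>2 * (d / 2)" using e vol by simp
      finally have "\<bar>?C e - e\<^sup>2 * intensity z\<bar> \<le> e\<^sup>2 * (d / 2)"
        unfolding eq .
      then have le: "\<bar>?C e - e\<^sup>2 * intensity z\<bar> / e\<^sup>2 \<le> d / 2"
        using e by (simp add: field_simps)
      have "?C e / e\<^sup>2 - intensity z =
          (?C e - e\<^sup>2 * intensity z) / e\<^sup>2"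
        using e by (simp add: field_simps)
      then have "\<bar>?C e / e\<^sup>2 - intensity z\<bar> =
          \<bar>?C e - e\<^sup>2 * intensity z\<bar> / e\<^sup>2"
        by (simp only: abs_divide abs_power2)
      then show ?thesis using le d by linarith
    qed
    then show "\<forall>\<^sub>F e in at_right 0. dist (?C e / e\<^sup>2) (intensity z) < d"
      unfolding eventually_at_right_field dist_real_def using r(1) by blast
  qed
  then show ?thesis unfolding one_point_def by (intro tendsto_Lim) auto
qed

end

section \<open>The Bessel weight as a mixture\<close>

lemma measurable_Complex [measurable]: "(\<lambda>(x, y). Complex x y) \<in> borel_measurable (borel \<Otimes>\<^sub>M borel)"
proof -
  have "(\<lambda>p::real \<times> real. of_real (fst p) + \<i> * of_real (snd p)) \<in> borel_measurable (borel \<Otimes>\<^sub>M borel)"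
    by measurable
  then show ?thesis by (simp add: Complex_eq case_prod_beta)
qed

lemma distr_Complex_lborel: "distr (lborel \<Otimes>\<^sub>M lborel) borel (\<lambda>(x, y). Complex x y) = (lborel :: complex measure)"
proof (rule lborel_eqI[symmetric])
  fix l u :: complex
  assume lu: "\<And>b. b \<in> Basis \<Longrightarrow> l \<bullet> b \<le> u \<bullet> b"
  have lu': "Re l \<le> Re u" "Im l \<le> Im u" using lu[of 1] lu[of \<i>] by (auto simp: Basis_complex_def)
  have "(\<lambda>(x, y). Complex x y) -` box l u \<inter> space (lborel \<Otimes>\<^sub>M lborel) = box (Re l) (Re u) \<times> box (Im l) (Im u)"
    by (auto simp: box_def Basis_complex_def space_pair_measure)
  then have "emeasure (distr (lborel \<Otimes>\<^sub>M lborel) borel (\<lambda>(x, y). Complex x y)) (box l u) =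
     emeasure (lborel \<Otimes>\<^sub>M lborel) (box (Re l) (Re u) \<times> box (Im l) (Im u))"
    by (subst emeasure_distr) auto
  also have "\<dots> = emeasure lborel (box (Re l) (Re u)) * emeasure lborel (box (Im l) (Im u))"
    by (intro lborel.emeasure_pair_measure_Times) auto
  also have "\<dots> = ennreal (\<Prod>b\<in>Basis. (u - l) \<bullet> b)"
    using lu' by (simp add: Basis_complex_def ennreal_mult)
  finally show "emeasure (distr (lborel \<Otimes>\<^sub>M lborel) borel (\<lambda>(x, y). Complex x y)) (box l u) = ennreal (\<Prod>b\<in>Basis. (u - l) \<bullet> b)" .
qed simp

lemma nn_integral_complex:
  assumes [measurable]: "f \<in> borel_measurable borel"
  shows "(\<integral>\<^sup>+z. f z \<partial>(lborel :: complex measure)) = (\<integral>\<^sup>+x. \<integral>\<^sup>+y. f (Complex x y) \<partial>lborel \<partial>lborel)"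
proof -
  have "(\<integral>\<^sup>+z. f z \<partial>(lborel :: complex measure)) = (\<integral>\<^sup>+p. f (case p of (x, y) \<Rightarrow> Complex x y) \<partial>(lborel \<Otimes>\<^sub>M lborel))"
    unfolding distr_Complex_lborel[symmetric] by (subst nn_integral_distr) auto
  also have "\<dots> = (\<integral>\<^sup>+x. \<integral>\<^sup>+y. f (Complex x y) \<partial>lborel \<partial>lborel)"
    by (subst lborel.nn_integral_fst[symmetric]) auto
  finally show ?thesis .
qed

lemma borel_measurable_cosh [measurable (raw)]:
  fixes f :: "'a \<Rightarrow> real"
  assumes [measurable]: "f \<in> borel_measurable M"
  shows "(\<lambda>x. cosh (f x)) \<in> borel_measurable M"
  unfolding cosh_def by measurable

text \<open>Exponential decay of any order, from \<open>cosh t \<ge> exp t / 2\<close> and \<open>exp (- y) \<le> n! / y\<^sup>n\<close>.  It dominates the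
factor \<open>cosh (\<nu> t)\<close> in the integrand of the Bessel function.\<close>

lemma exp_neg_cosh_le:
  assumes "x > 0" "t \<ge> 0"
  shows "exp (- x * cosh t) \<le> fact n * (2 / x) ^ n * exp (- real n * t)"
proof -
  define y where "y = x * exp t / 2"
  have y: "y > 0" using assms by (simp add: y_def)
  have "exp (- x * cosh t) \<le> exp (- y)"
    using assms by (simp add: y_def cosh_def algebra_simps)
  also have "\<dots> = 1 / exp y" by (simp add: exp_minus field_simps)
  also have "\<dots> \<le> 1 / (y ^ n / fact n)"
  proof -
    have "y ^ n / fact n \<le> exp y"
    proof -
      have "(\<lambda>k. y ^ k / fact k) sums exp y" using exp_converges[of y] by (simp add: divide_inverse mult.commute)
      then have s: "summable (\<lambda>k. y ^ k / fact k)" "suminf (\<lambda>k. y ^ k / fact k) = exp y"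
        by (auto simp: sums_iff)
      have "(\<Sum>k\<in>{n}. y ^ k / fact k) \<le> suminf (\<lambda>k. y ^ k / fact k)"
        using y by (intro sum_le_suminf s) auto
      then show ?thesis using s by simp
    qed
    then show ?thesis using y by (intro divide_left_mono mult_pos_pos) auto
  qed
  also have "\<dots> = fact n * (2 / x) ^ n * exp (- real n * t)"
    using assms by (simp add: y_def power_divide power_mult_distrib exp_of_nat_mult[symmetric] exp_minus field_simps)
  finally show ?thesis .
qed

lemma set_integrable_exp_neg: "set_integrable lborel {0..} (\<lambda>t::real. exp (- t))"
proof -
  have "(\<lambda>t::real. exp (- 1 * t)) absolutely_integrable_on {0..}"
  proof (rule nonnegative_absolutely_integrable_1)
    show "(\<lambda>t::real. exp (- 1 * t)) integrable_on {0..}"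
      using has_integral_exp_minus_to_infinity[of 1 0] unfolding integrable_on_def by auto
  qed auto
  then show ?thesis
    unfolding set_integrable_def by (subst (asm) integrable_completion) auto
qed

lemma bessel_integrable:
  fixes x \<nu> :: real
  assumes x: "x > 0"
  shows "set_integrable lborel {0..} (\<lambda>t. exp (- x * cosh t) * cosh (\<nu> * t))"
proof -
  obtain n :: nat where n: "\<bar>\<nu>\<bar> + 1 \<le> real n" using real_arch_simple by blast
  define C where "C = fact n * (2 / x) ^ n"
  have C: "C \<ge> 0" using x by (simp add: C_def)
  have "set_integrable lborel {0..} (\<lambda>t. C * exp (- t))"
    using set_integrable_exp_neg by simp
  then show ?thesis
  proof (rule set_integrable_bound)
    show "set_borel_measurable lborel {0..} (\<lambda>t. exp (- x * cosh t) * cosh (\<nu> * t))"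
      unfolding set_borel_measurable_def by measurable
    show "AE t in lborel. t \<in> {0..} \<longrightarrow> norm (exp (- x * cosh t) * cosh (\<nu> * t)) \<le> norm (C * exp (- t))"
    proof (intro AE_I2 impI)
      fix t :: real assume t: "t \<in> {0..}"
      have "cosh (\<nu> * t) = cosh \<bar>\<nu> * t\<bar>" by (simp add: abs_if)
      also have "\<dots> \<le> exp \<bar>\<nu> * t\<bar>" unfolding cosh_def using exp_le_cancel_iff[of "-\<bar>\<nu> * t\<bar>" "\<bar>\<nu> * t\<bar>"] by simp
      also have "\<dots> \<le> exp ((real n - 1) * t)" using t n by (simp add: abs_mult mult_right_mono)
      finally have "exp (- x * cosh t) * cosh (\<nu> * t) \<le> (C * exp (- real n * t)) * exp ((real n - 1) * t)"
        using exp_neg_cosh_le[OF x, of t n] t C unfolding C_def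
        by (intro mult_mono) (auto simp: less_imp_le cosh_real_nonneg)
      also have "\<dots> = C * exp (- t)"
        by (simp add: exp_add[symmetric] algebra_simps mult.assoc)
      finally show "norm (exp (- x * cosh t) * cosh (\<nu> * t)) \<le> norm (C * exp (- t))"
        using C by (simp add: abs_mult cosh_real_nonneg)
    qed
  qed
qed

lemma bessel_K_pos:
  assumes x: "x > 0"
  shows "bessel_K \<nu> x > 0"
proof -
  let ?f = "\<lambda>t. indicator {0..} t *\<^sub>R (exp (- x * cosh t) * cosh (\<nu> * t)) :: real"
  have int: "integrable lborel ?f" using bessel_integrable[OF x] unfolding set_integrable_def .
  have nn: "0 \<le> ?f t" for t by (auto simp: indicator_def cosh_real_nonneg)
  have "bessel_K \<nu> x \<noteq> 0"
  proof
    assume "bessel_K \<nu> x = 0"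
    then have "AE t in lborel. ?f t = 0"
      using integral_nonneg_eq_0_iff_AE[OF int] nn unfolding bessel_K_def set_lebesgue_integral_def by auto
    then have "AE t in lborel. t \<notin> {0..1::real}"
      by eventually_elim (auto simp: indicator_def cosh_real_pos less_imp_neq)
    moreover have "{t \<in> space lborel. \<not> t \<notin> {0..1::real}} = {0..1}" by auto
    ultimately have "emeasure lborel {0..1::real} = 0"
      by (subst (asm) AE_iff_measurable) auto
    then show False by simp
  qed
  moreover have "bessel_K \<nu> x \<ge> 0"
    unfolding bessel_K_def set_lebesgue_integral_def using nn by (rule Bochner_Integration.integral_nonneg)
  ultimately show ?thesis by simp
qed

text \<open>Near \<open>x\<close> the integrands are dominated by the integrand at \<open>x / 2\<close>.\<close>

lemma continuous_on_bessel_K: "continuous_on {0<..} (bessel_K \<nu>)"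
proof (rule continuous_at_imp_continuous_on, safe)
  fix x :: real assume "x > 0"
  show "isCont (bessel_K \<nu>) x"
    unfolding continuous_at_sequentially
  proof (intro allI impI)
    fix u assume u: "u \<longlonglongrightarrow> x"
    then have ev: "eventually (\<lambda>n. u n > x / 2) sequentially"
      using \<open>x > 0\<close> by (intro order_tendstoD) auto
    then obtain N where N: "\<And>n. n \<ge> N \<Longrightarrow> u n > x / 2" by (auto simp: eventually_sequentially)
    let ?f = "\<lambda>x t. indicator {0..} t *\<^sub>R (exp (- x * cosh t) * cosh (\<nu> * t)) :: real"
    have m[measurable]: "?f y \<in> borel_measurable lborel" for y
      by measurable
    have "(\<lambda>n. integral\<^sup>L lborel (?f (u (n + N)))) \<longlonglongrightarrow> integral\<^sup>L lborel (?f x)"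
    proof (rule integral_dominated_convergence[where w = "?f (x / 2)"])
      show "integrable lborel (?f (x / 2))"
        using bessel_integrable[of "x / 2" \<nu>] \<open>x > 0\<close> unfolding set_integrable_def by simp
      show "AE t in lborel. (\<lambda>n. ?f (u (n + N)) t) \<longlonglongrightarrow> ?f x t"
        by (intro AE_I2 tendsto_intros LIMSEQ_ignore_initial_segment[OF u])
      show "AE t in lborel. norm (?f (u (n + N)) t) \<le> ?f (x / 2) t" for n
      proof (intro AE_I2)
        fix t :: real
        have "exp (- u (n + N) * cosh t) \<le> exp (- (x / 2) * cosh t)"
          using N[of "n + N"] by (simp add: mult_right_mono cosh_real_nonneg)
        then show "norm (?f (u (n + N)) t) \<le> ?f (x / 2) t"
          by (auto simp: indicator_def abs_mult cosh_real_nonneg intro!: mult_right_mono)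
      qed
    qed auto
    then have "(\<lambda>n. bessel_K \<nu> (u (n + N))) \<longlonglongrightarrow> bessel_K \<nu> x"
      unfolding bessel_K_def set_lebesgue_integral_def .
    then show "(bessel_K \<nu> \<circ> u) \<longlonglongrightarrow> bessel_K \<nu> x"
      using LIMSEQ_offset by (fastforce simp: o_def)
  qed
qed

lemma bessel_K_measurable [measurable]: "bessel_K \<nu> \<in> borel_measurable borel"
  unfolding bessel_K_def[abs_def] set_lebesgue_integral_def
  by measurable

text \<open>By symmetry \<open>cosh (\<nu> t)\<close> on the half-line can be replaced by \<open>exp (\<nu> t)\<close> on the whole line, which is
suited to the substitution \<open>s = r exp t\<close>.\<close>

lemma bessel_K_nn_integral:
  assumes x: "x > 0"
  shows "ennreal (2 * bessel_K \<nu> x) = (\<integral>\<^sup>+t. ennreal (exp (- x * cosh t + \<nu> * t)) \<partial>lborel)"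
proof -
  let ?g = "\<lambda>t. exp (- x * cosh t + \<nu> * t)"
  have "(\<integral>\<^sup>+t. ennreal (?g t) \<partial>lborel) = (\<integral>\<^sup>+t. ennreal (?g t) * indicator {0..} t + ennreal (?g t) * indicator {..<0} t \<partial>lborel)"
    by (intro nn_integral_cong) (auto simp: indicator_def)
  also have "\<dots> = (\<integral>\<^sup>+t. ennreal (?g t) * indicator {0..} t \<partial>lborel) + (\<integral>\<^sup>+t. ennreal (?g t) * indicator {..<0} t \<partial>lborel)"
    by (intro nn_integral_add) auto
  also have "(\<integral>\<^sup>+t. ennreal (?g t) * indicator {..<0} t \<partial>lborel) = (\<integral>\<^sup>+t. ennreal (?g (- t)) * indicator {..<0} (- t) \<partial>lborel)"
    using nn_integral_real_affine[of "\<lambda>t. ennreal (?g t) * indicator {..<0} t" "-1" 0] by simp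
  also have "\<dots> = (\<integral>\<^sup>+t. ennreal (?g (- t)) * indicator {0..} t \<partial>lborel)"
  proof (rule nn_integral_cong_AE)
    have "AE t in lborel. t \<noteq> (0::real)" by (rule AE_lborel_singleton)
    then show "AE t in lborel. ennreal (?g (- t)) * indicator {..<0} (- t) = ennreal (?g (- t)) * indicator {0..} t"
      by eventually_elim (auto simp: indicator_def)
  qed
  also have "(\<integral>\<^sup>+t. ennreal (?g t) * indicator {0..} t \<partial>lborel) + (\<integral>\<^sup>+t. ennreal (?g (- t)) * indicator {0..} t \<partial>lborel)
     = (\<integral>\<^sup>+t. ennreal (?g t) * indicator {0..} t + ennreal (?g (- t)) * indicator {0..} t \<partial>lborel)"
    by (intro nn_integral_add[symmetric]) auto
  also have "\<dots> = (\<integral>\<^sup>+t. ennreal (2 * (indicator {0..} t *\<^sub>R (exp (- x * cosh t) * cosh (\<nu> * t)))) \<partial>lborel)"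
  proof (intro nn_integral_cong)
    fix t :: real
    have "?g t + ?g (- t) = 2 * (exp (- x * cosh t) * cosh (\<nu> * t))"
      by (simp add: exp_add exp_diff cosh_def[of "\<nu> * t"] exp_minus field_simps)
    then show "ennreal (?g t) * indicator {0..} t + ennreal (?g (- t)) * indicator {0..} t =
         ennreal (2 * (indicator {0..} t *\<^sub>R (exp (- x * cosh t) * cosh (\<nu> * t))))"
      by (auto simp: indicator_def ennreal_plus[symmetric] simp del: ennreal_plus)
  qed
  also have "\<dots> = ennreal (\<integral>t. 2 * (indicator {0..} t *\<^sub>R (exp (- x * cosh t) * cosh (\<nu> * t))) \<partial>lborel)"
    using bessel_integrable[OF x, of \<nu>] unfolding set_integrable_def
    by (intro nn_integral_eq_integral) (auto simp: indicator_def cosh_real_nonneg)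
  also have "\<dots> = ennreal (2 * bessel_K \<nu> x)"
    unfolding bessel_K_def set_lebesgue_integral_def by simp
  finally show ?thesis by simp
qed

lemma nn_integral_exp_substitution:
  fixes f :: "real \<Rightarrow> real"
  assumes r: "r > 0" and [measurable]: "f \<in> borel_measurable borel" and nn: "\<And>s. f s \<ge> 0"
  shows "(\<integral>\<^sup>+t. ennreal (f (r * exp t) * (r * exp t)) \<partial>lborel) = (\<integral>\<^sup>+s. ennreal (f s) * indicator {0<..} s \<partial>lborel)"
proof -
  let ?I = "\<lambda>n::nat. {- real n..real n}"
  let ?J = "\<lambda>n::nat. {r * exp (- real n)..r * exp (real n)}"
  have "(\<integral>\<^sup>+t. ennreal (f (r * exp t) * (r * exp t)) \<partial>lborel) = (\<integral>\<^sup>+t. (SUP n. ennreal (f (r * exp t) * (r * exp t)) * indicator (?I n) t) \<partial>lborel)"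
  proof (intro nn_integral_cong)
    fix t :: real
    obtain n where n: "\<bar>t\<bar> \<le> real n" using real_arch_simple by blast
    then have "t \<in> ?I n" by auto
    show "ennreal (f (r * exp t) * (r * exp t)) = (SUP n. ennreal (f (r * exp t) * (r * exp t)) * indicator (?I n) t)"
      by (rule antisym, rule SUP_upper2[of n], insert \<open>t \<in> ?I n\<close>, auto intro!: SUP_least simp: indicator_def)
  qed
  also have "\<dots> = (SUP n. \<integral>\<^sup>+t. ennreal (f (r * exp t) * (r * exp t)) * indicator (?I n) t \<partial>lborel)"
    by (intro nn_integral_monotone_convergence_SUP) (auto simp: incseq_def le_fun_def indicator_def)
  also have "(\<lambda>n. \<integral>\<^sup>+t. ennreal (f (r * exp t) * (r * exp t)) * indicator (?I n) t \<partial>lborel) =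
             (\<lambda>n. \<integral>\<^sup>+s. ennreal (f s) * indicator (?J n) s \<partial>lborel)"
  proof
    fix n
    have "(\<integral>\<^sup>+s. ennreal (f s * indicator (?J n) s) \<partial>lborel) = (\<integral>\<^sup>+t. ennreal (f (r * exp t) * (r * exp t) * indicator (?I n) t) \<partial>lborel)"
      by (rule nn_integral_substitution)
         (use r in \<open>auto simp: set_borel_measurable_def intro!: derivative_eq_intros continuous_intros\<close>)
    then show "(\<integral>\<^sup>+t. ennreal (f (r * exp t) * (r * exp t)) * indicator (?I n) t \<partial>lborel) = (\<integral>\<^sup>+s. ennreal (f s) * indicator (?J n) s \<partial>lborel)"
      by (simp add: nn_integral_set_ennreal)
  qed
  also have "(SUP n. \<integral>\<^sup>+s. ennreal (f s) * indicator (?J n) s \<partial>lborel) = (\<integral>\<^sup>+s. (SUP n. ennreal (f s) * indicator (?J n) s) \<partial>lborel)"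
  proof (intro nn_integral_monotone_convergence_SUP[symmetric])
    show "incseq (\<lambda>n s. ennreal (f s) * indicator (?J n) s)"
    proof (intro incseq_SucI le_funI mult_left_mono)
      fix n s
      have "r * exp (- real (Suc n)) \<le> r * exp (- real n)" "r * exp (real n) \<le> r * exp (real (Suc n))"
        using r by auto
      then show "(indicator (?J n) s :: ennreal) \<le> indicator (?J (Suc n)) s"
        by (auto simp: indicator_def)
    qed auto
  qed auto
  also have "\<dots> = (\<integral>\<^sup>+s. ennreal (f s) * indicator {0<..} s \<partial>lborel)"
  proof (intro nn_integral_cong)
    fix s :: real
    show "(SUP n. ennreal (f s) * indicator (?J n) s) = ennreal (f s) * indicator {0<..} s"
    proof (cases "s > 0")
      case True
      obtain n where n: "\<bar>ln (s / r)\<bar> \<le> real n" using real_arch_simple by blast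
      have "exp (- real n) \<le> exp (ln (s / r))" "exp (ln (s / r)) \<le> exp (real n)" using n by auto
      then have "s \<in> ?J n" using True r by (auto simp: field_simps)
      then show ?thesis using True
        by (intro antisym) (auto intro!: SUP_least SUP_upper2[of n] simp: indicator_def)
    next
      case False
      then have "s \<notin> ?J n" for n using r by (auto simp: not_le intro: order.strict_trans1[of s 0])
      then have z: "indicator (?J n) s = (0::ennreal)" for n by (intro indicator_simps(2))
      have "indicator {0<..} s = (0::ennreal)" using False by simp
      then show ?thesis by (simp only: z mult_zero_right SUP_const UNIV_not_empty simp_thms)
    qed
  qed
  finally show ?thesis .
qed

text \<open>If \<open>r\<close> is the modulus of a complex number, the integrand on the right is for each \<open>s\<close> a Gaussian function of
that number.  This is what turns the Bessel weight into a mixture of Gaussians.\<close>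

lemma bessel_K_mixture:
  assumes r: "r > 0" and a: "a > 0"
  shows "ennreal (2 * (bessel_K \<nu> (a * r) * r powr \<nu>)) =
    (\<integral>\<^sup>+s. ennreal (s powr (\<nu> - 1) * exp (- (a / 2) * (s + r\<^sup>2 / s))) * indicator {0<..} s \<partial>lborel)"
proof -
  have "ennreal (2 * (bessel_K \<nu> (a * r) * r powr \<nu>)) = ennreal (r powr \<nu>) * ennreal (2 * bessel_K \<nu> (a * r))"
    using bessel_K_pos[of "a * r" \<nu>] r a by (simp flip: ennreal_mult add: mult_ac)
  also have "\<dots> = (\<integral>\<^sup>+t. ennreal (r powr \<nu>) * ennreal (exp (- (a * r) * cosh t + \<nu> * t)) \<partial>lborel)"
    using r a by (subst bessel_K_nn_integral) (auto intro!: nn_integral_cmult[symmetric] borel_measurable_continuous_onI continuous_intros measurable_compose[OF _ measurable_ennreal])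
  also have "\<dots> = (\<integral>\<^sup>+t. ennreal (((\<lambda>s. s powr (\<nu> - 1) * exp (- (a / 2) * (s + r\<^sup>2 / s))) (r * exp t)) * (r * exp t)) \<partial>lborel)"
  proof (intro nn_integral_cong)
    fix t :: real
    define s where "s = r * exp t"
    have s: "s > 0" using r by (simp add: s_def)
    have 1: "(a * r) * cosh t = a / 2 * (s + r\<^sup>2 / s)"
      using r by (simp add: s_def cosh_def exp_minus field_simps power2_eq_square)
    have "s powr (\<nu> - 1) * s = s powr \<nu>" using s powr_mult_base[of s "\<nu> - 1"] by (simp add: mult.commute)
    also have "\<dots> = r powr \<nu> * exp (\<nu> * t)" using r by (simp add: s_def powr_mult exp_powr_real mult.commute)
    finally have 2: "s powr (\<nu> - 1) * s = r powr \<nu> * exp (\<nu> * t)" .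
    have "s powr (\<nu> - 1) * exp (- (a / 2) * (s + r\<^sup>2 / s)) * s = (s powr (\<nu> - 1) * s) * exp (- (a / 2 * (s + r\<^sup>2 / s)))"
      by (simp add: mult_ac)
    also have "\<dots> = r powr \<nu> * exp (- (a * r) * cosh t + \<nu> * t)"
      unfolding 2 1[symmetric] by (simp add: mult_exp_exp)
    finally show "ennreal (r powr \<nu>) * ennreal (exp (- (a * r) * cosh t + \<nu> * t)) =
       ennreal (((\<lambda>s. s powr (\<nu> - 1) * exp (- (a / 2) * (s + r\<^sup>2 / s))) (r * exp t)) * (r * exp t))"
      unfolding s_def[symmetric] by (simp flip: ennreal_mult)
  qed
  also have "\<dots> = (\<integral>\<^sup>+s. ennreal (s powr (\<nu> - 1) * exp (- (a / 2) * (s + r\<^sup>2 / s))) * indicator {0<..} s \<partial>lborel)"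
    using r by (subst nn_integral_exp_substitution) auto
  finally show ?thesis .
qed

section \<open>Moments of a gamma mixture and Laguerre polynomials\<close>

text \<open>Let \<open>Z = \<tau> s + G\<close>, where for given \<open>s\<close> the variable \<open>G\<close> is a centred, rotationally symmetric Gaussian with
\<open>E |G|\<^sup>2 = \<omega> s\<close>.  For given \<open>s\<close>, the expectation of \<open>Z\<^sup>i (cnj Z)\<^sup>j\<close> is the polynomial
\<open>\<Sum>p. mix_coeff \<tau> \<omega> i j p s\<^bsup>i + j - p\<^esup>\<close>; the index \<open>p\<close> counts the pairings of \<open>G\<close> with its conjugate.\<close>

definition mix_coeff :: "real \<Rightarrow> real \<Rightarrow> nat \<Rightarrow> nat \<Rightarrow> nat \<Rightarrow> real" where
  "mix_coeff \<tau> \<omega> i j p = real (i choose p) * real (j choose p) * fact p * \<omega> ^ p * \<tau> ^ (i - p) * \<tau> ^ (j - p)"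

text \<open>The sequence \<open>M\<close> stands for the powers of \<open>s\<close> if \<open>s\<close> is fixed, and for the moments of \<open>s\<close> if \<open>s\<close> is random.\<close>

definition mix_moment :: "real \<Rightarrow> real \<Rightarrow> (nat \<Rightarrow> real) \<Rightarrow> nat \<Rightarrow> nat \<Rightarrow> real" where
  "mix_moment \<tau> \<omega> M i j = (\<Sum>p\<le>i. mix_coeff \<tau> \<omega> i j p * M (i + j - p))"

lemma mix_moment_extend:
  assumes "n \<ge> i" shows "mix_moment \<tau> \<omega> M i j = (\<Sum>p\<le>n. mix_coeff \<tau> \<omega> i j p * M (i + j - p))"
  unfolding mix_moment_def using assms
  by (intro sum.mono_neutral_left) (auto simp: mix_coeff_def)

lemma mix_moment_sym: "mix_moment \<tau> \<omega> M i j = mix_moment \<tau> \<omega> M j i"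
  unfolding mix_moment_extend[of i "i + j", simplified] mix_moment_extend[of j "i + j", simplified]
  by (simp add: mix_coeff_def ac_simps)

lemma mix_moment_0: "mix_moment \<tau> \<omega> M 0 j = \<tau> ^ j * M j"
  by (simp add: mix_moment_def mix_coeff_def)

lemma mix_coeff_Suc_0: "mix_coeff \<tau> \<omega> (Suc i) j 0 = \<tau> * mix_coeff \<tau> \<omega> i j 0"
  by (simp add: mix_coeff_def)

lemma mix_coeff_Suc_Suc:
  "mix_coeff \<tau> \<omega> (Suc i) j (Suc q) = \<tau> * mix_coeff \<tau> \<omega> i j (Suc q) + \<omega> * real j * mix_coeff \<tau> \<omega> i (j - 1) q"
proof -
  have 1: "real (i choose Suc q) * \<tau> ^ (Suc i - Suc q) = real (i choose Suc q) * (\<tau> * \<tau> ^ (i - Suc q))"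
  proof (cases "Suc q \<le> i")
    case True
    then have "Suc i - Suc q = Suc (i - Suc q)" by simp
    then show ?thesis by simp
  qed simp
  have 2: "real (j choose Suc q) * fact (Suc q) = real j * (real (j - 1 choose q) * fact q)"
    using binomial_absorption[of q "j"] by (simp add: mult_ac flip: of_nat_mult of_nat_Suc)
  have 3: "j - Suc q = j - 1 - q" by simp
  have "mix_coeff \<tau> \<omega> (Suc i) j (Suc q) =
      (real (i choose Suc q) * \<tau> ^ (Suc i - Suc q)) * real (j choose Suc q) * fact (Suc q) * \<omega> ^ Suc q * \<tau> ^ (j - Suc q)
     + real (i choose q) * \<tau> ^ (i - q) * (real (j choose Suc q) * fact (Suc q)) * \<omega> ^ Suc q * \<tau> ^ (j - Suc q)"
    by (simp add: mix_coeff_def algebra_simps del: fact_Suc power_Suc)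
  also have "\<dots> = \<tau> * mix_coeff \<tau> \<omega> i j (Suc q) + \<omega> * real j * mix_coeff \<tau> \<omega> i (j - 1) q"
    unfolding 1 2 3 by (simp add: mix_coeff_def mult_ac del: fact_Suc)
  finally show ?thesis .
qed

text \<open>Gaussian integration by parts, \<open>E (Z f) = \<tau> s E f + \<omega> s E (\<partial> f / \<partial> cnj z)\<close> for given \<open>s\<close>, as an identity
between coefficients.  The factor \<open>s\<close> shifts the sequence \<open>M\<close>.\<close>

lemma mix_moment_Suc:
  "mix_moment \<tau> \<omega> M (Suc i) j = \<tau> * mix_moment \<tau> \<omega> (\<lambda>n. M (Suc n)) i j
     + \<omega> * real j * mix_moment \<tau> \<omega> (\<lambda>n. M (Suc n)) i (j - 1)"
proof -
  let ?c = "mix_coeff \<tau> \<omega>"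
  have idx: "?c i j p * M (Suc i + j - p) = ?c i j p * M (Suc (i + j - p))" for p
    by (cases "p \<le> i") (auto simp: Suc_diff_le mix_coeff_def)
  have idx2: "real j * ?c i (j - 1) q * M (Suc i + j - Suc q) = real j * ?c i (j - 1) q * M (Suc (i + (j - 1) - q))" for q
  proof (cases "j = 0 \<or> \<not> q \<le> i")
    case False
    then have "Suc i + j - Suc q = Suc (i + (j - 1) - q)" by auto
    then show ?thesis by simp
  qed (auto simp: mix_coeff_def)
  have "mix_moment \<tau> \<omega> M (Suc i) j = ?c (Suc i) j 0 * M (Suc i + j - 0) + (\<Sum>q\<le>i. ?c (Suc i) j (Suc q) * M (Suc i + j - Suc q))"
    unfolding mix_moment_def by (subst sum.atMost_Suc_shift) simp
  also have "\<dots> = \<tau> * (?c i j 0 * M (Suc i + j - 0) + (\<Sum>q\<le>i. ?c i j (Suc q) * M (Suc i + j - Suc q)))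
      + \<omega> * (\<Sum>q\<le>i. real j * ?c i (j - 1) q * M (Suc i + j - Suc q))"
    unfolding mix_coeff_Suc_Suc mix_coeff_Suc_0
    by (simp only: distrib_left distrib_right sum.distrib sum_distrib_left mult.assoc add.assoc)
  also have "?c i j 0 * M (Suc i + j - 0) + (\<Sum>q\<le>i. ?c i j (Suc q) * M (Suc i + j - Suc q)) = (\<Sum>p\<le>Suc i. ?c i j p * M (Suc i + j - p))"
    by (subst sum.atMost_Suc_shift) simp
  also have "\<dots> = mix_moment \<tau> \<omega> (\<lambda>n. M (Suc n)) i j"
    unfolding idx by (rule mix_moment_extend[symmetric]) simp
  also have "(\<Sum>q\<le>i. real j * ?c i (j - 1) q * M (Suc i + j - Suc q)) = real j * mix_moment \<tau> \<omega> (\<lambda>n. M (Suc n)) i (j - 1)"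
    unfolding idx2 mix_moment_def by (simp add: sum_distrib_left mult_ac)
  finally show ?thesis by simp
qed

text \<open>Here \<open>s\<close> has the gamma law with shape \<open>\<nu> + 1\<close> and scale \<open>\<delta>\<close>.  The variance parameter is tied to \<open>\<tau>\<close> by
\<open>\<omega> = (1 - \<tau>\<^sup>2) \<delta>\<close>; this is the relation under which Laguerre polynomials become orthogonal.\<close>

locale gamma_mixture =
  fixes \<tau> \<delta> \<nu> :: real
  assumes \<tau>: "\<tau> \<noteq> 0" and \<delta>: "\<delta> \<noteq> 0" and \<nu>: "\<nu> > -1"
begin

abbreviation "\<theta> \<equiv> 1 - \<tau>\<^sup>2"

definition gamma_moment :: "nat \<Rightarrow> real" where "gamma_moment n = pochhammer (\<nu> + 1) n * \<delta> ^ n"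

lemma gamma_moment_Suc: "gamma_moment (Suc n) = \<delta> * (\<nu> + 1 + real n) * gamma_moment n"
  by (simp add: gamma_moment_def pochhammer_Suc)

definition mixed_moment where "mixed_moment = mix_moment \<tau> (\<theta> * \<delta>) gamma_moment"
text \<open>The moments with an additional factor \<open>s\<close>.\<close>

definition mixed_moment1 where "mixed_moment1 = mix_moment \<tau> (\<theta> * \<delta>) (\<lambda>n. gamma_moment (Suc n))"

lemma mixed_moment_Suc: "mixed_moment (Suc i) j = \<tau> * mixed_moment1 i j + \<theta> * \<delta> * real j * mixed_moment1 i (j - 1)"
  unfolding mixed_moment_def mixed_moment1_def by (rule mix_moment_Suc)

lemma mixed_moment_Suc': "mixed_moment i (Suc j) = \<tau> * mixed_moment1 i j + \<theta> * \<delta> * real i * mixed_moment1 (i - 1) j"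
  using mixed_moment_Suc[of j i] unfolding mixed_moment_def mixed_moment1_def by (simp only: mix_moment_sym[of _ _ _ "Suc j" i] mix_moment_sym[of _ _ _ j i] mix_moment_sym[of _ _ _ j "i - 1"])

text \<open>Integration by parts for the gamma law, \<open>E (s g(s)) = \<delta> (\<nu> + 1) E g(s) + \<delta> E (s g'(s))\<close>, applied to the
conditional moment; it holds term by term.\<close>

lemma mixed_moment1_gamma: "mixed_moment1 i j = \<delta> * (\<nu> + 1 + real j) * mixed_moment i j + \<delta> * \<tau> * real i * mixed_moment1 (i - 1) j"
proof -
  let ?c = "mix_coeff \<tau> (\<theta> * \<delta>)"
  have "?c i j p * gamma_moment (Suc (i + j - p)) = \<delta> * (\<nu> + 1 + real j) * (?c i j p * gamma_moment (i + j - p)) +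
      \<delta> * \<tau> * real i * (?c (i - 1) j p * gamma_moment (Suc (i - 1 + j - p)))" for p
  proof (cases "p \<le> i")
    case False
    then show ?thesis by (simp add: mix_coeff_def binomial_eq_0)
  next
    case True
    show ?thesis
    proof (cases "p = i")
      case True
      then show ?thesis by (cases i) (simp_all add: mix_coeff_def gamma_moment_Suc)
    next
      case False
      with True have p: "p < i" by simp
      then obtain i' where i: "i = Suc i'" by (cases i) auto
      have b: "real (i - p) * real (i choose p) = real i * real (i' choose p)"
        using binomial_absorb_comp[of i p] unfolding i by (metis diff_Suc_1 of_nat_mult)
      have "i - p = Suc (i' - p)" using p i by simp
      then have t: "\<tau> ^ (i - p) = \<tau> * \<tau> ^ (i' - p)" by simp
      have "real (i - p) * ?c i j p = (real (i - p) * real (i choose p)) * (real (j choose p) * fact p * (\<theta> * \<delta>) ^ p * \<tau> ^ (i - p) * \<tau> ^ (j - p))"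
        by (simp only: mix_coeff_def ac_simps)
      also have "\<dots> = \<tau> * real i * ?c i' j p"
        unfolding b t by (simp only: mix_coeff_def ac_simps)
      finally have c: "real (i - p) * ?c i j p = \<tau> * real i * ?c i' j p" .
      have e: "Suc (i - 1 + j - p) = i + j - p" using p i by auto
      have "real (i + j - p) = real (i - p) + real j" using p by simp
      then have "?c i j p * gamma_moment (Suc (i + j - p)) = \<delta> * (\<nu> + 1 + real j) * (?c i j p * gamma_moment (i + j - p))
          + \<delta> * (real (i - p) * ?c i j p) * gamma_moment (i + j - p)"
        unfolding gamma_moment_Suc by (simp only: distrib_left distrib_right ac_simps)
      then show ?thesis unfolding e c by (simp add: i mult_ac)
    qed
  qed
  then have "mixed_moment1 i j = (\<Sum>p\<le>i. \<delta> * (\<nu> + 1 + real j) * (?c i j p * gamma_moment (i + j - p)) +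
      \<delta> * \<tau> * real i * (?c (i - 1) j p * gamma_moment (Suc (i - 1 + j - p))))"
    unfolding mixed_moment1_def mix_moment_def by (simp only:)
  also have "\<dots> = \<delta> * (\<nu> + 1 + real j) * mixed_moment i j + \<delta> * \<tau> * real i * mixed_moment1 (i - 1) j"
    unfolding mixed_moment_def mixed_moment1_def
    by (subst mix_moment_extend[of "i - 1" i], simp)
       (simp only: mix_moment_def sum.distrib sum_distrib_left)
  finally show ?thesis .
qed

text \<open>The factor \<open>s\<close> can be traded for a factor \<open>cnj Z\<close>: this combines both integrations by parts and uses
\<open>\<tau>\<^sup>2 + \<theta> = 1\<close>.\<close>

lemma mixed_moment1_eq: "mixed_moment1 i j = \<tau> * mixed_moment i (Suc j) + \<theta> * \<delta> * (\<nu> + 1 + real j) * mixed_moment i j"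
proof -
  have "\<tau> * mixed_moment i (Suc j) + \<theta> * \<delta> * (\<nu> + 1 + real j) * mixed_moment i j
      = \<tau>\<^sup>2 * mixed_moment1 i j + \<theta> * (\<delta> * (\<nu> + 1 + real j) * mixed_moment i j + \<delta> * \<tau> * real i * mixed_moment1 (i - 1) j)"
    unfolding mixed_moment_Suc' by (simp only: power2_eq_square distrib_left distrib_right ac_simps)
  also have "\<dots> = mixed_moment1 i j" unfolding mixed_moment1_gamma[symmetric] by (simp only: left_diff_distrib mult_1_left)
  finally show ?thesis ..
qed

text \<open>Consequently multiplication by \<open>z\<close> on the holomorphic side equals a second order differential operator
on the antiholomorphic side.  This determines the pairing of any polynomial with the powers of
\<open>cnj z\<close> from the row \<open>i = 0\<close>.\<close>

lemma mixed_moment_Suc_left: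
  "mixed_moment (Suc i) j = \<tau>\<^sup>2 * mixed_moment i (Suc j) + \<tau> * \<theta> * \<delta> * (2 * real j + \<nu> + 1) * mixed_moment i j
     + \<theta>\<^sup>2 * \<delta>\<^sup>2 * real j * (real j + \<nu>) * mixed_moment i (j - 1)"
proof (cases j)
  case 0
  then show ?thesis unfolding mixed_moment_Suc mixed_moment1_eq by (simp add: algebra_simps power2_eq_square)
next
  case (Suc j')
  have "mixed_moment (Suc i) j = \<tau> * mixed_moment1 i j + \<theta> * \<delta> * real j * mixed_moment1 i j'" using mixed_moment_Suc[of i j] Suc by simp
  also have "\<dots> = \<tau> * (\<tau> * mixed_moment i (Suc j) + \<theta> * \<delta> * (\<nu> + 1 + real j) * mixed_moment i j)
     + \<theta> * \<delta> * real j * (\<tau> * mixed_moment i j + \<theta> * \<delta> * (\<nu> + 1 + real j') * mixed_moment i j')"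
    by (simp only: mixed_moment1_eq Suc[symmetric])
  also have "\<nu> + 1 + real j' = real j + \<nu>" using Suc by simp
  also have "\<tau> * (\<tau> * mixed_moment i (Suc j) + \<theta> * \<delta> * (\<nu> + 1 + real j) * mixed_moment i j)
      + \<theta> * \<delta> * real j * (\<tau> * mixed_moment i j + \<theta> * \<delta> * (real j + \<nu>) * mixed_moment i j')
     = \<tau>\<^sup>2 * mixed_moment i (Suc j) + \<tau> * \<theta> * \<delta> * (2 * real j + \<nu> + 1) * mixed_moment i j
       + \<theta>\<^sup>2 * \<delta>\<^sup>2 * real j * (real j + \<nu>) * mixed_moment i j'" by Groebner_Basis.algebra
  finally show ?thesis using Suc by simp
qed

lemma mixed_moment_0: "mixed_moment 0 j = \<tau> ^ j * gamma_moment j"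
  unfolding mixed_moment_def by (rule mix_moment_0)

text \<open>In terms of the classical polynomials this is \<open>k! (- \<tau> \<delta>)\<^sup>k L\<^sub>k(x / (\<tau> \<delta>))\<close> with parameter \<open>\<nu>\<close>.\<close>

fun laguerre :: "nat \<Rightarrow> real poly" where
  "laguerre 0 = 1"
| "laguerre (Suc 0) = [:- (\<tau> * \<delta> * (\<nu> + 1)), 1:]"
| "laguerre (Suc (Suc k)) = pCons 0 (laguerre (Suc k)) - Polynomial.smult (\<tau> * \<delta> * (2 * real (Suc k) + \<nu> + 1)) (laguerre (Suc k))
      - Polynomial.smult (\<tau>\<^sup>2 * \<delta>\<^sup>2 * real (Suc k) * (real (Suc k) + \<nu>)) (laguerre k)"

lemma laguerre_Suc:
  "laguerre (Suc k) = pCons 0 (laguerre k) - Polynomial.smult (\<tau> * \<delta> * (2 * real k + \<nu> + 1)) (laguerre k)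
      - Polynomial.smult (\<tau>\<^sup>2 * \<delta>\<^sup>2 * real k * (real k + \<nu>)) (laguerre (k - 1))"
  by (cases k) (auto simp: one_pCons)

lemma laguerre_monic: "degree (laguerre k) = k \<and> coeff (laguerre k) k = 1"
proof (induction k rule: less_induct)
  case (less k)
  show ?case
  proof (cases k)
    case 0
    then show ?thesis by simp
  next
    case (Suc n)
    let ?r = "Polynomial.smult (\<tau> * \<delta> * (2 * real n + \<nu> + 1)) (laguerre n)
      + Polynomial.smult (\<tau>\<^sup>2 * \<delta>\<^sup>2 * real n * (real n + \<nu>)) (laguerre (n - 1))"
    have IH: "degree (laguerre n) = n" "coeff (laguerre n) n = 1" "degree (laguerre (n - 1)) = n - 1"
      using less.IH[of n] less.IH[of "n - 1"] Suc by auto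
    have e: "laguerre k = pCons 0 (laguerre n) - ?r" unfolding Suc laguerre_Suc by simp
    have r: "degree ?r \<le> n"
      using IH by (intro degree_add_le) (auto intro: order_trans[OF degree_smult_le])
    have c: "coeff (laguerre k) (Suc n) = 1"
      unfolding e using r IH by (simp add: coeff_eq_0)
    have "degree (laguerre k) \<le> Suc n"
      unfolding e using r IH by (intro degree_diff_le) (auto intro: order_trans[OF degree_pCons_le])
    moreover have "Suc n \<le> degree (laguerre k)" by (rule le_degree) (use c in simp)
    ultimately show ?thesis using c Suc by simp
  qed
qed

text \<open>The expectation of \<open>p(Z) (cnj Z)\<^sup>j\<close>.\<close>

definition pairing :: "real poly \<Rightarrow> nat \<Rightarrow> real" where
  "pairing p j = (\<Sum>i\<le>degree p. coeff p i * mixed_moment i j)"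

lemma pairing_extend: "degree p \<le> n \<Longrightarrow> pairing p j = (\<Sum>i\<le>n. coeff p i * mixed_moment i j)"
  unfolding pairing_def by (intro sum.mono_neutral_left) (auto simp: coeff_eq_0)

lemma pairing_diff: "pairing (p - q) j = pairing p j - pairing q j"
proof -
  let ?n = "max (degree p) (degree q)"
  have "pairing (p - q) j = (\<Sum>i\<le>?n. coeff (p - q) i * mixed_moment i j)"
    by (intro pairing_extend degree_diff_le_max)
  also have "\<dots> = (\<Sum>i\<le>?n. coeff p i * mixed_moment i j) - (\<Sum>i\<le>?n. coeff q i * mixed_moment i j)"
    by (simp add: algebra_simps sum_subtractf)
  finally show ?thesis by (simp add: pairing_extend[of p ?n] pairing_extend[of q ?n])
qed

lemma pairing_smult: "pairing (Polynomial.smult c p) j = c * pairing p j"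
proof -
  have "pairing (Polynomial.smult c p) j = (\<Sum>i\<le>degree p. coeff (Polynomial.smult c p) i * mixed_moment i j)"
    by (intro pairing_extend degree_smult_le)
  then show ?thesis by (simp add: pairing_def sum_distrib_left mult.assoc)
qed

lemma pairing_pCons: "pairing (pCons 0 p) j = \<tau>\<^sup>2 * pairing p (Suc j) + \<tau> * \<theta> * \<delta> * (2 * real j + \<nu> + 1) * pairing p j
     + \<theta>\<^sup>2 * \<delta>\<^sup>2 * real j * (real j + \<nu>) * pairing p (j - 1)"
proof -
  have "pairing (pCons 0 p) j = (\<Sum>i\<le>Suc (degree p). coeff (pCons 0 p) i * mixed_moment i j)"
    by (intro pairing_extend degree_pCons_le)
  also have "\<dots> = (\<Sum>i\<le>degree p. coeff p i * mixed_moment (Suc i) j)"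
    by (subst sum.atMost_Suc_shift) simp
  also have "\<dots> = (\<Sum>i\<le>degree p. \<tau>\<^sup>2 * (coeff p i * mixed_moment i (Suc j)) + \<tau> * \<theta> * \<delta> * (2 * real j + \<nu> + 1) * (coeff p i * mixed_moment i j)
     + \<theta>\<^sup>2 * \<delta>\<^sup>2 * real j * (real j + \<nu>) * (coeff p i * mixed_moment i (j - 1)))"
    unfolding mixed_moment_Suc_left by (intro sum.cong refl) (simp only: distrib_left mult_ac)
  also have "\<dots> = \<tau>\<^sup>2 * pairing p (Suc j) + \<tau> * \<theta> * \<delta> * (2 * real j + \<nu> + 1) * pairing p j
     + \<theta>\<^sup>2 * \<delta>\<^sup>2 * real j * (real j + \<nu>) * pairing p (j - 1)"
    by (simp only: pairing_def sum.distrib sum_distrib_left)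
  finally show ?thesis .
qed

text \<open>The coefficients of the powers of \<open>T\<close> agree one by one.\<close>

lemma binomial_identity:
  fixes T :: real
  assumes n: "n \<ge> 1" and j: "j \<ge> 1"
  defines "c \<equiv> \<lambda>j n. real (j choose n)"
  shows "T\<^sup>2 * (\<nu> + 1 + real j) * c (Suc j) n + T * (1 - T) * (2 * real j + \<nu> + 1) * c j n
      + (1 - T)\<^sup>2 * real j * c (j - 1) n - T * (2 * real n + \<nu> + 1) * c j n - T\<^sup>2 * (real n + \<nu>) * c j (n - 1)
     = (real n + 1) * c j (Suc n)"
proof -
  obtain n' where n': "n = Suc n'" using n by (cases n) auto
  obtain j' where j': "j = Suc j'" using j by (cases j) auto
  have 1: "(real n + 1) * c j (Suc n) = real j * c (j - 1) n"
    using binomial_absorption[of n j] unfolding c_def by (metis add.commute of_nat_Suc of_nat_mult)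
  have 2: "c (Suc j) n = c j n + c j (n - 1)" unfolding c_def n' by simp
  have 3: "real j * c (j - 1) n = (real j - real n) * c j n"
  proof (cases "n \<le> j")
    case True
    then show ?thesis using binomial_absorb_comp[of j n] unfolding c_def by (metis of_nat_diff of_nat_mult)
  qed (simp add: c_def binomial_eq_0)
  have 4: "real n * c j n = (real j - real n + 1) * c j (n - 1)"
  proof (cases "n' \<le> j")
    case True
    have "real n * c j n = real j * c (j - 1) n'"
      using binomial_absorption[of n' j] unfolding c_def n' by (metis of_nat_mult)
    also have "\<dots> = (real j - real n') * c j n'"
      using binomial_absorb_comp[of j n'] True unfolding c_def by (metis of_nat_diff of_nat_mult)
    finally show ?thesis by (simp add: n')
  qed (simp add: c_def n' binomial_eq_0)
  define A B C where "A = c j n" "B = c j (n - 1)" "C = real j * c (j - 1) n"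
  have "C = (real j - real n) * A" "real n * A = (real j - real n + 1) * B" using 3 4 by (auto simp: A_B_C_def)
  then have "T\<^sup>2 * (\<nu> + 1 + real j) * (A + B) + T * (1 - T) * (2 * real j + \<nu> + 1) * A
      + (1 - T)\<^sup>2 * C - T * (2 * real n + \<nu> + 1) * A - T\<^sup>2 * (real n + \<nu>) * B = C"
    by Groebner_Basis.algebra
  then show ?thesis unfolding 1 2 A_B_C_def by (simp add: mult.assoc)
qed

text \<open>The binomial coefficient vanishes for \<open>j < k\<close>, which is the orthogonality.  In the induction, the
three-term recurrence raises \<open>k\<close> while \<open>pairing_pCons\<close> moves the factor \<open>z\<close> to the index \<open>j\<close>; what
remains is \<open>binomial_identity\<close> with \<open>T = \<tau>\<^sup>2\<close>.\<close>

lemma pairing_laguerre: "pairing (laguerre k) j * \<tau> ^ k = fact k * \<delta> ^ k * gamma_moment j * real (j choose k) * \<tau> ^ j"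
proof (induction k arbitrary: j rule: less_induct)
  case (less k)
  show ?case
  proof (cases k)
    case 0
    then show ?thesis by (simp add: pairing_def mixed_moment_0)
  next
    case (Suc n)
    let ?p = "\<lambda>k j. pairing (laguerre k) j"
    have rec: "?p (Suc n) j = \<tau>\<^sup>2 * ?p n (Suc j) + \<tau> * \<theta> * \<delta> * (2 * real j + \<nu> + 1) * ?p n j
      + \<theta>\<^sup>2 * \<delta>\<^sup>2 * real j * (real j + \<nu>) * ?p n (j - 1) - \<tau> * \<delta> * (2 * real n + \<nu> + 1) * ?p n j
      - \<tau>\<^sup>2 * \<delta>\<^sup>2 * real n * (real n + \<nu>) * ?p (n - 1) j"
      by (simp only: laguerre_Suc pairing_diff pairing_smult pairing_pCons)
    have P: "?p n j = fact n * \<delta> ^ n * gamma_moment j * real (j choose n) * \<tau> ^ j / \<tau> ^ n" for j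
      using less.IH[of n j] Suc \<tau> by (simp add: field_simps)
    have P': "real n * ?p (n - 1) j = real n * (fact (n - 1) * \<delta> ^ (n - 1) * gamma_moment j * real (j choose (n - 1)) * \<tau> ^ j / \<tau> ^ (n - 1))" for j
      using less.IH[of "n - 1" j] Suc \<tau> by (cases n) (auto simp: field_simps)
    have gmj: "real j * (real j + \<nu>) * \<delta> * gamma_moment (j - 1) = real j * gamma_moment j"
      using gamma_moment_Suc[of "j - 1"] by (cases j) (auto simp: algebra_simps)
    have tj: "real j * (\<tau> ^ (j - 1) * \<tau>) = real j * \<tau> ^ j" by (cases j) auto
    let ?K = "fact n * \<delta> ^ Suc n * gamma_moment j * \<tau> ^ j / \<tau> ^ Suc n"
    have main: "?p (Suc n) j = ?K * ((real n + 1) * real (j choose Suc n))"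
    proof -
      have t1: "\<tau>\<^sup>2 * ?p n (Suc j) = ?K * ((\<tau>\<^sup>2)\<^sup>2 * (\<nu> + 1 + real j) * real (Suc j choose n))"
        unfolding P gamma_moment_Suc using \<tau> by (simp add: field_simps power2_eq_square)
      have t2: "\<tau> * \<theta> * \<delta> * (2 * real j + \<nu> + 1) * ?p n j = ?K *
          (\<tau>\<^sup>2 * \<theta> * (2 * real j + \<nu> + 1) * real (j choose n))"
        unfolding P using \<tau> by (simp add: field_simps power2_eq_square)
      have t3: "\<theta>\<^sup>2 * \<delta>\<^sup>2 * real j * (real j + \<nu>) * ?p n (j - 1) = ?K *
          (\<theta>\<^sup>2 * real j * real (j - 1 choose n))"
      proof -
        have "\<theta>\<^sup>2 * \<delta>\<^sup>2 * real j * (real j + \<nu>) * ?p n (j - 1) =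
          \<theta>\<^sup>2 * \<delta> ^ Suc n * (real j * (real j + \<nu>) * \<delta> * gamma_moment (j - 1)) * fact n * real (j - 1 choose n) * \<tau> ^ (j - 1) / \<tau> ^ n"
          unfolding P using \<tau> by (simp add: field_simps power2_eq_square)
        also have "\<dots> = \<theta>\<^sup>2 * \<delta> ^ Suc n * gamma_moment j * fact n * real (j - 1 choose n) * (real j * (\<tau> ^ (j - 1) * \<tau>)) / \<tau> ^ Suc n"
          unfolding gmj using \<tau> by (simp add: field_simps)
        also have "\<dots> = ?K * (\<theta>\<^sup>2 * real j * real (j - 1 choose n))"
          unfolding tj by (simp add: field_simps)
        finally show ?thesis .
      qed
      have t4: "\<tau> * \<delta> * (2 * real n + \<nu> + 1) * ?p n j = ?K *
         (\<tau>\<^sup>2 * (2 * real n + \<nu> + 1) * real (j choose n))"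
        unfolding P using \<tau> by (simp add: field_simps power2_eq_square)
      show ?thesis
      proof (cases "n = 0")
        case True
        have "?p (Suc n) j = ?K *
          ((\<tau>\<^sup>2)\<^sup>2 * (\<nu> + 1 + real j) * real (Suc j choose n) + \<tau>\<^sup>2 * \<theta> * (2 * real j + \<nu> + 1) * real (j choose n)
           + \<theta>\<^sup>2 * real j * real (j - 1 choose n) - \<tau>\<^sup>2 * (2 * real n + \<nu> + 1) * real (j choose n))"
          unfolding rec t1 t2 t3 t4 using True by (simp add: algebra_simps)
        also have "((\<tau>\<^sup>2)\<^sup>2 * (\<nu> + 1 + real j) * real (Suc j choose n) + \<tau>\<^sup>2 * \<theta> * (2 * real j + \<nu> + 1) * real (j choose n)
           + \<theta>\<^sup>2 * real j * real (j - 1 choose n) - \<tau>\<^sup>2 * (2 * real n + \<nu> + 1) * real (j choose n)) = (real n + 1) * real (j choose Suc n)"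
          using True by (simp add: algebra_simps power2_eq_square)
        finally show ?thesis .
      next
        case False
        then obtain n' where n': "n = Suc n'" by (cases n) auto
        have t5: "\<tau>\<^sup>2 * \<delta>\<^sup>2 * real n * (real n + \<nu>) * ?p (n - 1) j = ?K *
            ((\<tau>\<^sup>2)\<^sup>2 * (real n + \<nu>) * real (j choose (n - 1)))"
        proof -
          have "\<tau>\<^sup>2 * \<delta>\<^sup>2 * real n * (real n + \<nu>) * ?p (n - 1) j = \<tau>\<^sup>2 * \<delta>\<^sup>2 * (real n + \<nu>) * (real n * ?p (n - 1) j)"
            by (simp add: mult_ac)
          also have "\<dots> = ?K *
            ((\<tau>\<^sup>2)\<^sup>2 * (real n + \<nu>) * real (j choose (n - 1)))"
            by (subst P') (use \<tau> in \<open>simp add: n' field_simps power2_eq_square\<close>)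
          finally show ?thesis .
        qed
        have comb: "?p (Suc n) j = ?K *
          ((\<tau>\<^sup>2)\<^sup>2 * (\<nu> + 1 + real j) * real (Suc j choose n) + \<tau>\<^sup>2 * \<theta> * (2 * real j + \<nu> + 1) * real (j choose n)
           + \<theta>\<^sup>2 * real j * real (j - 1 choose n) - \<tau>\<^sup>2 * (2 * real n + \<nu> + 1) * real (j choose n)
           - (\<tau>\<^sup>2)\<^sup>2 * (real n + \<nu>) * real (j choose (n - 1)))"
          unfolding rec t1 t2 t3 t4 t5 by (simp only: distrib_left right_diff_distrib)
        have br: "((\<tau>\<^sup>2)\<^sup>2 * (\<nu> + 1 + real j) * real (Suc j choose n) + \<tau>\<^sup>2 * \<theta> * (2 * real j + \<nu> + 1) * real (j choose n)
           + \<theta>\<^sup>2 * real j * real (j - 1 choose n) - \<tau>\<^sup>2 * (2 * real n + \<nu> + 1) * real (j choose n)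
           - (\<tau>\<^sup>2)\<^sup>2 * (real n + \<nu>) * real (j choose (n - 1))) = (real n + 1) * real (j choose Suc n)"
        proof (cases "j = 0")
          case False
          then show ?thesis using binomial_identity[of n j "\<tau>\<^sup>2"] \<open>n \<noteq> 0\<close> by simp
        next
          case True
          then show ?thesis unfolding True n' by (cases n') (auto simp: algebra_simps)
        qed
        show ?thesis unfolding comb br ..
      qed
    qed
    show ?thesis unfolding Suc main using \<tau> by (simp add: field_simps)
  qed
qed

end

section \<open>Gaussian moments in the plane\<close>

definition std_normal :: "real measure" where "std_normal = density lborel (\<lambda>x. ennreal (std_normal_density x))"

lemma sets_std_normal [measurable_cong, simp]: "sets std_normal = sets borel" by (simp add: std_normal_def)
lemma space_std_normal [simp]: "space std_normal = UNIV" by (simp add: std_normal_def)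

lemma prob_space_std_normal: "prob_space std_normal"
  unfolding std_normal_def by (rule prob_space_normal_density) simp

interpretation std_normal: prob_space std_normal by (rule prob_space_std_normal)
interpretation G2: pair_prob_space std_normal std_normal ..

lemma integrable_std_normal_iff:
  fixes f :: "real \<Rightarrow> 'a::{banach, second_countable_topology}"
  shows "f \<in> borel_measurable borel \<Longrightarrow> integrable std_normal f \<longleftrightarrow> integrable lborel (\<lambda>x. std_normal_density x *\<^sub>R f x)"
  unfolding std_normal_def by (intro integrable_density) auto

lemma integral_std_normal_eq:
  fixes f :: "real \<Rightarrow> 'a::{banach, second_countable_topology}"
  shows "f \<in> borel_measurable borel \<Longrightarrow> integral\<^sup>L std_normal f = integral\<^sup>L lborel (\<lambda>x. std_normal_density x *\<^sub>R f x)"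
  unfolding std_normal_def by (intro integral_density) auto

lemma integrable_std_normal_power: "integrable std_normal (\<lambda>x. x ^ k)"
  by (subst integrable_std_normal_iff) (auto simp: integrable_std_normal_moment)

lemma integrable_std_normal_abs_power: "integrable std_normal (\<lambda>x. \<bar>x\<bar> ^ k)"
  by (subst integrable_std_normal_iff) (auto simp: integrable_std_normal_moment_abs)

lemma std_normal_moment_Suc: "(\<integral>x. x ^ Suc k \<partial>std_normal) = real k * (\<integral>x. x ^ (k - 1) \<partial>std_normal)"
proof -
  define M where "M k = (\<integral>x. x ^ k \<partial>std_normal)" for k
  have M: "M k = (\<integral>x. std_normal_density x * x ^ k \<partial>lborel)" for k
    unfolding M_def by (subst integral_std_normal_eq) auto
  have even: "M (2 * n) = fact (2 * n) / (2 ^ n * fact n)" for n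
    unfolding M by (rule integral_std_normal_moment_even)
  have odd: "M (2 * n + 1) = 0" for n
    unfolding M by (rule integral_std_normal_moment_odd)
  have "M (Suc k) = real k * M (k - 1)"
  proof (cases "even k")
    case True
    then obtain n where n: "k = 2 * n" by (elim evenE)
    show ?thesis
    proof (cases n)
      case 0
      then show ?thesis using odd[of 0] n by simp
    next
      case (Suc n')
      then have "k - 1 = 2 * n' + 1" using n by simp
      then show ?thesis using odd[of n] odd[of n'] n by simp
    qed
  next
    case False
    then obtain n where n: "k = 2 * n + 1" by (elim oddE)
    have f1: "fact (2 * Suc n) = (2 * (real n + 1)) * ((2 * real n + 1) * fact (2 * n))"
      by (simp add: algebra_simps)
    have f2: "2 ^ Suc n * fact (Suc n) = (2 * (real n + 1)) * (2 ^ n * fact n)"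
      by (simp add: algebra_simps)
    have "real n + 1 > 0" by simp
    then have "2 * (real n + 1) \<noteq> 0" by simp
    then have "M (2 * Suc n) = ((2 * real n + 1) * fact (2 * n)) / (2 ^ n * fact n)"
      unfolding even f1 f2 by (rule mult_divide_mult_cancel_left)
    then have "M (2 * Suc n) = real (2 * n + 1) * M (2 * n)"
      unfolding even[of n] by simp
    then show ?thesis using n by simp
  qed
  then show ?thesis by (simp add: M_def)
qed

lemma poly_of_real_measurable [measurable]: "(\<lambda>x. poly p (of_real x :: complex)) \<in> borel_measurable borel"
  by (intro borel_measurable_continuous_onI continuous_intros)

lemma integrable_std_normal_poly: "integrable std_normal (\<lambda>x. poly p (of_real x :: complex))"
proof -
  have "integrable std_normal (\<lambda>x. \<Sum>i\<le>degree p. coeff p i * complex_of_real (x ^ i))"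
    by (intro Bochner_Integration.integrable_sum integrable_mult_right integrable_of_real integrable_std_normal_power)
  then show ?thesis by (simp add: poly_altdef)
qed

lemma pderiv_sum: "pderiv (\<Sum>i\<in>A. f i) = (\<Sum>i\<in>A. pderiv (f i))"
  by (induction A rule: infinite_finite_induct) (auto simp: pderiv_add)

text \<open>Gaussian integration by parts, which for polynomials amounts to the recurrence of the moments.\<close>

lemma std_normal_stein: "(\<integral>x. of_real x * poly p (of_real x :: complex) \<partial>std_normal) = (\<integral>x. poly (pderiv p) (of_real x) \<partial>std_normal)"
proof -
  have mono: "(\<integral>x. poly (monom a i) (of_real x :: complex) \<partial>std_normal) = a * of_real (\<integral>x. x ^ i \<partial>std_normal)" for a i
  proof -
    have "(\<integral>x. poly (monom a i) (of_real x :: complex) \<partial>std_normal) = (\<integral>x. a * complex_of_real (x ^ i) \<partial>std_normal)"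
      by (simp add: poly_monom)
    also have "\<dots> = a * of_real (\<integral>x. x ^ i \<partial>std_normal)"
      by (subst integral_mult_right_zero) (simp only: integral_complex_of_real)
    finally show ?thesis .
  qed
  have "(\<integral>x. of_real x * poly p (of_real x :: complex) \<partial>std_normal) =
      (\<integral>x. (\<Sum>i\<le>degree p. poly (monom (coeff p i) (Suc i)) (of_real x :: complex)) \<partial>std_normal)"
    by (intro Bochner_Integration.integral_cong refl)
       (simp only: poly_monom, subst poly_altdef, simp add: sum_distrib_left mult_ac)
  also have "\<dots> = (\<Sum>i\<le>degree p. coeff p i * of_real (\<integral>x. x ^ Suc i \<partial>std_normal))"
    by (subst Bochner_Integration.integral_sum) (auto intro: integrable_std_normal_poly simp only: mono)
  also have "\<dots> = (\<Sum>i\<le>degree p. (of_nat i * coeff p i) * of_real (\<integral>x. x ^ (i - 1) \<partial>std_normal))"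
    by (intro sum.cong refl) (simp only: std_normal_moment_Suc of_real_mult of_real_of_nat_eq mult_ac)
  also have "\<dots> = (\<integral>x. (\<Sum>i\<le>degree p. poly (monom (of_nat i * coeff p i) (i - 1)) (of_real x :: complex)) \<partial>std_normal)"
    by (subst Bochner_Integration.integral_sum) (auto intro: integrable_std_normal_poly simp only: mono)
  also have "\<dots> = (\<integral>x. poly (pderiv p) (of_real x) \<partial>std_normal)"
  proof -
    have "pderiv p = pderiv (\<Sum>i\<le>degree p. monom (coeff p i) i)" by (simp add: poly_as_sum_of_monoms)
    also have "\<dots> = (\<Sum>i\<le>degree p. monom (of_nat i * coeff p i) (i - 1))"
      by (simp add: pderiv_sum pderiv_monom)
    finally show ?thesis by (simp add: poly_sum)
  qed
  finally show ?thesis .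
qed

lemma integrable_pair_mult:
  fixes f :: "'a \<Rightarrow> real" and g :: "'b \<Rightarrow> real"
  assumes "prob_space M1" "prob_space M2" and f: "integrable M1 f" and g: "integrable M2 g"
  shows "integrable (M1 \<Otimes>\<^sub>M M2) (\<lambda>p. f (fst p) * g (snd p))"
proof -
  interpret M1: prob_space M1 by fact
  interpret M2: prob_space M2 by fact
  interpret pair_prob_space M1 M2 ..
  have [measurable]: "f \<in> borel_measurable M1" "g \<in> borel_measurable M2" using f g by auto
  show ?thesis
  proof (rule Fubini_integrable)
    show "integrable M1 (\<lambda>x. \<integral>y. norm (f (fst (x, y)) * g (snd (x, y))) \<partial>M2)"
      using f by (simp add: abs_mult)
    show "AE x in M1. integrable M2 (\<lambda>y. f (fst (x, y)) * g (snd (x, y)))"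
      using g by simp
  qed measurable
qed

definition gauss_point :: "real \<Rightarrow> real \<Rightarrow> real \<times> real \<Rightarrow> complex" where
  "gauss_point c g p = of_real c + of_real g * (of_real (fst p) + \<i> * of_real (snd p))"

lemma cnj_measurable [measurable]: "cnj \<in> borel_measurable borel"
  by (intro borel_measurable_continuous_onI continuous_intros)

lemma gauss_point_measurable [measurable]: "gauss_point c g \<in> borel_measurable (borel \<Otimes>\<^sub>M borel)"
  unfolding gauss_point_def by measurable

lemma norm_gauss_point_le: "cmod (gauss_point c g p) \<le> (\<bar>c\<bar> + \<bar>g\<bar>) * ((1 + \<bar>fst p\<bar>) * (1 + \<bar>snd p\<bar>))"
proof -
  have "cmod (gauss_point c g p) \<le> \<bar>c\<bar> + \<bar>g\<bar> * (\<bar>fst p\<bar> + \<bar>snd p\<bar>)"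
    unfolding gauss_point_def
    by (intro order_trans[OF norm_triangle_ineq] add_mono) (auto simp: norm_mult intro!: mult_left_mono order_trans[OF norm_triangle_ineq])
  also have "\<dots> \<le> \<bar>c\<bar> * ((1 + \<bar>fst p\<bar>) * (1 + \<bar>snd p\<bar>)) + \<bar>g\<bar> * ((1 + \<bar>fst p\<bar>) * (1 + \<bar>snd p\<bar>))"
  proof (intro add_mono mult_left_mono)
    have "1 * 1 \<le> (1 + \<bar>fst p\<bar>) * (1 + \<bar>snd p\<bar>)" by (intro mult_mono) auto
    then show "\<bar>c\<bar> \<le> \<bar>c\<bar> * ((1 + \<bar>fst p\<bar>) * (1 + \<bar>snd p\<bar>))" by (simp add: mult_le_cancel_left1)
    show "\<bar>fst p\<bar> + \<bar>snd p\<bar> \<le> (1 + \<bar>fst p\<bar>) * (1 + \<bar>snd p\<bar>)" by (simp add: algebra_simps)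
  qed auto
  finally show ?thesis by (simp add: distrib_right)
qed

lemma integrable_std_normal_one_plus_abs_power: "integrable std_normal (\<lambda>x. (1 + \<bar>x\<bar>) ^ n)"
  unfolding binomial_ring by (intro Bochner_Integration.integrable_sum integrable_mult_right integrable_mult_left) (auto intro: integrable_std_normal_abs_power)

lemma integrable_gauss_point: "integrable (std_normal \<Otimes>\<^sub>M std_normal) (\<lambda>p. gauss_point c g p ^ i * cnj (gauss_point c g p) ^ j)"
proof (rule Bochner_Integration.integrable_bound)
  show "integrable (std_normal \<Otimes>\<^sub>M std_normal) (\<lambda>p. (\<bar>c\<bar> + \<bar>g\<bar>) ^ (i + j) * ((1 + \<bar>fst p\<bar>) ^ (i + j) * (1 + \<bar>snd p\<bar>) ^ (i + j)))"
    by (intro integrable_mult_right integrable_pair_mult prob_space_std_normal integrable_std_normal_one_plus_abs_power)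
  show "AE p in std_normal \<Otimes>\<^sub>M std_normal. norm (gauss_point c g p ^ i * cnj (gauss_point c g p) ^ j) \<le>
      norm ((\<bar>c\<bar> + \<bar>g\<bar>) ^ (i + j) * ((1 + \<bar>fst p\<bar>) ^ (i + j) * (1 + \<bar>snd p\<bar>) ^ (i + j)))"
  proof (rule AE_I2)
    fix p :: "real \<times> real"
    have "norm (gauss_point c g p ^ i * cnj (gauss_point c g p) ^ j) = cmod (gauss_point c g p) ^ (i + j)"
      by (simp add: norm_mult norm_power power_add)
    also have "\<dots> \<le> ((\<bar>c\<bar> + \<bar>g\<bar>) * ((1 + \<bar>fst p\<bar>) * (1 + \<bar>snd p\<bar>))) ^ (i + j)"
      by (intro power_mono norm_gauss_point_le) auto
    finally show "norm (gauss_point c g p ^ i * cnj (gauss_point c g p) ^ j) \<le>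
      norm ((\<bar>c\<bar> + \<bar>g\<bar>) ^ (i + j) * ((1 + \<bar>fst p\<bar>) ^ (i + j) * (1 + \<bar>snd p\<bar>) ^ (i + j)))"
      by (simp add: power_mult_distrib)
  qed
qed (unfold gauss_point_def, measurable)

definition gauss_moment :: "real \<Rightarrow> real \<Rightarrow> nat \<Rightarrow> nat \<Rightarrow> complex" where
  "gauss_moment c g i j = (\<integral>p. gauss_point c g p ^ i * cnj (gauss_point c g p) ^ j \<partial>(std_normal \<Otimes>\<^sub>M std_normal))"

lemma pderiv_two_powers:
  "poly (pderiv ([:a, b:] ^ i * [:a', b':] ^ j)) x =
     of_nat i * b * (a + b * x) ^ (i - 1) * (a' + b' * x) ^ j + of_nat j * b' * (a + b * x) ^ i * (a' + b' * x) ^ (j - 1)"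
  for x :: "'a :: {idom, semiring_char_0}"
  by (simp add: pderiv_mult pderiv_power pderiv_pCons poly_power mult_ac)

lemma gauss_point_x: "gauss_point c g (x, y) ^ i * cnj (gauss_point c g (x, y)) ^ j =
   poly ([:of_real c + \<i> * of_real (g * y), of_real g:] ^ i * [:of_real c - \<i> * of_real (g * y), of_real g:] ^ j) (of_real x)"
  by (simp add: gauss_point_def poly_power algebra_simps)

lemma gauss_point_y: "gauss_point c g (x, y) ^ i * cnj (gauss_point c g (x, y)) ^ j =
   poly ([:of_real c + of_real (g * x), \<i> * of_real g:] ^ i * [:of_real c + of_real (g * x), - \<i> * of_real g:] ^ j) (of_real y)"
  by (simp add: gauss_point_def poly_power algebra_simps)

lemma stein_x: "(\<integral>x. of_real x * (gauss_point c g (x, y) ^ i * cnj (gauss_point c g (x, y)) ^ j) \<partial>std_normal) =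
   (\<integral>x. of_real g * (of_nat i * (gauss_point c g (x, y) ^ (i - 1) * cnj (gauss_point c g (x, y)) ^ j) + of_nat j * (gauss_point c g (x, y) ^ i * cnj (gauss_point c g (x, y)) ^ (j - 1))) \<partial>std_normal)"
  unfolding gauss_point_x[of c g _ y i j] std_normal_stein pderiv_two_powers
  by (intro Bochner_Integration.integral_cong refl) (simp add: gauss_point_def algebra_simps)

lemma stein_y: "(\<integral>y. of_real y * (gauss_point c g (x, y) ^ i * cnj (gauss_point c g (x, y)) ^ j) \<partial>std_normal) =
   (\<integral>y. \<i> * of_real g * (of_nat i * (gauss_point c g (x, y) ^ (i - 1) * cnj (gauss_point c g (x, y)) ^ j) - of_nat j * (gauss_point c g (x, y) ^ i * cnj (gauss_point c g (x, y)) ^ (j - 1))) \<partial>std_normal)"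
  unfolding gauss_point_y[of c g x _ i j] std_normal_stein pderiv_two_powers
  by (intro Bochner_Integration.integral_cong refl) (simp add: gauss_point_def algebra_simps)

text \<open>A coordinate is an affine combination of the point and its conjugate, unless the Gaussian part has
coefficient 0.\<close>

lemma integrable_gauss_point_mult:
  assumes "p = fst \<or> p = snd"
  shows "integrable (std_normal \<Otimes>\<^sub>M std_normal) (\<lambda>q. of_real (p q) * (gauss_point c g q ^ i * cnj (gauss_point c g q) ^ j))"
proof (cases "g = 0")
  case False
  have "complex_of_real (fst q) = 1 / (2 * of_real g) * gauss_point c g q + 1 / (2 * of_real g) * cnj (gauss_point c g q) + - of_real c / of_real g"
    "complex_of_real (snd q) = 1 / (2 * \<i> * of_real g) * gauss_point c g q + - 1 / (2 * \<i> * of_real g) * cnj (gauss_point c g q) + 0" for q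
    using False by (simp_all add: gauss_point_def field_simps)
  then have "\<exists>u v w. \<forall>q. complex_of_real (p q) = u * gauss_point c g q + v * cnj (gauss_point c g q) + w"
    using assms by blast
  then obtain u v w where uvw: "\<And>q. complex_of_real (p q) = u * gauss_point c g q + v * cnj (gauss_point c g q) + w" by blast
  have "integrable (std_normal \<Otimes>\<^sub>M std_normal) (\<lambda>q. u * (gauss_point c g q ^ (Suc i) * cnj (gauss_point c g q) ^ j) + v * (gauss_point c g q ^ i * cnj (gauss_point c g q) ^ (Suc j))
      + w * (gauss_point c g q ^ i * cnj (gauss_point c g q) ^ j))"
    by (intro Bochner_Integration.integrable_add integrable_mult_right integrable_gauss_point)
  then show ?thesis unfolding uvw by (simp add: algebra_simps)
next
  case True
  have "integrable (std_normal \<Otimes>\<^sub>M std_normal) (\<lambda>q. (fst q) * 1)" "integrable (std_normal \<Otimes>\<^sub>M std_normal) (\<lambda>q. 1 * (snd q))"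
    using integrable_std_normal_power[of 1] by (auto intro!: integrable_pair_mult[of _ _ "\<lambda>x. x" "\<lambda>_. 1", simplified] integrable_pair_mult[of _ _ "\<lambda>_. 1" "\<lambda>x. x", simplified] prob_space_std_normal)
  then have "integrable (std_normal \<Otimes>\<^sub>M std_normal) (\<lambda>q. of_real (p q) * (of_real c ^ i * of_real c ^ j) :: complex)"
    using assms by auto
  then show ?thesis using True by (simp add: gauss_point_def)
qed

text \<open>In the combination of the integrations by parts in \<open>x\<close> and \<open>\<i> y\<close> the derivatives with respect to \<open>z\<close> cancel
and those with respect to \<open>cnj z\<close> double.\<close>

lemma gauss_moment_Suc: "gauss_moment c g (Suc i) j = of_real c * gauss_moment c g i j + of_real (2 * g\<^sup>2) * of_nat j * gauss_moment c g i (j - 1)"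
proof -
  let ?h = "\<lambda>i j p. gauss_point c g p ^ i * cnj (gauss_point c g p) ^ j"
  let ?P = "std_normal \<Otimes>\<^sub>M std_normal"
  note I = integrable_gauss_point[of c g] and Ix = integrable_gauss_point_mult[of fst c g, simplified] and Iy = integrable_gauss_point_mult[of snd c g, simplified]
  have X: "(\<integral>p. of_real (fst p) * ?h i j p \<partial>?P) = of_real g * (of_nat i * gauss_moment c g (i - 1) j + of_nat j * gauss_moment c g i (j - 1))"
  proof -
    have e: "(\<lambda>(x, y). of_real x * ?h i j (x, y)) = (\<lambda>p. of_real (fst p) * ?h i j p)"
      by (simp add: fun_eq_iff)
    have "(\<integral>p. of_real (fst p) * ?h i j p \<partial>?P) = (\<integral>y. \<integral>x. of_real x * ?h i j (x, y) \<partial>std_normal \<partial>std_normal)"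
      using G2.integral_snd[of "\<lambda>x y. of_real x * ?h i j (x, y)", unfolded e, OF Ix] by (rule sym)
    also have "\<dots> = (\<integral>p. of_real g * (of_nat i * ?h (i - 1) j p + of_nat j * ?h i (j - 1) p) \<partial>?P)"
    proof -
      have e: "(\<lambda>(x, y). of_real g * (of_nat i * ?h (i - 1) j (x, y) + of_nat j * ?h i (j - 1) (x, y))) =
          (\<lambda>p. of_real g * (of_nat i * ?h (i - 1) j p + of_nat j * ?h i (j - 1) p))"
        by (simp add: fun_eq_iff)
      have "integrable ?P (\<lambda>p. of_real g * (of_nat i * ?h (i - 1) j p + of_nat j * ?h i (j - 1) p))"
        using I by (intro integrable_mult_right Bochner_Integration.integrable_add)
      from G2.integral_snd[of "\<lambda>x y. of_real g * (of_nat i * ?h (i - 1) j (x, y) + of_nat j * ?h i (j - 1) (x, y))", unfolded e, OF this]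
      show ?thesis unfolding stein_x .
    qed
    also have "\<dots> = of_real g * (of_nat i * gauss_moment c g (i - 1) j + of_nat j * gauss_moment c g i (j - 1))"
      using I by (simp add: gauss_moment_def)
    finally show ?thesis .
  qed
  have Y: "(\<integral>p. of_real (snd p) * ?h i j p \<partial>?P) = \<i> * of_real g * (of_nat i * gauss_moment c g (i - 1) j - of_nat j * gauss_moment c g i (j - 1))"
  proof -
    have "(\<integral>p. of_real (snd p) * ?h i j p \<partial>?P) = (\<integral>x. \<integral>y. of_real y * ?h i j (x, y) \<partial>std_normal \<partial>std_normal)"
      using G2.integral_fst'[of "\<lambda>p. of_real (snd p) * ?h i j p"] Iy by simp
    also have "\<dots> = (\<integral>p. \<i> * of_real g * (of_nat i * ?h (i - 1) j p - of_nat j * ?h i (j - 1) p) \<partial>?P)"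
      unfolding stein_y using I
      by (subst G2.integral_fst'[of "\<lambda>p. \<i> * of_real g * (of_nat i * ?h (i - 1) j p - of_nat j * ?h i (j - 1) p)"])
         (auto intro!: integrable_mult_right Bochner_Integration.integrable_diff)
    also have "\<dots> = \<i> * of_real g * (of_nat i * gauss_moment c g (i - 1) j - of_nat j * gauss_moment c g i (j - 1))"
      using I by (simp add: gauss_moment_def)
    finally show ?thesis .
  qed
  have "gauss_moment c g (Suc i) j = (\<integral>p. of_real c * ?h i j p + of_real g * (of_real (fst p) * ?h i j p) + of_real g * \<i> * (of_real (snd p) * ?h i j p) \<partial>?P)"
    unfolding gauss_moment_def
  proof (intro Bochner_Integration.integral_cong refl)
    fix p
    have "gauss_point c g p ^ Suc i * cnj (gauss_point c g p) ^ j = gauss_point c g p * ?h i j p" by simp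
    also have "\<dots> = (of_real c + of_real g * of_real (fst p) + of_real g * \<i> * of_real (snd p)) * ?h i j p"
      by (subst (1) gauss_point_def) (simp add: algebra_simps)
    finally show "gauss_point c g p ^ Suc i * cnj (gauss_point c g p) ^ j = of_real c * ?h i j p + of_real g * (of_real (fst p) * ?h i j p) + of_real g * \<i> * (of_real (snd p) * ?h i j p)"
      by (simp only: distrib_right mult.assoc)
  qed
  also have "\<dots> = of_real c * gauss_moment c g i j + of_real g * (\<integral>p. of_real (fst p) * ?h i j p \<partial>?P) + of_real g * \<i> * (\<integral>p. of_real (snd p) * ?h i j p \<partial>?P)"
    using I Ix Iy by (simp add: gauss_moment_def)
  also have "\<dots> = of_real c * gauss_moment c g i j + of_real (2 * g\<^sup>2) * of_nat j * gauss_moment c g i (j - 1)"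
    unfolding X Y by (simp add: algebra_simps power2_eq_square)
  finally show ?thesis .
qed

lemma gauss_moment_cnj: "gauss_moment c g i j = cnj (gauss_moment c g j i)"
  unfolding gauss_moment_def
  by (subst integral_bounded_linear[OF bounded_linear_cnj, symmetric]) (auto intro: integrable_gauss_point simp: mult.commute)

lemma gauss_moment_0: "gauss_moment c g 0 j = of_real c ^ j"
proof -
  have "gauss_moment c g j 0 = of_real c ^ j"
  proof (induction j)
    case 0
    then show ?case by (simp add: gauss_moment_def G2.prob_space)
  qed (simp add: gauss_moment_Suc)
  then show ?thesis by (subst gauss_moment_cnj) simp
qed

section \<open>The law defined by the Bessel weight\<close>

text \<open>The weight is \<open>K\<^sub>\<nu>(a |z|) |z|\<^sup>\<nu> exp (a \<tau> Re z)\<close>.\<close>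

locale wishart_weight =
  fixes a \<tau> \<nu> :: real
  assumes a: "a > 0" and tau01: "0 < \<tau>" "\<tau> < 1" and \<nu>: "\<nu> > -1"
begin

definition \<kappa> where "\<kappa> = a / 2 * (1 - \<tau>\<^sup>2)"

lemma \<tau>2: "\<tau>\<^sup>2 < 1" using tau01 by (simp add: power_less_one_iff)

lemma \<kappa>_pos: "\<kappa> > 0" using a \<tau>2 by (simp add: \<kappa>_def)

sublocale gamma_mixture \<tau> "1 / \<kappa>" \<nu>
  using tau01 \<kappa>_pos \<nu> by unfold_locales auto

definition gamma_density :: "real \<Rightarrow> real" where
  "gamma_density s = indicator {0<..} s * (\<kappa> powr (\<nu> + 1) * s powr \<nu> * exp (- \<kappa> * s) / Gamma (\<nu> + 1))"

definition gamma_law :: "real measure" where "gamma_law = density lborel (\<lambda>s. ennreal (gamma_density s))"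

lemma gamma_density_nonneg: "gamma_density s \<ge> 0"
  using \<nu> by (auto simp: gamma_density_def indicator_def Gamma_real_pos less_imp_le)

lemma gamma_density_measurable [measurable]: "gamma_density \<in> borel_measurable borel"
  unfolding gamma_density_def by measurable

lemma sets_gamma_law [measurable_cong, simp]: "sets gamma_law = sets borel" by (simp add: gamma_law_def)
lemma space_gamma_law [simp]: "space gamma_law = UNIV" by (simp add: gamma_law_def)

lemma nn_integral_gamma_law_power: "(\<integral>\<^sup>+s. ennreal (indicator {0<..} s * s ^ n) \<partial>gamma_law) = ennreal (gamma_moment n)"
proof -
  let ?g = "\<lambda>t. indicator {0..} t * t powr (\<nu> + 1 + real n - 1) / exp t"
  have G: "Gamma (\<nu> + 1) > 0" using \<nu> by (simp add: Gamma_real_pos)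
  have pos: "\<nu> + 1 + real n > 0" using \<nu> by simp
  have "(\<integral>\<^sup>+s. ennreal (indicator {0<..} s * s ^ n) \<partial>gamma_law) = (\<integral>\<^sup>+s. ennreal (gamma_density s * (indicator {0<..} s * s ^ n)) \<partial>lborel)"
    unfolding gamma_law_def by (subst nn_integral_density) (auto simp: ennreal_mult'' gamma_density_nonneg indicator_def intro!: nn_integral_cong split: if_splits)
  also have "\<dots> = (\<integral>\<^sup>+s. ennreal (\<kappa> / \<kappa> ^ n / Gamma (\<nu> + 1)) * ennreal (?g (0 + \<kappa> * s)) \<partial>lborel)"
  proof (rule nn_integral_cong_AE)
    have "AE s in lborel. s \<noteq> (0::real)" by (rule AE_lborel_singleton)
    then show "AE s in lborel. ennreal (gamma_density s * (indicator {0<..} s * s ^ n)) = ennreal (\<kappa> / \<kappa> ^ n / Gamma (\<nu> + 1)) * ennreal (?g (0 + \<kappa> * s))"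
    proof eventually_elim
      case (elim s)
      show ?case
      proof (cases "s > 0")
        case False
        with elim have "\<kappa> * s < 0" using \<kappa>_pos by (simp add: mult_pos_neg)
        then show ?thesis using False by simp
      next
        case True
        have p: "s powr (\<nu> + real n) = s powr \<nu> * s ^ n" "\<kappa> powr (\<nu> + real n) = \<kappa> powr \<nu> * \<kappa> ^ n" "\<kappa> powr (\<nu> + 1) = \<kappa> powr \<nu> * \<kappa>"
          using True \<kappa>_pos by (simp_all add: powr_add powr_realpow)
        have p': "\<kappa> powr (1 + \<nu>) = \<kappa> powr \<nu> * \<kappa>" using p(3) by (simp add: add.commute)
        have "gamma_density s * (indicator {0<..} s * s ^ n) = \<kappa> / \<kappa> ^ n / Gamma (\<nu> + 1) * ?g (0 + \<kappa> * s)"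
          using True \<kappa>_pos G by (simp add: gamma_density_def powr_mult p p' exp_minus field_simps)
        then show ?thesis using \<kappa>_pos G by (simp add: ennreal_mult'' [symmetric] ennreal_mult' [symmetric])
      qed
    qed
  qed
  also have "\<dots> = ennreal (\<kappa> / \<kappa> ^ n / Gamma (\<nu> + 1)) * (\<integral>\<^sup>+s. ennreal (?g (0 + \<kappa> * s)) \<partial>lborel)"
    by (intro nn_integral_cmult) measurable
  also have "(\<integral>\<^sup>+s. ennreal (?g (0 + \<kappa> * s)) \<partial>lborel) = ennreal (1 / \<kappa>) * (\<integral>\<^sup>+t. ennreal (?g t) \<partial>lborel)"
  proof -
    have "(\<integral>\<^sup>+t. ennreal (?g t) \<partial>lborel) = ennreal \<bar>\<kappa>\<bar> * (\<integral>\<^sup>+s. ennreal (?g (0 + \<kappa> * s)) \<partial>lborel)"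
      using \<kappa>_pos by (intro nn_integral_real_affine) auto
    moreover have "ennreal (1 / \<kappa>) * ennreal \<bar>\<kappa>\<bar> = 1" using \<kappa>_pos by (simp add: ennreal_mult[symmetric])
    ultimately show ?thesis by (simp add: mult.assoc[symmetric])
  qed
  also have "(\<integral>\<^sup>+t. ennreal (?g t) \<partial>lborel) = ennreal (Gamma (\<nu> + 1 + real n))"
    using Gamma_conv_nn_integral_real[OF pos] by simp
  also have "ennreal (\<kappa> / \<kappa> ^ n / Gamma (\<nu> + 1)) * (ennreal (1 / \<kappa>) * ennreal (Gamma (\<nu> + 1 + real n))) = ennreal (gamma_moment n)"
  proof -
    have "pochhammer (\<nu> + 1) n = Gamma (\<nu> + 1 + real n) / Gamma (\<nu> + 1)"
      using \<nu> by (intro pochhammer_Gamma) (auto elim!: nonpos_Ints_cases)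
    then have e: "Gamma (\<nu> + 1 + real n) = pochhammer (\<nu> + 1) n * Gamma (\<nu> + 1)"
      using G by (simp add: field_simps)
    have e2: "\<kappa> / \<kappa> ^ n / Gamma (\<nu> + 1) * (1 / \<kappa> * Gamma (\<nu> + 1 + real n)) = gamma_moment n"
      unfolding e gamma_moment_def using \<kappa>_pos G by (simp add: power_one_over)
    have "ennreal (\<kappa> / \<kappa> ^ n / Gamma (\<nu> + 1)) * (ennreal (1 / \<kappa>) * ennreal (Gamma (\<nu> + 1 + real n))) =
        ennreal (\<kappa> / \<kappa> ^ n / Gamma (\<nu> + 1) * (1 / \<kappa> * Gamma (\<nu> + 1 + real n)))"
      using \<kappa>_pos G Gamma_real_pos[OF pos] by (simp add: ennreal_mult[symmetric])
    then show ?thesis unfolding e2 .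
  qed
  finally show ?thesis .
qed

lemma prob_space_gamma_law: "prob_space gamma_law"
proof
  have "emeasure gamma_law (space gamma_law) = (\<integral>\<^sup>+s. 1 \<partial>gamma_law)" by simp
  also have "\<dots> = (\<integral>\<^sup>+s. ennreal (indicator {0<..} s * s ^ 0) \<partial>gamma_law)"
  proof (rule nn_integral_cong_AE)
    show "AE s in gamma_law. 1 = ennreal (indicator {0<..} s * s ^ 0)"
      unfolding gamma_law_def by (subst AE_density) (auto simp: gamma_density_def indicator_def)
  qed
  also have "\<dots> = 1" unfolding nn_integral_gamma_law_power by (simp add: gamma_moment_def)
  finally show "emeasure gamma_law (space gamma_law) = 1" .
qed

lemma AE_gamma_law_pos: "AE s in gamma_law. s > 0"
  unfolding gamma_law_def by (subst AE_density) (auto simp: gamma_density_def indicator_def)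

lemma gamma_moment_nonneg: "gamma_moment n \<ge> 0"
  unfolding gamma_moment_def using \<nu> \<kappa>_pos by (auto intro!: mult_nonneg_nonneg pochhammer_nonneg)

lemma gamma_law_power: "has_bochner_integral gamma_law (\<lambda>s. s ^ n) (gamma_moment n)"
proof (rule has_bochner_integral_nn_integral)
  show "AE s in gamma_law. 0 \<le> s ^ n" using AE_gamma_law_pos by eventually_elim simp
  have "(\<integral>\<^sup>+s. ennreal (s ^ n) \<partial>gamma_law) = (\<integral>\<^sup>+s. ennreal (indicator {0<..} s * s ^ n) \<partial>gamma_law)"
    by (rule nn_integral_cong_AE) (use AE_gamma_law_pos in \<open>eventually_elim, simp\<close>)
  then show "(\<integral>\<^sup>+s. ennreal (s ^ n) \<partial>gamma_law) = ennreal (gamma_moment n)" by (simp add: nn_integral_gamma_law_power)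
qed (auto simp: gamma_moment_nonneg)

interpretation gamma_law: prob_space gamma_law by (rule prob_space_gamma_law)
interpretation GG: pair_prob_space gamma_law "std_normal \<Otimes>\<^sub>M std_normal" ..

definition sample :: "(real \<times> real \<times> real) measure" where "sample = gamma_law \<Otimes>\<^sub>M (std_normal \<Otimes>\<^sub>M std_normal)"

definition sample_point :: "real \<times> real \<times> real \<Rightarrow> complex" where
  "sample_point p = gauss_point (\<tau> * fst p) (sqrt (fst p / a)) (snd p)"

lemma sample_point_measurable [measurable]: "sample_point \<in> borel_measurable (borel \<Otimes>\<^sub>M (borel \<Otimes>\<^sub>M borel))"
  unfolding sample_point_def gauss_point_def by measurable

lemma sets_sample [measurable_cong]: "sets sample = sets (borel \<Otimes>\<^sub>M (borel \<Otimes>\<^sub>M borel))"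
  unfolding sample_def by (intro sets_pair_measure_cong) auto

definition law :: "complex measure" where "law = distr sample borel sample_point"

lemma sets_law [measurable_cong, simp]: "sets law = sets borel" by (simp add: law_def)

lemma prob_space_sample: "prob_space sample" unfolding sample_def by unfold_locales

lemma integrable_gamma_law_one_plus_abs_power: "integrable gamma_law (\<lambda>s. (1 + \<bar>s\<bar>) ^ n)"
proof -
  have "integrable gamma_law (\<lambda>s. \<bar>s\<bar> ^ k)" for k
    using integrable_abs[OF integrable.intros[OF gamma_law_power[of k]]] by (simp add: power_abs)
  then show ?thesis
    unfolding binomial_ring by (intro Bochner_Integration.integrable_sum integrable_mult_right integrable_mult_left) auto
qed

lemma integrable_sample_point: "integrable sample (\<lambda>p. sample_point p ^ i * cnj (sample_point p) ^ j)"
proof (rule Bochner_Integration.integrable_bound)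
  let ?n = "i + j"
  show "integrable sample (\<lambda>p. (2 + 1 / a) ^ ?n * ((1 + \<bar>fst p\<bar>) ^ ?n * (((1 + \<bar>fst (snd p)\<bar>) ^ ?n * (1 + \<bar>snd (snd p)\<bar>) ^ ?n))))"
    unfolding sample_def
    by (intro integrable_mult_right integrable_pair_mult prob_space_std_normal prob_space_gamma_law integrable_gamma_law_one_plus_abs_power integrable_std_normal_one_plus_abs_power G2.prob_space_axioms)
  show "AE p in sample. norm (sample_point p ^ i * cnj (sample_point p) ^ j) \<le>
     norm ((2 + 1 / a) ^ ?n * ((1 + \<bar>fst p\<bar>) ^ ?n * ((1 + \<bar>fst (snd p)\<bar>) ^ ?n * (1 + \<bar>snd (snd p)\<bar>) ^ ?n)))"
  proof (rule AE_I2)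
    fix p :: "real \<times> real \<times> real"
    have "\<bar>\<tau> * fst p\<bar> = \<tau> * \<bar>fst p\<bar>" using tau01 by (simp add: abs_mult)
    moreover have "\<tau> * \<bar>fst p\<bar> \<le> \<bar>fst p\<bar>" using tau01 by (intro mult_left_le_one_le) auto
    ultimately have 1: "\<bar>\<tau> * fst p\<bar> \<le> 1 + \<bar>fst p\<bar>" by linarith
    have 2: "\<bar>sqrt (fst p / a)\<bar> \<le> (1 + 1 / a) * (1 + \<bar>fst p\<bar>)"
    proof -
      have "\<bar>sqrt (fst p / a)\<bar> = sqrt (\<bar>fst p\<bar> / a)" 
        using a real_sqrt_minus[of "fst p / a"]
        by (cases "fst p \<ge> 0") (auto simp: abs_if divide_less_0_iff)
      also have "\<dots> \<le> 1 + \<bar>fst p\<bar> / a"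
      proof -
        have "sqrt u \<le> 1 + u" if "u \<ge> 0" for u :: real
          by (intro real_le_lsqrt) (use that in \<open>auto simp: power2_eq_square algebra_simps\<close>)
        then show ?thesis using a by simp
      qed
      also have "\<dots> \<le> (1 + 1 / a) * (1 + \<bar>fst p\<bar>)" using a by (simp add: algebra_simps divide_nonneg_pos)
      finally show ?thesis .
    qed
    have "norm (sample_point p ^ i * cnj (sample_point p) ^ j) = cmod (sample_point p) ^ ?n"
      by (simp add: norm_mult norm_power power_add)
    also have "\<dots> \<le> (((2 + 1 / a) * (1 + \<bar>fst p\<bar>)) * ((1 + \<bar>fst (snd p)\<bar>) * (1 + \<bar>snd (snd p)\<bar>))) ^ ?n"
    proof (intro power_mono)
      have "cmod (sample_point p) \<le> (\<bar>\<tau> * fst p\<bar> + \<bar>sqrt (fst p / a)\<bar>) * ((1 + \<bar>fst (snd p)\<bar>) * (1 + \<bar>snd (snd p)\<bar>))"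
        unfolding sample_point_def by (rule norm_gauss_point_le)
      also have "\<dots> \<le> ((2 + 1 / a) * (1 + \<bar>fst p\<bar>)) * ((1 + \<bar>fst (snd p)\<bar>) * (1 + \<bar>snd (snd p)\<bar>))"
        using add_mono[OF 1 2] by (intro mult_right_mono) (auto simp: algebra_simps)
      finally show "cmod (sample_point p) \<le> ((2 + 1 / a) * (1 + \<bar>fst p\<bar>)) * ((1 + \<bar>fst (snd p)\<bar>) * (1 + \<bar>snd (snd p)\<bar>))" .
    qed simp
    also have "\<dots> = (2 + 1 / a) ^ ?n * ((1 + \<bar>fst p\<bar>) ^ ?n * ((1 + \<bar>fst (snd p)\<bar>) ^ ?n * (1 + \<bar>snd (snd p)\<bar>) ^ ?n))"
      by (simp only: power_mult_distrib mult.assoc)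
    also have "\<dots> \<le> norm \<dots>" by simp
    finally show "norm (sample_point p ^ i * cnj (sample_point p) ^ j) \<le> norm ((2 + 1 / a) ^ ?n * ((1 + \<bar>fst p\<bar>) ^ ?n * ((1 + \<bar>fst (snd p)\<bar>) ^ ?n * (1 + \<bar>snd (snd p)\<bar>) ^ ?n)))" .
  qed
qed measurable

text \<open>For given \<open>s\<close> the Gaussian part of \<open>Z\<close> has \<open>E |G|\<^sup>2 = 2 s / a\<close>, and \<open>2 / a = \<theta> / \<kappa>\<close>.\<close>

lemma gauss_moment_eq:
  assumes s: "s > 0"
  shows "gauss_moment (\<tau> * s) (sqrt (s / a)) i j = of_real (mix_moment \<tau> (\<theta> * (1 / \<kappa>)) (\<lambda>n. s ^ n) i j)"
proof (induction i arbitrary: j)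
  case 0
  then show ?case by (simp add: gauss_moment_0 mix_moment_0 power_mult_distrib)
next
  case (Suc i)
  have sq: "(sqrt (s / a))\<^sup>2 = s / a" using s a by simp
  have k: "2 / a = \<theta> * (1 / \<kappa>)" using a \<kappa>_pos \<tau>2 by (simp add: \<kappa>_def field_simps)
  have shift: "mix_moment \<tau> \<omega> (\<lambda>n. s ^ Suc n) i j = s * mix_moment \<tau> \<omega> (\<lambda>n. s ^ n) i j" for \<omega> j
    unfolding mix_moment_def sum_distrib_left by (intro sum.cong) auto
  show ?case
    unfolding gauss_moment_Suc Suc.IH sq mix_moment_Suc shift k[symmetric]
    by (simp add: algebra_simps)
qed

lemma law_moments:
  "integrable law (\<lambda>z. z ^ i * cnj z ^ j)" "(\<integral>z. z ^ i * cnj z ^ j \<partial>law) = of_real (mixed_moment i j)"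
proof -
  have [measurable]: "(\<lambda>z. z ^ i * cnj z ^ j) \<in> borel_measurable borel" by measurable
  show "integrable law (\<lambda>z. z ^ i * cnj z ^ j)"
    unfolding law_def by (subst integrable_distr_eq) (auto intro: integrable_sample_point)
  have "(\<integral>z. z ^ i * cnj z ^ j \<partial>law) = (\<integral>p. sample_point p ^ i * cnj (sample_point p) ^ j \<partial>sample)"
    unfolding law_def by (subst integral_distr) auto
  also have "\<dots> = (\<integral>s. \<integral>q. sample_point (s, q) ^ i * cnj (sample_point (s, q)) ^ j \<partial>(std_normal \<Otimes>\<^sub>M std_normal) \<partial>gamma_law)"
    using integrable_sample_point unfolding sample_def by (subst GG.integral_fst'[symmetric]) auto
  also have "\<dots> = (\<integral>s. gauss_moment (\<tau> * s) (sqrt (s / a)) i j \<partial>gamma_law)"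
    unfolding gauss_moment_def sample_point_def by simp
  also have "\<dots> = (\<integral>s. of_real (mix_moment \<tau> (\<theta> * (1 / \<kappa>)) (\<lambda>n. s ^ n) i j) \<partial>gamma_law)"
  proof (rule integral_cong_AE)
    show "AE s in gamma_law. gauss_moment (\<tau> * s) (sqrt (s / a)) i j = of_real (mix_moment \<tau> (\<theta> * (1 / \<kappa>)) (\<lambda>n. s ^ n) i j)"
      using AE_gamma_law_pos by eventually_elim (rule gauss_moment_eq)
    show "(\<lambda>s. gauss_moment (\<tau> * s) (sqrt (s / a)) i j) \<in> borel_measurable gamma_law"
      unfolding gauss_moment_def gauss_point_def by measurable
    show "(\<lambda>s. complex_of_real (mix_moment \<tau> (\<theta> * (1 / \<kappa>)) (\<lambda>n. s ^ n) i j)) \<in> borel_measurable gamma_law"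
      unfolding mix_moment_def by measurable
  qed
  also have "\<dots> = of_real (\<integral>s. mix_moment \<tau> (\<theta> * (1 / \<kappa>)) (\<lambda>n. s ^ n) i j \<partial>gamma_law)"
    by (rule integral_complex_of_real)
  also have "(\<integral>s. mix_moment \<tau> (\<theta> * (1 / \<kappa>)) (\<lambda>n. s ^ n) i j \<partial>gamma_law) = mixed_moment i j"
    unfolding mix_moment_def mixed_moment_def using gamma_law_power
    by (subst Bochner_Integration.integral_sum) (auto simp: has_bochner_integral_iff)
  finally show "(\<integral>z. z ^ i * cnj z ^ j \<partial>law) = of_real (mixed_moment i j)" .
qed

definition weight_const :: real where "weight_const = Gamma (\<nu> + 1) / (a * \<kappa> powr (\<nu> + 1))"

lemma weight_const_pos: "weight_const > 0" using a \<kappa>_pos \<nu> by (simp add: weight_const_def Gamma_real_pos)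

text \<open>The integrand of the mixture representation of the weight at \<open>z\<close>.\<close>

definition joint :: "real \<Rightarrow> complex \<Rightarrow> real" where
  "joint s z = indicator {0<..} s * (1 / 2 * (s powr (\<nu> - 1) * exp (- (a / 2) * (s + (cmod z)\<^sup>2 / s))) * exp (a * \<tau> * Re z))"

lemma joint_measurable [measurable]: "(\<lambda>(s, z). joint s z) \<in> borel_measurable (borel \<Otimes>\<^sub>M borel)"
  unfolding joint_def by measurable

lemma weight_eq_nn_integral:
  assumes z: "z \<noteq> 0"
  shows "ennreal (bessel_K \<nu> (a * cmod z) * cmod z powr \<nu> * exp (a * \<tau> * Re z)) = (\<integral>\<^sup>+s. ennreal (joint s z) \<partial>lborel)"
proof -
  let ?B = "bessel_K \<nu> (a * cmod z) * cmod z powr \<nu>" and ?E = "exp (a * \<tau> * Re z)"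
  have B: "?B \<ge> 0" using bessel_K_pos[of "a * cmod z" \<nu>] a z by simp
  have "ennreal (?B * ?E) = ennreal (?E / 2) * ennreal (2 * ?B)"
    using B by (simp add: ennreal_mult[symmetric])
  also have "\<dots> = (\<integral>\<^sup>+s. ennreal (?E / 2) * (ennreal (s powr (\<nu> - 1) * exp (- (a / 2) * (s + (cmod z)\<^sup>2 / s))) * indicator {0<..} s) \<partial>lborel)"
    using z a by (subst bessel_K_mixture) (auto intro!: nn_integral_cmult[symmetric])
  also have "\<dots> = (\<integral>\<^sup>+s. ennreal (joint s z) \<partial>lborel)"
    by (intro nn_integral_cong) (auto simp: joint_def indicator_def ennreal_mult[symmetric] mult_ac)
  finally show ?thesis .
qed

text \<open>Completing the square:
\<open>a \<tau> Re z - (a / 2) (s + |z|\<^sup>2 / s) = - \<kappa> s - (a / (2 s)) |z - \<tau> s|\<^sup>2\<close>.\<close>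

lemma joint_factor:
  assumes s: "s > 0"
  shows "1 / pi * joint s (Complex x y) = weight_const * gamma_density s * (normal_density (\<tau> * s) (sqrt (s / a)) x * normal_density 0 (sqrt (s / a)) y)"
proof -
  have sq: "(sqrt (s / a))\<^sup>2 = s / a" using s a by simp
  have nn: "normal_density (\<tau> * s) (sqrt (s / a)) x * normal_density 0 (sqrt (s / a)) y
     = a / (2 * pi * s) * exp (- (a / (2 * s)) * ((x - \<tau> * s)\<^sup>2 + y\<^sup>2))"
  proof -
    have "normal_density (\<tau> * s) (sqrt (s / a)) x * normal_density 0 (sqrt (s / a)) y =
       (1 / sqrt (2 * pi * (s / a)) * (1 / sqrt (2 * pi * (s / a)))) * (exp (- (x - \<tau> * s)\<^sup>2 / (2 * (s / a))) * exp (- (y - 0)\<^sup>2 / (2 * (s / a))))"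
      unfolding normal_density_def sq by (simp only: mult_ac)
    also have "1 / sqrt (2 * pi * (s / a)) * (1 / sqrt (2 * pi * (s / a))) = a / (2 * pi * s)"
      using s a by (simp add: field_simps)
    also have "exp (- (x - \<tau> * s)\<^sup>2 / (2 * (s / a))) * exp (- (y - 0)\<^sup>2 / (2 * (s / a))) = exp (- (a / (2 * s)) * ((x - \<tau> * s)\<^sup>2 + y\<^sup>2))"
      unfolding mult_exp_exp using s a by (simp add: field_simps)
    finally show ?thesis .
  qed
  have g: "weight_const * gamma_density s = s powr \<nu> * exp (- \<kappa> * s) / a"
    using s \<kappa>_pos a \<nu> Gamma_real_pos[of "\<nu> + 1"] by (simp add: weight_const_def gamma_density_def less_imp_neq[symmetric])
  have e: "- \<kappa> * s + - (a / (2 * s)) * ((x - \<tau> * s)\<^sup>2 + y\<^sup>2) = - (a / 2) * (s + (cmod (Complex x y))\<^sup>2 / s) + a * \<tau> * x"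
    unfolding cmod_power2 \<kappa>_def using s a by (simp add: field_simps power2_eq_square)
  have p: "s powr (\<nu> - 1) = s powr \<nu> / s" using s by (simp add: powr_diff)
  have "weight_const * gamma_density s * (normal_density (\<tau> * s) (sqrt (s / a)) x * normal_density 0 (sqrt (s / a)) y) =
     s powr \<nu> / (2 * pi * s) * (exp (- \<kappa> * s) * exp (- (a / (2 * s)) * ((x - \<tau> * s)\<^sup>2 + y\<^sup>2)))"
    unfolding nn g using a s by (simp add: field_simps)
  also have "\<dots> = s powr \<nu> / (2 * pi * s) * exp (- (a / 2) * (s + (cmod (Complex x y))\<^sup>2 / s)) * exp (a * \<tau> * x)"
    unfolding mult_exp_exp e by (simp only: exp_add mult.assoc complex.sel)
  also have "\<dots> = 1 / pi * joint s (Complex x y)"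
    using s by (simp add: joint_def p)
  finally show ?thesis ..
qed

lemma nn_integral_normal_affine:
  assumes g: "g > 0" and [measurable]: "f \<in> borel_measurable borel"
  shows "(\<integral>\<^sup>+x. ennreal (normal_density c g x) * f x \<partial>lborel) = (\<integral>\<^sup>+x. f (c + g * x) \<partial>std_normal)"
proof -
  have "(\<integral>\<^sup>+x. ennreal (normal_density c g x) * f x \<partial>lborel) = ennreal \<bar>g\<bar> * (\<integral>\<^sup>+x. ennreal (normal_density c g (c + g * x)) * f (c + g * x) \<partial>lborel)"
    using g by (intro nn_integral_real_affine) auto
  also have "\<dots> = (\<integral>\<^sup>+x. ennreal \<bar>g\<bar> * (ennreal (normal_density c g (c + g * x)) * f (c + g * x)) \<partial>lborel)"
    by (intro nn_integral_cmult[symmetric]) measurable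
  also have "\<dots> = (\<integral>\<^sup>+x. ennreal (std_normal_density x) * f (c + g * x) \<partial>lborel)"
  proof (intro nn_integral_cong)
    fix x
    have "\<bar>g\<bar> * normal_density c g (c + g * x) = std_normal_density x"
      using g by (simp add: normal_density_def real_sqrt_mult power_mult_distrib)
    then show "ennreal \<bar>g\<bar> * (ennreal (normal_density c g (c + g * x)) * f (c + g * x)) = ennreal (std_normal_density x) * f (c + g * x)"
      by (simp add: mult.assoc[symmetric] ennreal_mult[symmetric])
  qed
  also have "\<dots> = (\<integral>\<^sup>+x. f (c + g * x) \<partial>std_normal)"
    unfolding std_normal_def by (subst nn_integral_density) auto
  finally show ?thesis .
qed

text \<open>By Tonelli's theorem the integral over \<open>z\<close> may be taken first, for fixed \<open>s\<close>, where \<open>joint_factor\<close> exhibits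
the density of \<open>\<tau> s + sqrt (s / a) (X + \<i> Y)\<close>.\<close>

lemma nn_integral_weight:
  fixes w :: "complex \<Rightarrow> real"
  assumes w: "\<And>z. z \<noteq> 0 \<Longrightarrow> w z = bessel_K \<nu> (a * cmod z) * cmod z powr \<nu> * exp (a * \<tau> * Re z)"
    and wm[measurable]: "w \<in> borel_measurable borel" and f[measurable]: "f \<in> borel_measurable borel"
  shows "(\<integral>\<^sup>+z. ennreal (w z) * f z \<partial>dA) = ennreal weight_const * (\<integral>\<^sup>+z. f z \<partial>law)"
proof -
  have "(\<integral>\<^sup>+z. ennreal (w z) * f z \<partial>dA) = ennreal (1 / pi) * (\<integral>\<^sup>+z. ennreal (w z) * f z \<partial>lborel)"
    by (intro nn_integral_dA) measurable
  also have "(\<integral>\<^sup>+z. ennreal (w z) * f z \<partial>lborel) = (\<integral>\<^sup>+z. (\<integral>\<^sup>+s. ennreal (joint s z) * f z \<partial>lborel) \<partial>lborel)"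
  proof (rule nn_integral_cong_AE)
    have "AE z in lborel. z \<noteq> (0::complex)" by (rule AE_lborel_singleton)
    then show "AE z in lborel. ennreal (w z) * f z = (\<integral>\<^sup>+s. ennreal (joint s z) * f z \<partial>lborel)"
      by eventually_elim (simp add: w weight_eq_nn_integral nn_integral_multc)
  qed
  also have "\<dots> = (\<integral>\<^sup>+s. (\<integral>\<^sup>+z. ennreal (joint s z) * f z \<partial>lborel) \<partial>lborel)"
    by (intro lborel_pair.Fubini') measurable
  also have "ennreal (1 / pi) * \<dots> = (\<integral>\<^sup>+s. ennreal (1 / pi) * (\<integral>\<^sup>+z. ennreal (joint s z) * f z \<partial>lborel) \<partial>lborel)"
    by (intro nn_integral_cmult[symmetric]) measurable
  also have "\<dots> = (\<integral>\<^sup>+s. ennreal weight_const * (ennreal (gamma_density s) * (\<integral>\<^sup>+q. f (sample_point (s, q)) \<partial>(std_normal \<Otimes>\<^sub>M std_normal))) \<partial>lborel)"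
  proof (intro nn_integral_cong)
    fix s :: real
    show "ennreal (1 / pi) * (\<integral>\<^sup>+z. ennreal (joint s z) * f z \<partial>lborel) =
       ennreal weight_const * (ennreal (gamma_density s) * (\<integral>\<^sup>+q. f (sample_point (s, q)) \<partial>(std_normal \<Otimes>\<^sub>M std_normal)))"
    proof (cases "s > 0")
      case False
      then show ?thesis by (simp add: joint_def gamma_density_def)
    next
      case True
      let ?g = "sqrt (s / a)"
      have g: "?g > 0" using True a by simp
      have "ennreal (1 / pi) * (\<integral>\<^sup>+z. ennreal (joint s z) * f z \<partial>lborel) =
          (\<integral>\<^sup>+z. ennreal (1 / pi * joint s z) * f z \<partial>lborel)"
        by (subst nn_integral_cmult[symmetric], measurable)
           (intro nn_integral_cong, simp only: ennreal_mult' mult.assoc zero_le_divide_1_iff pi_ge_zero)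
      also have "\<dots> = (\<integral>\<^sup>+x. \<integral>\<^sup>+y. ennreal (1 / pi * joint s (Complex x y)) * f (Complex x y) \<partial>lborel \<partial>lborel)"
        by (rule nn_integral_complex) measurable
      also have "\<dots> = (\<integral>\<^sup>+x. \<integral>\<^sup>+y. ennreal (weight_const * gamma_density s) * (ennreal (normal_density (\<tau> * s) ?g x) * (ennreal (normal_density 0 ?g y) * f (Complex x y))) \<partial>lborel \<partial>lborel)"
        unfolding joint_factor[OF True] using gamma_density_nonneg[of s] weight_const_pos
        by (intro nn_integral_cong) (simp add: ennreal_mult mult.assoc)
      also have "\<dots> = ennreal (weight_const * gamma_density s) * (\<integral>\<^sup>+x. ennreal (normal_density (\<tau> * s) ?g x) * (\<integral>\<^sup>+y. ennreal (normal_density 0 ?g y) * f (Complex x y) \<partial>lborel) \<partial>lborel)"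
        by (simp add: nn_integral_cmult)
      also have "(\<integral>\<^sup>+x. ennreal (normal_density (\<tau> * s) ?g x) * (\<integral>\<^sup>+y. ennreal (normal_density 0 ?g y) * f (Complex x y) \<partial>lborel) \<partial>lborel)
         = (\<integral>\<^sup>+x. \<integral>\<^sup>+y. f (Complex (\<tau> * s + ?g * x) (0 + ?g * y)) \<partial>std_normal \<partial>std_normal)"
      proof -
        have "(\<integral>\<^sup>+y. ennreal (normal_density 0 ?g y) * f (Complex x y) \<partial>lborel) = (\<integral>\<^sup>+y. f (Complex x (0 + ?g * y)) \<partial>std_normal)" for x
          by (rule nn_integral_normal_affine[OF g]) measurable
        moreover have "(\<integral>\<^sup>+x. ennreal (normal_density (\<tau> * s) ?g x) * (\<integral>\<^sup>+y. f (Complex x (0 + ?g * y)) \<partial>std_normal) \<partial>lborel)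
            = (\<integral>\<^sup>+x. \<integral>\<^sup>+y. f (Complex (\<tau> * s + ?g * x) (0 + ?g * y)) \<partial>std_normal \<partial>std_normal)"
          by (rule nn_integral_normal_affine[OF g]) measurable
        ultimately show ?thesis by simp
      qed
      also have "\<dots> = (\<integral>\<^sup>+q. f (sample_point (s, q)) \<partial>(std_normal \<Otimes>\<^sub>M std_normal))"
        by (subst std_normal.nn_integral_fst[symmetric]) (auto simp: sample_point_def gauss_point_def Complex_eq algebra_simps)
      finally show ?thesis using gamma_density_nonneg[of s] weight_const_pos by (simp add: ennreal_mult mult.assoc)
    qed
  qed
  also have "\<dots> = ennreal weight_const * (\<integral>\<^sup>+s. ennreal (gamma_density s) * (\<integral>\<^sup>+q. f (sample_point (s, q)) \<partial>(std_normal \<Otimes>\<^sub>M std_normal)) \<partial>lborel)"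
    by (intro nn_integral_cmult) measurable
  also have "(\<integral>\<^sup>+s. ennreal (gamma_density s) * (\<integral>\<^sup>+q. f (sample_point (s, q)) \<partial>(std_normal \<Otimes>\<^sub>M std_normal)) \<partial>lborel) = (\<integral>\<^sup>+s. (\<integral>\<^sup>+q. f (sample_point (s, q)) \<partial>(std_normal \<Otimes>\<^sub>M std_normal)) \<partial>gamma_law)"
    unfolding gamma_law_def by (subst nn_integral_density) auto
  also have "\<dots> = (\<integral>\<^sup>+p. f (sample_point p) \<partial>sample)"
    unfolding sample_def by (subst sigma_finite_measure.nn_integral_fst[OF G2.sigma_finite_measure_axioms, symmetric]) auto
  also have "\<dots> = (\<integral>\<^sup>+z. f z \<partial>law)"
    unfolding law_def by (subst nn_integral_distr) auto
  finally show ?thesis .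
qed

lemma law_eq_density:
  fixes w :: "complex \<Rightarrow> real"
  assumes w: "\<And>z. z \<noteq> 0 \<Longrightarrow> w z = bessel_K \<nu> (a * cmod z) * cmod z powr \<nu> * exp (a * \<tau> * Re z)"
    and w0: "\<And>z. w z \<ge> 0"
    and wm[measurable]: "w \<in> borel_measurable borel"
  shows "law = density dA (\<lambda>z. ennreal (w z / weight_const))"
proof (rule measure_eqI)
  fix A assume "A \<in> sets law"
  then have A[measurable]: "A \<in> sets borel" by simp
  have "emeasure (density dA (\<lambda>z. ennreal (w z / weight_const))) A = (\<integral>\<^sup>+z. ennreal (w z / weight_const) * indicator A z \<partial>dA)"
    by (intro emeasure_density) auto
  also have "\<dots> = (\<integral>\<^sup>+z. ennreal (1 / weight_const) * (ennreal (w z) * indicator A z) \<partial>dA)"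
    using weight_const_pos w0 by (intro nn_integral_cong) (simp add: ennreal_mult[symmetric] mult.assoc[symmetric])
  also have "\<dots> = ennreal (1 / weight_const) * (ennreal weight_const * (\<integral>\<^sup>+z. indicator A z \<partial>law))"
    by (subst nn_integral_cmult) (auto simp: nn_integral_weight[OF w wm])
  also have "\<dots> = emeasure law A"
    using weight_const_pos by (simp add: mult.assoc[symmetric] ennreal_mult[symmetric])
  finally show "emeasure law A = emeasure (density dA (\<lambda>z. ennreal (w z / weight_const))) A" ..
qed simp

end

section \<open>Fourier coefficients of powers of a trigonometric symbol\<close>

text \<open>The Fourier coefficients of the \<open>i\<close>-th power of \<open>d + 2 b cos t\<close>; the function is even, so half a period
suffices.  They are the entries of the \<open>i\<close>-th power of the doubly infinite tridiagonal matrix with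
diagonal \<open>d\<close> and off-diagonal \<open>b\<close>.\<close>

definition symbol_coeff :: "real \<Rightarrow> real \<Rightarrow> nat \<Rightarrow> int \<Rightarrow> real" where
  "symbol_coeff d b i l = (1 / pi) * (LBINT t:{-pi..0}. (d + 2 * b * cos t) ^ i * cos (of_int l * t))"

lemma set_integrable_cont: 
  fixes f :: "real \<Rightarrow> real"
  assumes "continuous_on UNIV f" shows "set_integrable lborel {a..b} f"
  unfolding set_integrable_def
  by (rule borel_integrable_compact) (auto intro: continuous_on_subset[OF assms])

lemma symbol_coeff_0: "symbol_coeff d b 0 l = (if l = 0 then 1 else 0)"
proof -
  have "(LBINT t:{-pi..0}. cos (of_int l * t)) = (if l = 0 then pi else 0)"
  proof (cases "l = 0")
    case True
    then show ?thesis by (simp add: set_lebesgue_integral_def)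
  next
    case False
    have "(LBINT t. indicator {-pi..0} t *\<^sub>R cos (of_int l * t)) =
        sin (of_int l * 0) / of_int l - sin (of_int l * (-pi)) / of_int l"
      by (rule integral_FTC_Icc) (use False in \<open>auto intro!: derivative_eq_intros continuous_intros
         simp flip: has_real_derivative_iff_has_vector_derivative\<close>)
    also have "\<dots> = 0" using sin_int_times_real[of l] by (simp add: sin_zero_iff_int2 mult.commute)
    finally show ?thesis using False by (simp add: set_lebesgue_integral_def)
  qed
  then show ?thesis by (simp add: symbol_coeff_def)
qed

lemma symbol_coeff_Suc:
  "symbol_coeff d b (Suc i) l = b * symbol_coeff d b i (l - 1) + d * symbol_coeff d b i l + b * symbol_coeff d b i (l + 1)"
proof -
  have int: "set_integrable lborel {-pi..0} (\<lambda>t. (d + 2 * b * cos t) ^ i * cos (of_int k * t))" for k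
    by (intro set_integrable_cont continuous_intros)
  have "(LBINT t:{-pi..0}. (d + 2 * b * cos t) ^ Suc i * cos (of_int l * t)) =
     (LBINT t:{-pi..0}. b * ((d + 2 * b * cos t) ^ i * cos (of_int (l - 1) * t)) +
        d * ((d + 2 * b * cos t) ^ i * cos (of_int l * t)) +
        b * ((d + 2 * b * cos t) ^ i * cos (of_int (l + 1) * t)))"
  proof (intro set_lebesgue_integral_cong allI impI)
    fix t :: real
    have "cos (of_int (l - 1) * t) + cos (of_int (l + 1) * t) = 2 * cos t * cos (of_int l * t)"
      by (simp add: algebra_simps cos_add cos_diff)
    moreover have "b * cos (of_int (l - 1) * t) + d * cos (of_int l * t) + b * cos (of_int (l + 1) * t)
        = d * cos (of_int l * t) + b * (cos (of_int (l - 1) * t) + cos (of_int (l + 1) * t))"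
      by (simp only: distrib_left ac_simps)
    ultimately have e: "(d + 2 * b * cos t) * cos (of_int l * t) =
        b * cos (of_int (l - 1) * t) + d * cos (of_int l * t) + b * cos (of_int (l + 1) * t)"
      by (simp only: distrib_right distrib_left ac_simps)
    have "(d + 2 * b * cos t) ^ Suc i * cos (of_int l * t) =
        (d + 2 * b * cos t) ^ i * ((d + 2 * b * cos t) * cos (of_int l * t))"
      by (simp only: power_Suc2 mult.assoc)
    then show "(d + 2 * b * cos t) ^ Suc i * cos (of_int l * t) =
        b * ((d + 2 * b * cos t) ^ i * cos (of_int (l - 1) * t)) +
        d * ((d + 2 * b * cos t) ^ i * cos (of_int l * t)) +
        b * ((d + 2 * b * cos t) ^ i * cos (of_int (l + 1) * t))"
      unfolding e by (simp only: distrib_left ac_simps)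
  qed simp
  also have "\<dots> = b * (LBINT t:{-pi..0}. (d + 2 * b * cos t) ^ i * cos (of_int (l - 1) * t)) +
        d * (LBINT t:{-pi..0}. (d + 2 * b * cos t) ^ i * cos (of_int l * t)) +
        b * (LBINT t:{-pi..0}. (d + 2 * b * cos t) ^ i * cos (of_int (l + 1) * t))"
    using int[of "l - 1"] int[of l] int[of "l + 1"]
    by (simp only: set_integral_add set_integral_mult_right set_integrable_mult_right simp_thms)
  finally show ?thesis by (simp add: symbol_coeff_def algebra_simps)
qed

lemma symbol_coeff_eq_0: "\<bar>l\<bar> > int i \<Longrightarrow> symbol_coeff d b i l = 0"
proof (induction i arbitrary: l)
  case (Suc i)
  then have "\<bar>l - 1\<bar> > int i" "\<bar>l\<bar> > int i" "\<bar>l + 1\<bar> > int i" by auto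
  then show ?case by (simp add: symbol_coeff_Suc Suc.IH)
qed (auto simp: symbol_coeff_0)

lemma sum_int_shift:
  fixes f :: "int \<Rightarrow> real"
  assumes "f (- int n) = 0" "f (int n + 1) = 0"
  shows "(\<Sum>l\<in>{-int n..int n}. f (l + 1)) = (\<Sum>l\<in>{-int n..int n}. f l)"
proof -
  have "(\<Sum>l\<in>{-int n..int n}. f (l + 1)) = (\<Sum>l\<in>(\<lambda>l. l + 1) ` {-int n..int n}. f l)"
    by (subst sum.reindex) (auto simp: inj_on_def)
  also have "(\<lambda>l. l + 1) ` {-int n..int n} = {-int n + 1..int n + 1}" by simp
  also have "sum f {-int n + 1..int n + 1} = sum f (insert (-int n) {-int n + 1..int n + 1})"
    using assms(1) by (subst sum.insert) auto
  also have "insert (-int n) {-int n + 1..int n + 1} = insert (int n + 1) {-int n..int n}" by auto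
  also have "sum f \<dots> = (\<Sum>l\<in>{-int n..int n}. f l)"
    using assms(2) by (subst sum.insert) auto
  finally show ?thesis .
qed

text \<open>This is the symmetry of the tridiagonal matrix.\<close>

lemma symbol_coeff_parseval_step:
  assumes n: "n \<ge> i + j + 2"
  shows "(\<Sum>l\<in>{-int n..int n}. symbol_coeff d b (Suc i) l * symbol_coeff d b j l) =
   (\<Sum>l\<in>{-int n..int n}. symbol_coeff d b i l * symbol_coeff d b (Suc j) l)"
proof -
  let ?S = "\<lambda>f::int \<Rightarrow> real. \<Sum>l\<in>{-int n..int n}. f l"
  let ?a = "symbol_coeff d b"
  have z: "?a i (int n) = 0" "?a i (- int n) = 0" "?a j (int n) = 0" "?a j (- int n) = 0"
    "?a i (- int n - 1) = 0" "?a j (- int n - 1) = 0"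
    using n by (simp_all add: symbol_coeff_eq_0)
  have 1: "?S (\<lambda>l. ?a i (l - 1) * ?a j l) = ?S (\<lambda>l. ?a i l * ?a j (l + 1))"
    using sum_int_shift[of "\<lambda>l. ?a i (l - 1) * ?a j l" n] z by simp
  have 2: "?S (\<lambda>l. ?a i (l + 1) * ?a j l) = ?S (\<lambda>l. ?a i l * ?a j (l - 1))"
    using sum_int_shift[of "\<lambda>l. ?a i l * ?a j (l - 1)" n] z by simp
  have L: "?a (Suc i) l * ?a j l = b * (?a i (l - 1) * ?a j l) + d * (?a i l * ?a j l) + b * (?a i (l + 1) * ?a j l)" for l
    unfolding symbol_coeff_Suc by (simp add: algebra_simps)
  have R: "?a i l * ?a (Suc j) l = b * (?a i l * ?a j (l + 1)) + d * (?a i l * ?a j l) + b * (?a i l * ?a j (l - 1))" for l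
    unfolding symbol_coeff_Suc by (simp add: algebra_simps)
  have 3: "?S (\<lambda>l. ?a (Suc i) l * ?a j l) = b * ?S (\<lambda>l. ?a i (l - 1) * ?a j l) + d * ?S (\<lambda>l. ?a i l * ?a j l)
      + b * ?S (\<lambda>l. ?a i (l + 1) * ?a j l)"
    by (simp only: L sum.distrib sum_distrib_left)
  have 4: "?S (\<lambda>l. ?a i l * ?a (Suc j) l) = b * ?S (\<lambda>l. ?a i l * ?a j (l + 1)) + d * ?S (\<lambda>l. ?a i l * ?a j l)
      + b * ?S (\<lambda>l. ?a i l * ?a j (l - 1))"
    by (simp only: R sum.distrib sum_distrib_left)
  show ?thesis unfolding 3 4 1 2 ..
qed

lemma symbol_coeff_parseval:
  "n \<ge> i + j + 1 \<Longrightarrow> (\<Sum>l\<in>{-int n..int n}. symbol_coeff d b i l * symbol_coeff d b j l) = symbol_coeff d b (i + j) 0"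
proof (induction i arbitrary: j)
  case 0
  have "(\<Sum>l\<in>{-int n..int n}. symbol_coeff d b 0 l * symbol_coeff d b j l) =
      (\<Sum>l\<in>{0}. symbol_coeff d b 0 l * symbol_coeff d b j l)"
    by (intro sum.mono_neutral_right) (auto simp: symbol_coeff_0)
  then show ?case by (simp add: symbol_coeff_0)
next
  case (Suc i)
  have n: "n \<ge> i + j + 2" "n \<ge> i + Suc j + 1" using Suc.prems by auto
  have "i + Suc j = Suc i + j" by simp
  then show ?case
    using trans[OF symbol_coeff_parseval_step[OF n(1), of d b] Suc.IH[OF n(2)]] by (simp only:)
qed

lemma sum_eq_integral_floor:
  fixes g :: "nat \<Rightarrow> real"
  assumes N: "N > 0"
  shows "(1 / real N) * (\<Sum>k<N. g k) = (\<integral>x. indicator {0<..<1} x * g (nat \<lfloor>real N * x\<rfloor>) \<partial>lborel)"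
proof -
  have "(\<integral>x. indicator {0<..<1} x * g (nat \<lfloor>real N * x\<rfloor>) \<partial>lborel) =
        (\<integral>x. (\<Sum>k<N. g k * indicator {real k / real N..<real (Suc k) / real N} x) \<partial>lborel)"
  proof (rule integral_cong_AE)
    show "AE x in lborel. indicator {0<..<1} x * g (nat \<lfloor>real N * x\<rfloor>) =
       (\<Sum>k<N. g k * indicator {real k / real N..<real (Suc k) / real N} x)"
    proof -
      have "AE x in lborel. x \<noteq> (0::real)" by (rule AE_lborel_singleton)
      then show ?thesis
      proof eventually_elim
        case (elim x)
        have iff: "x \<in> {real k / real N..<real (Suc k) / real N} \<longleftrightarrow> x > 0 \<and> nat \<lfloor>real N * x\<rfloor> = k" for k
        proof -
          have "x \<in> {real k / real N..<real (Suc k) / real N} \<longleftrightarrow> real k \<le> real N * x \<and> real N * x < real k + 1"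
            using N by (auto simp: field_simps)
          also have "\<dots> \<longleftrightarrow> \<lfloor>real N * x\<rfloor> = int k" by (simp add: floor_eq_iff)
          also have "\<dots> \<longleftrightarrow> x > 0 \<and> nat \<lfloor>real N * x\<rfloor> = k"
          proof (cases "x > 0")
            case True
            then show ?thesis using N by (auto simp: nat_eq_iff)
          next
            case False
            with elim have "x < 0" by simp
            then have "real N * x < 0" using N by (simp add: mult_pos_neg)
            then have "\<lfloor>real N * x\<rfloor> < 0" by (simp add: floor_less_iff)
            then have "\<lfloor>real N * x\<rfloor> \<noteq> int k" by linarith
            then show ?thesis using False by simp
          qed
          finally show ?thesis .
        qed
        have "(\<Sum>k<N. g k * indicator {real k / real N..<real (Suc k) / real N} x) =
            (\<Sum>k<N. if k = nat \<lfloor>real N * x\<rfloor> then (if x > 0 then g k else 0) else 0)"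
          by (intro sum.cong refl) (simp only: indicator_def iff, auto)
        also have "\<dots> = (if nat \<lfloor>real N * x\<rfloor> < N \<and> x > 0 then g (nat \<lfloor>real N * x\<rfloor>) else 0)"
          by simp
        also have "(nat \<lfloor>real N * x\<rfloor> < N \<and> x > 0) \<longleftrightarrow> x \<in> {0<..<1}"
        proof -
          have "real N * x < real N \<longleftrightarrow> x < 1"
            using N mult_less_cancel_left_pos[of "real N" x 1] by simp
          moreover have "nat \<lfloor>real N * x\<rfloor> < N \<longleftrightarrow> \<lfloor>real N * x\<rfloor> < int N"
            using N by linarith
          ultimately show ?thesis by (auto simp only: floor_less_iff of_int_of_nat_eq greaterThanLessThan_iff)
        qed
        finally show ?case by (auto simp: indicator_def)
      qed
    qed
  qed measurable
  also have "\<dots> = (\<Sum>k<N. g k * (1 / real N))"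
    using N by (subst Bochner_Integration.integral_sum) (auto simp: field_simps)
  also have "\<dots> = (1 / real N) * (\<Sum>k<N. g k)"
    by (subst sum_distrib_right[symmetric]) (rule mult.commute)
  finally show ?thesis ..
qed

section \<open>The Marchenko-Pastur law as a mixture of arcsine laws\<close>

text \<open>The half period from \<open>- \<pi>\<close> to 0 is chosen because the cosine is increasing there.\<close>

lemma nn_integral_arcsine:
  fixes d b :: real
  assumes b: "b > 0" and A[measurable]: "A \<in> sets borel"
  shows "(\<integral>\<^sup>+t. ennreal (indicator A (d + b * cos t) * indicator {-pi..0} t) \<partial>lborel) =
         (\<integral>\<^sup>+y. ennreal (indicator A y / sqrt (b\<^sup>2 - (y - d)\<^sup>2) * indicator {d - b..d + b} y) \<partial>lborel)"
proof -
  have "(\<integral>\<^sup>+y. ennreal (indicator A y / sqrt (b\<^sup>2 - (y - d)\<^sup>2) *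
            indicator {(\<lambda>t. d + b * cos t) (-pi)..(\<lambda>t. d + b * cos t) 0} y) \<partial>lborel) =
        (\<integral>\<^sup>+t. ennreal (indicator A (d + b * cos t) / sqrt (b\<^sup>2 - ((d + b * cos t) - d)\<^sup>2) *
            (- b * sin t) * indicator {-pi..0} t) \<partial>lborel)"
  proof (rule nn_integral_substitution)
    show "set_borel_measurable borel {d + b * cos (- pi)..d + b * cos 0}
        (\<lambda>y. indicat_real A y / sqrt (b\<^sup>2 - (y - d)\<^sup>2))"
      unfolding set_borel_measurable_def by measurable
    show "continuous_on {- pi..0} (\<lambda>t. - b * sin t)" by (intro continuous_intros)
    show "((\<lambda>t. d + b * cos t) has_real_derivative - b * sin x) (at x)" for x
      by (auto intro!: derivative_eq_intros)
    show "0 \<le> - b * sin x" if "x \<in> {-pi..0}" for x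
      using b that sin_ge_zero[of "-x"] by (simp add: mult_nonneg_nonpos)
  qed simp
  also have "\<dots> = (\<integral>\<^sup>+t. ennreal (indicator A (d + b * cos t) * indicator {-pi..0} t) \<partial>lborel)"
  proof (rule nn_integral_cong_AE)
    have "AE t in lborel. t \<noteq> -pi" "AE t in lborel. t \<noteq> (0::real)"
      by (auto intro: AE_lborel_singleton)
    then show "AE t in lborel. ennreal (indicator A (d + b * cos t) / sqrt (b\<^sup>2 - ((d + b * cos t) - d)\<^sup>2) *
            (- b * sin t) * indicator {-pi..0} t) =
          ennreal (indicator A (d + b * cos t) * indicator {-pi..0} t)"
    proof eventually_elim
      case (elim t)
      show ?case
      proof (cases "t \<in> {-pi..0}")
        case True
        with elim have "0 < -t" "-t < pi" by auto
        then have s: "sin t < 0" using sin_gt_zero[of "-t"] by simp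
        have "b\<^sup>2 - (d + b * cos t - d)\<^sup>2 = (- b * sin t)\<^sup>2"
          by (simp add: power_mult_distrib cos_squared_eq algebra_simps)
        then have "sqrt (b\<^sup>2 - (d + b * cos t - d)\<^sup>2) = - b * sin t"
          using mult_pos_neg[OF b s] by simp
        then show ?thesis using s b by (simp add: field_simps)
      qed simp
    qed
  qed
  finally show ?thesis by simp
qed

text \<open>The substitution \<open>r x - s = v\<^sup>2\<close> removes the singularity.\<close>

lemma nn_integral_inv_sqrt_linear:
  fixes r s :: real
  assumes r: "r > 0" and s: "0 \<le> s"
  shows "(\<integral>\<^sup>+x. ennreal ((if 0 \<le> r * x - s then 1 / sqrt (r * x - s) else 0) * indicator {0..1} x) \<partial>lborel)
       = ennreal (if s \<le> r then 2 / r * sqrt (r - s) else 0)"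
proof (cases "s \<le> r")
  case False
  have "(\<integral>\<^sup>+x. ennreal ((if 0 \<le> r * x - s then 1 / sqrt (r * x - s) else 0) * indicator {0..1} x) \<partial>lborel)
     = (\<integral>\<^sup>+x. 0 \<partial>(lborel :: real measure))"
  proof (intro nn_integral_cong)
    fix x :: real
    have "r * x - s < 0" if "x \<in> {0..1}"
    proof -
      have "r * x \<le> r" using that r by (intro mult_left_le) auto
      then show ?thesis using False by linarith
    qed
    then show "ennreal ((if 0 \<le> r * x - s then 1 / sqrt (r * x - s) else 0) * indicator {0..1} x) = 0"
      by (auto simp: indicator_def)
  qed
  then show ?thesis using False by simp
next
  case True
  define u where "u = sqrt (r - s)"
  have u: "u \<ge> 0" "u\<^sup>2 = r - s" using True by (auto simp: u_def)
  let ?g = "\<lambda>v. (v\<^sup>2 + s) / r"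
  have "(\<integral>\<^sup>+x. ennreal (1 / sqrt (r * x - s) * indicator {?g 0..?g u} x) \<partial>lborel) =
        (\<integral>\<^sup>+v. ennreal (1 / sqrt (r * ?g v - s) * (2 * v / r) * indicator {0..u} v) \<partial>lborel)"
  proof (rule nn_integral_substitution)
    show "set_borel_measurable borel {(0\<^sup>2 + s) / r..(u\<^sup>2 + s) / r} (\<lambda>x. 1 / sqrt (r * x - s))"
      unfolding set_borel_measurable_def by measurable
    show "((\<lambda>v. (v\<^sup>2 + s) / r) has_real_derivative 2 * x / r) (at x)" for x
      using r by (auto intro!: derivative_eq_intros)
    show "continuous_on {0..u} (\<lambda>v. 2 * v / r)" using r by (intro continuous_intros) auto
    show "0 \<le> 2 * x / r" if "x \<in> {0..u}" for x using that r by simp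
  qed (use u in simp)
  also have "\<dots> = (\<integral>\<^sup>+v. ennreal (2 / r) * indicator {0..u} v \<partial>lborel)"
  proof (rule nn_integral_cong_AE)
    have "AE v in lborel. v \<noteq> (0::real)" by (auto intro: AE_lborel_singleton)
    then show "AE v in lborel. ennreal (1 / sqrt (r * ?g v - s) * (2 * v / r) * indicator {0..u} v)
        = ennreal (2 / r) * indicator {0..u} v"
      by eventually_elim (use r in \<open>auto simp: indicator_def\<close>)
  qed
  also have "\<dots> = ennreal (2 / r * u)"
    using u r ennreal_mult[of "2 / r" u] by (simp add: nn_integral_cmult)
  also have "(\<integral>\<^sup>+x. ennreal (1 / sqrt (r * x - s) * indicator {?g 0..?g u} x) \<partial>lborel) =
      (\<integral>\<^sup>+x. ennreal ((if 0 \<le> r * x - s then 1 / sqrt (r * x - s) else 0) * indicator {0..1} x) \<partial>lborel)"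
  proof (intro nn_integral_cong)
    fix x :: real
    have "?g u = 1" using u r by (simp add: field_simps)
    moreover have "x \<in> {?g 0..1} \<longleftrightarrow> x \<in> {0..1} \<and> 0 \<le> r * x - s"
      using r s by (auto simp: field_simps) (smt (verit) mult_nonneg_nonpos2 zero_le_mult_iff)+
    ultimately show "ennreal (1 / sqrt (r * x - s) * indicator {?g 0..?g u} x) =
        ennreal ((if 0 \<le> r * x - s then 1 / sqrt (r * x - s) else 0) * indicator {0..1} x)"
      by (auto simp: indicator_def)
  qed
  finally show ?thesis using True by (simp add: u_def)
qed

definition mp_sample :: "(real \<times> real) measure" where
  "mp_sample = uniform_measure lborel {0..1} \<Otimes>\<^sub>M uniform_measure lborel {-pi..0}"

text \<open>For fixed \<open>x\<close> and uniformly distributed \<open>t\<close> the value has an arcsine law.\<close>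

definition mp_map :: "real \<Rightarrow> real \<times> real \<Rightarrow> real" where
  "mp_map \<alpha> = (\<lambda>(x, t). 2 * x + \<alpha> + 2 * sqrt (x * (x + \<alpha>)) * cos t)"

lemma mp_map_measurable [measurable]: "mp_map \<alpha> \<in> borel_measurable (borel \<Otimes>\<^sub>M borel)"
  unfolding mp_map_def by measurable

lemma sets_mp_sample [measurable_cong]: "sets mp_sample = sets (borel \<Otimes>\<^sub>M borel)"
  unfolding mp_sample_def by (intro sets_pair_measure_cong) auto

lemma prob_space_mp_sample: "prob_space mp_sample"
proof -
  interpret A: prob_space "uniform_measure lborel {0..1::real}"
    by (rule prob_space_uniform_measure) auto
  interpret B: prob_space "uniform_measure lborel {-pi..0::real}"
    by (rule prob_space_uniform_measure) auto
  interpret pair_prob_space "uniform_measure lborel {0..1::real}" "uniform_measure lborel {-pi..0::real}" ..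
  show ?thesis unfolding mp_sample_def by unfold_locales
qed

lemma mp_density_nonpos: "0 \<le> \<alpha> \<Longrightarrow> \<xi> \<le> 0 \<Longrightarrow> mp_density \<alpha> \<xi> = 0"
  unfolding mp_density_def mp_edge_minus_def
  by (cases "\<xi> = 0") (auto simp: indicator_def, smt (verit) zero_le_power2)

lemma mp_density_eq:
  assumes \<alpha>: "0 \<le> \<alpha>" and \<xi>: "\<xi> > 0"
  shows "mp_density \<alpha> \<xi> = (if (\<xi> - \<alpha>)\<^sup>2 \<le> 4 * \<xi> then 1 / pi * (2 / (4 * \<xi>) * sqrt (4 * \<xi> - (\<xi> - \<alpha>)\<^sup>2)) else 0)"
proof -
  define r where "r = sqrt (\<alpha> + 1)"
  have r: "r\<^sup>2 = \<alpha> + 1" "r \<ge> 0" using \<alpha> by (auto simp: r_def)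
  have "(mp_edge_plus \<alpha> - \<xi>) * (\<xi> - mp_edge_minus \<alpha>) = 
     - \<xi>\<^sup>2 + 2 * (r\<^sup>2 + 1) * \<xi> - (r\<^sup>2 - 1)\<^sup>2"
    unfolding mp_edge_plus_def mp_edge_minus_def r_def[symmetric]
    by (simp add: power2_eq_square algebra_simps del: real_sqrt_mult_self real_sqrt_pow2)
  also have "\<dots> = 4 * \<xi> - (\<xi> - \<alpha>)\<^sup>2" unfolding r(1) by (simp add: power2_eq_square algebra_simps)
  finally have e: "(mp_edge_plus \<alpha> - \<xi>) * (\<xi> - mp_edge_minus \<alpha>) = 4 * \<xi> - (\<xi> - \<alpha>)\<^sup>2" .
  have le: "mp_edge_minus \<alpha> \<le> mp_edge_plus \<alpha>"
    using r(2) \<alpha> by (simp add: mp_edge_plus_def mp_edge_minus_def r_def[symmetric] power2_eq_square algebra_simps)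
  have "\<xi> \<in> {mp_edge_minus \<alpha>..mp_edge_plus \<alpha>} \<longleftrightarrow> 0 \<le> (mp_edge_plus \<alpha> - \<xi>) * (\<xi> - mp_edge_minus \<alpha>)"
    using le by (auto simp: zero_le_mult_iff)
  then have "\<xi> \<in> {mp_edge_minus \<alpha>..mp_edge_plus \<alpha>} \<longleftrightarrow> (\<xi> - \<alpha>)\<^sup>2 \<le> 4 * \<xi>"
    unfolding e by simp
  then show ?thesis
    unfolding mp_density_def e using \<xi> by (auto simp: indicator_def)
qed

lemma mp_density_measurable [measurable]: "mp_density \<alpha> \<in> borel_measurable borel"
  unfolding mp_density_def by measurable

text \<open>The density of the mixture at \<open>y\<close> is the integral of \<open>h x y / \<pi>\<close> over \<open>x\<close>.  The radicand in \<open>h\<close> arises from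
\<open>4x (x + \<alpha>) - (y - 2x - \<alpha>)\<^sup>2 = 4x y - (y - \<alpha>)\<^sup>2\<close> and is linear in \<open>x\<close>.\<close>

lemma density_measure_mp_eq_distr:
  assumes \<alpha>: "0 \<le> \<alpha>"
  shows "density_measure (mp_density \<alpha>) = distr mp_sample borel (mp_map \<alpha>)"
proof (rule measure_eqI)
  show "sets (density_measure (mp_density \<alpha>)) = sets (distr mp_sample borel (mp_map \<alpha>))"
    by (simp add: density_measure_def)
next
  fix A assume "A \<in> sets (density_measure (mp_density \<alpha>))"
  then have A[measurable]: "A \<in> sets borel" by (simp add: density_measure_def)
  define h where "h x y = (if 0 \<le> 4 * x * y - (y - \<alpha>)\<^sup>2 then 1 / sqrt (4 * x * y - (y - \<alpha>)\<^sup>2) else 0)" for x y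
  have h[measurable]: "(\<lambda>(x, y). h x y) \<in> borel_measurable (borel \<Otimes>\<^sub>M borel)"
    unfolding h_def by measurable
  have h0: "0 \<le> h x y" for x y by (simp add: h_def)
  interpret U2: prob_space "uniform_measure lborel {-pi..0::real}"
    by (rule prob_space_uniform_measure) auto
  have inner_t: "(\<integral>\<^sup>+t. indicator A (mp_map \<alpha> (x, t)) \<partial>uniform_measure lborel {-pi..0}) =
      ennreal (1 / pi) * (\<integral>\<^sup>+y. ennreal (indicator A y * h x y) \<partial>lborel)" if x: "x > 0" for x
  proof -
    define b where "b = 2 * sqrt (x * (x + \<alpha>))"
    define d where "d = 2 * x + \<alpha>"
    have b: "b > 0" "b\<^sup>2 = 4 * x * (x + \<alpha>)" using x \<alpha> by (auto simp: b_def power_mult_distrib)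
    have e: "b\<^sup>2 - (y - d)\<^sup>2 = 4 * x * y - (y - \<alpha>)\<^sup>2" for y
      unfolding b(2) d_def by (simp add: power2_eq_square algebra_simps)
    have i: "y \<in> {d - b..d + b} \<longleftrightarrow> 0 \<le> b\<^sup>2 - (y - d)\<^sup>2" for y
    proof -
      have "0 \<le> b\<^sup>2 - (y - d)\<^sup>2 \<longleftrightarrow> \<bar>y - d\<bar> \<le> \<bar>b\<bar>" by (simp add: abs_le_square_iff)
      then show ?thesis using b(1) by auto
    qed
    have "(\<integral>\<^sup>+t. indicator A (mp_map \<alpha> (x, t)) \<partial>uniform_measure lborel {-pi..0}) =
       (\<integral>\<^sup>+t. indicator A (d + b * cos t) * indicator {-pi..0} t \<partial>lborel) / emeasure lborel {-pi..0}"
      unfolding mp_map_def by (subst nn_integral_uniform_measure) (auto simp: d_def b_def)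
    also have "(\<integral>\<^sup>+t. indicator A (d + b * cos t) * indicator {-pi..0} t \<partial>lborel) =
       (\<integral>\<^sup>+t. ennreal (indicator A (d + b * cos t) * indicator {-pi..0} t) \<partial>lborel)"
      by (intro nn_integral_cong) (auto simp: indicator_def)
    also have "\<dots> = (\<integral>\<^sup>+y. ennreal (indicator A y * h x y) \<partial>lborel)"
      unfolding nn_integral_arcsine[OF b(1) A] h_def e[symmetric] i[symmetric]
      by (intro nn_integral_cong) (auto simp: indicator_def)
    finally show ?thesis
      by (simp add: divide_ennreal_def inverse_ennreal mult.commute divide_inverse)
  qed
  have inner_x: "(\<integral>\<^sup>+x. ennreal (h x y) * indicator {0..1} x \<partial>lborel) = ennreal pi * ennreal (mp_density \<alpha> y)"
    if y: "y \<noteq> 0" for y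
  proof (cases "y > 0")
    case True
    have "(\<integral>\<^sup>+x. ennreal (h x y) * indicator {0..1} x \<partial>lborel) =
      (\<integral>\<^sup>+x. ennreal ((if 0 \<le> 4 * y * x - (y - \<alpha>)\<^sup>2 then 1 / sqrt (4 * y * x - (y - \<alpha>)\<^sup>2) else 0) * indicator {0..1} x) \<partial>lborel)"
      unfolding h_def by (intro nn_integral_cong) (auto simp: indicator_def ac_simps)
    also have "\<dots> = ennreal (if (y - \<alpha>)\<^sup>2 \<le> 4 * y then 2 / (4 * y) * sqrt (4 * y - (y - \<alpha>)\<^sup>2) else 0)"
      using True by (intro nn_integral_inv_sqrt_linear) auto
    also have "\<dots> = ennreal pi * ennreal (mp_density \<alpha> y)"
      unfolding mp_density_eq[OF \<alpha> True] using True by (simp flip: ennreal_mult)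
    finally show ?thesis .
  next
    case False
    with y have y: "y < 0" by simp
    have hz: "h x y * indicator {0..1} x = 0" for x
    proof -
      have "4 * x * y - (y - \<alpha>)\<^sup>2 < 0" if "x \<ge> 0"
        using that y \<alpha> mult_nonneg_nonpos[of "4 * x" y] by (smt (verit) zero_less_power2)
      then show ?thesis by (auto simp: h_def indicator_def)
    qed
    then have "(\<integral>\<^sup>+x. ennreal (h x y) * indicator {0..1} x \<partial>lborel) = (\<integral>\<^sup>+x. 0 \<partial>(lborel :: real measure))"
    proof (intro nn_integral_cong)
      fix x show "ennreal (h x y) * indicator {0..1} x = 0"
        using hz[of x] by (cases "x \<in> {0..1}") simp_all
    qed
    then show ?thesis using y \<alpha> by (simp add: mp_density_nonpos)
  qed
  have "emeasure (distr mp_sample borel (mp_map \<alpha>)) A = (\<integral>\<^sup>+p. indicator A (mp_map \<alpha> p) \<partial>mp_sample)"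
    by (subst nn_integral_indicator[symmetric], simp, subst nn_integral_distr) auto
  also have "\<dots> = (\<integral>\<^sup>+x. \<integral>\<^sup>+t. indicator A (mp_map \<alpha> (x, t)) \<partial>uniform_measure lborel {-pi..0} \<partial>uniform_measure lborel {0..1})"
    unfolding mp_sample_def by (subst U2.nn_integral_fst[symmetric]) auto
  also have "\<dots> = (\<integral>\<^sup>+x. (\<integral>\<^sup>+t. indicator A (mp_map \<alpha> (x, t)) \<partial>uniform_measure lborel {-pi..0}) * indicator {0..1} x \<partial>lborel)"
    by (subst nn_integral_uniform_measure) (auto simp: divide_ennreal_def)
  also have "\<dots> = (\<integral>\<^sup>+x. (ennreal (1 / pi) * (\<integral>\<^sup>+y. ennreal (indicator A y * h x y) \<partial>lborel)) * indicator {0..1} x \<partial>lborel)"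
  proof (rule nn_integral_cong_AE)
    have "AE x in lborel. x \<noteq> (0::real)" by (auto intro: AE_lborel_singleton)
    then show "AE x in lborel. (\<integral>\<^sup>+t. indicator A (mp_map \<alpha> (x, t)) \<partial>uniform_measure lborel {-pi..0}) * indicator {0..1} x =
      (ennreal (1 / pi) * (\<integral>\<^sup>+y. ennreal (indicator A y * h x y) \<partial>lborel)) * indicator {0..1} x"
    proof eventually_elim
      case (elim x)
      then show ?case by (cases "x \<in> {0..1}") (auto simp: inner_t)
    qed
  qed
  also have "\<dots> = (\<integral>\<^sup>+x. \<integral>\<^sup>+y. ennreal (1 / pi) * (indicator A y * (ennreal (h x y) * indicator {0..1} x)) \<partial>lborel \<partial>lborel)"
  proof (intro nn_integral_cong)
    fix x :: real
    have "(ennreal (1 / pi) * (\<integral>\<^sup>+y. ennreal (indicator A y * h x y) \<partial>lborel)) * indicator {0..1} x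
      = (\<integral>\<^sup>+y. ennreal (1 / pi) * ennreal (indicator A y * h x y) * indicator {0..1} x \<partial>lborel)"
      by (subst nn_integral_multc, simp, subst nn_integral_cmult) auto
    also have "\<dots> = (\<integral>\<^sup>+y. ennreal (1 / pi) * (indicator A y * (ennreal (h x y) * indicator {0..1} x)) \<partial>lborel)"
      by (intro nn_integral_cong) (auto simp: indicator_def)
    finally show "(ennreal (1 / pi) * (\<integral>\<^sup>+y. ennreal (indicator A y * h x y) \<partial>lborel)) * indicator {0..1} x
      = (\<integral>\<^sup>+y. ennreal (1 / pi) * (indicator A y * (ennreal (h x y) * indicator {0..1} x)) \<partial>lborel)" .
  qed
  also have "\<dots> = (\<integral>\<^sup>+y. \<integral>\<^sup>+x. ennreal (1 / pi) * (indicator A y * (ennreal (h x y) * indicator {0..1} x)) \<partial>lborel \<partial>lborel)"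
    by (intro lborel_pair.Fubini'[symmetric]) measurable
  also have "\<dots> = (\<integral>\<^sup>+y. ennreal (1 / pi) * (indicator A y * (\<integral>\<^sup>+x. ennreal (h x y) * indicator {0..1} x \<partial>lborel)) \<partial>lborel)"
    by (intro nn_integral_cong) (simp add: nn_integral_cmult)
  also have "\<dots> = (\<integral>\<^sup>+y. ennreal (mp_density \<alpha> y) * indicator A y \<partial>lborel)"
  proof (rule nn_integral_cong_AE)
    have "AE y in lborel. y \<noteq> (0::real)" by (auto intro: AE_lborel_singleton)
    then show "AE y in lborel. ennreal (1 / pi) * (indicator A y * (\<integral>\<^sup>+x. ennreal (h x y) * indicator {0..1} x \<partial>lborel)) =
        ennreal (mp_density \<alpha> y) * indicator A y"
    proof eventually_elim
      case (elim y)
      have "ennreal (1 / pi) * ennreal pi = 1" by (simp flip: ennreal_mult)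
      then show ?case by (simp add: inner_x[OF elim] mult_ac) (metis mult.left_commute mult.right_neutral)
    qed
  qed
  also have "\<dots> = emeasure (density_measure (mp_density \<alpha>)) A"
    by (simp add: density_measure_def emeasure_density)
  finally show "emeasure (density_measure (mp_density \<alpha>)) A = emeasure (distr mp_sample borel (mp_map \<alpha>)) A"
    by simp
qed

section \<open>Moments from nearly constant Jacobi coefficients\<close>

text \<open>Suppose \<open>z p\<^sub>n = A (n + 1) p\<^sub>n\<^sub>+\<^sub>1 + d n p\<^sub>n + t A n p\<^sub>n\<^sub>-\<^sub>1\<close> for all \<open>n\<close>.  Then these are the coefficients of \<open>z\<^sup>i p\<^sub>k\<close>
with respect to the \<open>p\<^sub>n\<close>.  At \<open>n = 0\<close> the truncated predecessor is harmless if \<open>A 0 = 0\<close>.\<close>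

fun jacobi_coeff :: "(nat \<Rightarrow> real) \<Rightarrow> (nat \<Rightarrow> real) \<Rightarrow> real \<Rightarrow> nat \<Rightarrow> nat \<Rightarrow> nat \<Rightarrow> real" where
  "jacobi_coeff A d t k 0 n = (if n = k then 1 else 0)"
| "jacobi_coeff A d t k (Suc i) n = A n * jacobi_coeff A d t k i (n - 1) + d n * jacobi_coeff A d t k i n + t * A (Suc n) * jacobi_coeff A d t k i (Suc n)"

lemma jacobi_coeff_eq_0:
  assumes "n > k + i \<or> n + i < k" shows "jacobi_coeff A d t k i n = 0"
  using assms
proof (induction i arbitrary: n)
  case (Suc i)
  have "jacobi_coeff A d t k i (n - 1) = 0" "jacobi_coeff A d t k i n = 0" "jacobi_coeff A d t k i (Suc n) = 0"
    by (rule Suc.IH; use Suc.prems in auto)+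
  then show ?case by simp
qed auto

text \<open>The inner product of \<open>z\<^sup>i p\<^sub>k\<close> and \<open>z\<^sup>j p\<^sub>k\<close> for orthonormal \<open>p\<^sub>n\<close>.  The range contains all indices at which both
coefficients can differ from 0, and leaves room for the window of \<open>symbol_coeff_parseval\<close>.\<close>

definition jacobi_inner :: "(nat \<Rightarrow> real) \<Rightarrow> (nat \<Rightarrow> real) \<Rightarrow> real \<Rightarrow> nat \<Rightarrow> nat \<Rightarrow> nat \<Rightarrow> real" where
  "jacobi_inner A d t k i j = (\<Sum>n\<le>k + i + j + 1. jacobi_coeff A d t k i n * jacobi_coeff A d t k j n)"

text \<open>The \<open>m\<close>-th moment of \<open>Re z = (z + cnj z) / 2\<close> under the measure with density \<open>|p\<^sub>k|\<^sup>2\<close>.\<close>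

definition jacobi_moment :: "(nat \<Rightarrow> real) \<Rightarrow> (nat \<Rightarrow> real) \<Rightarrow> real \<Rightarrow> nat \<Rightarrow> nat \<Rightarrow> real" where
  "jacobi_moment A d t m k = (\<Sum>i\<le>m. real (m choose i) * jacobi_inner A d t k i (m - i)) / 2 ^ m"

text \<open>A bound for the coefficients up to \<open>L\<close> is enough, because \<open>z\<^sup>i p\<^sub>k\<close> only involves indices up to
\<open>k + i\<close>.  In the application \<open>L\<close> is proportional to \<open>N\<close>, and the coefficients are bounded on this scale.\<close>

lemma abs_jacobi_coeff_le:
  assumes B: "\<And>n. n \<le> L \<Longrightarrow> \<bar>A n\<bar> + \<bar>d n\<bar> + \<bar>t\<bar> * \<bar>A (Suc n)\<bar> \<le> B" and B0: "B \<ge> 0"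
    and L: "k + i \<le> L"
  shows "\<bar>jacobi_coeff A d t k i n\<bar> \<le> B ^ i"
  using L
proof (induction i arbitrary: n)
  case (Suc i)
  show ?case
  proof (cases "n \<le> L")
    case False
    then have "jacobi_coeff A d t k (Suc i) n = 0" using Suc.prems by (intro jacobi_coeff_eq_0) auto
    then show ?thesis using B0 by simp
  next
    case True
    have IH: "\<bar>jacobi_coeff A d t k i n\<bar> \<le> B ^ i" for n using Suc by auto
    have "\<bar>jacobi_coeff A d t k (Suc i) n\<bar> \<le> \<bar>A n\<bar> * \<bar>jacobi_coeff A d t k i (n - 1)\<bar> + \<bar>d n\<bar> * \<bar>jacobi_coeff A d t k i n\<bar> + \<bar>t\<bar> * \<bar>A (Suc n)\<bar> * \<bar>jacobi_coeff A d t k i (Suc n)\<bar>"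
      unfolding jacobi_coeff.simps abs_mult[symmetric] by linarith
    also have "\<dots> \<le> \<bar>A n\<bar> * B ^ i + \<bar>d n\<bar> * B ^ i + \<bar>t\<bar> * \<bar>A (Suc n)\<bar> * B ^ i"
      by (intro add_mono mult_left_mono IH) auto
    also have "\<dots> = (\<bar>A n\<bar> + \<bar>d n\<bar> + \<bar>t\<bar> * \<bar>A (Suc n)\<bar>) * B ^ i" by (simp add: distrib_right)
    also have "\<dots> \<le> B * B ^ i" using B[OF True] B0 by (intro mult_right_mono) auto
    finally show ?thesis by simp
  qed
qed simp

lemma abs_jacobi_inner_le:
  assumes B: "\<And>n. n \<le> L \<Longrightarrow> \<bar>A n\<bar> + \<bar>d n\<bar> + \<bar>t\<bar> * \<bar>A (Suc n)\<bar> \<le> B" and B0: "B \<ge> 0"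
    and L: "k + i + j \<le> L"
  shows "\<bar>jacobi_inner A d t k i j\<bar> \<le> (2 * real i + 1) * B ^ (i + j)"
proof -
  have "jacobi_inner A d t k i j = (\<Sum>n\<in>{k - i..k + i}. jacobi_coeff A d t k i n * jacobi_coeff A d t k j n)"
    unfolding jacobi_inner_def by (intro sum.mono_neutral_right) (auto intro!: jacobi_coeff_eq_0)
  also have "\<bar>\<dots>\<bar> \<le> (\<Sum>n\<in>{k - i..k + i}. B ^ (i + j))"
  proof (rule order_trans[OF sum_abs], rule sum_mono)
    fix n
    show "\<bar>jacobi_coeff A d t k i n * jacobi_coeff A d t k j n\<bar> \<le> B ^ (i + j)"
      unfolding abs_mult power_add using B0 L
      by (intro mult_mono abs_jacobi_coeff_le[where L = L and A = A and d = d and t = t and B = B, OF B]) auto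
  qed
  also have "\<dots> = real (card {k - i..k + i}) * B ^ (i + j)" by simp
  also have "\<dots> \<le> (2 * real i + 1) * B ^ (i + j)"
    using B0 by (intro mult_right_mono) (auto simp: of_nat_diff)
  finally show ?thesis .
qed

text \<open>Only finitely many diagonals around the row \<open>k N\<close> matter, and on them the matrix of multiplication by \<open>z\<close>
tends to the doubly infinite matrix with constant diagonals.  As \<open>k N\<close> tends to infinity, the
boundary at index 0 is not seen.\<close>

lemma jacobi_coeff_tendsto:
  fixes A d :: "nat \<Rightarrow> nat \<Rightarrow> real" and k :: "nat \<Rightarrow> nat"
  assumes k: "filterlim k at_top sequentially"
    and A: "\<And>l. (\<lambda>N. A N (nat (int (k N) + l))) \<longlonglongrightarrow> b"
    and d: "\<And>l. (\<lambda>N. d N (nat (int (k N) + l))) \<longlonglongrightarrow> e"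
    and t: "t \<longlonglongrightarrow> 1"
  shows "(\<lambda>N. jacobi_coeff (A N) (d N) (t N) (k N) i (nat (int (k N) + l))) \<longlonglongrightarrow> symbol_coeff e b i l"
proof (induction i arbitrary: l)
  case 0
  have "eventually (\<lambda>N. k N \<ge> Suc (nat \<bar>l\<bar>)) sequentially"
    using k unfolding filterlim_at_top by blast
  then have "eventually (\<lambda>N. jacobi_coeff (A N) (d N) (t N) (k N) 0 (nat (int (k N) + l)) = symbol_coeff e b 0 l) sequentially"
    by eventually_elim (auto simp: symbol_coeff_0)
  then show ?case by (rule tendsto_eventually)
next
  case (Suc i)
  have ev: "eventually (\<lambda>N. k N \<ge> Suc (nat \<bar>l\<bar> + 1)) sequentially"
    using k unfolding filterlim_at_top by blast
  let ?c = "\<lambda>N l. jacobi_coeff (A N) (d N) (t N) (k N) i (nat (int (k N) + l))"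
  have "(\<lambda>N. A N (nat (int (k N) + l)) * ?c N (l - 1) + d N (nat (int (k N) + l)) * ?c N l
      + t N * A N (nat (int (k N) + (l + 1))) * ?c N (l + 1)) \<longlonglongrightarrow>
      b * symbol_coeff e b i (l - 1) + e * symbol_coeff e b i l + 1 * b * symbol_coeff e b i (l + 1)"
    by (intro tendsto_intros A d t Suc.IH)
  then have L: "(\<lambda>N. A N (nat (int (k N) + l)) * ?c N (l - 1) + d N (nat (int (k N) + l)) * ?c N l
      + t N * A N (nat (int (k N) + (l + 1))) * ?c N (l + 1)) \<longlonglongrightarrow> symbol_coeff e b (Suc i) l"
    by (simp add: symbol_coeff_Suc)
  show ?case
  proof (rule Lim_transform_eventually[OF L])
    show "\<forall>\<^sub>F N in sequentially. A N (nat (int (k N) + l)) * ?c N (l - 1) + d N (nat (int (k N) + l)) * ?c N l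
      + t N * A N (nat (int (k N) + (l + 1))) * ?c N (l + 1) = jacobi_coeff (A N) (d N) (t N) (k N) (Suc i) (nat (int (k N) + l))"
      using ev
    proof eventually_elim
      case (elim N)
      have 1: "nat (int (k N) + l) - 1 = nat (int (k N) + (l - 1))" and 2: "Suc (nat (int (k N) + l)) = nat (int (k N) + (l + 1))"
        using elim by linarith+
      show ?case by (simp only: jacobi_coeff.simps 1 2)
    qed
  qed
qed

lemma jacobi_inner_tendsto:
  fixes A d :: "nat \<Rightarrow> nat \<Rightarrow> real" and k :: "nat \<Rightarrow> nat"
  assumes k: "filterlim k at_top sequentially"
    and A: "\<And>l. (\<lambda>N. A N (nat (int (k N) + l))) \<longlonglongrightarrow> b"
    and d: "\<And>l. (\<lambda>N. d N (nat (int (k N) + l))) \<longlonglongrightarrow> e"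
    and t: "t \<longlonglongrightarrow> 1"
  shows "(\<lambda>N. jacobi_inner (A N) (d N) (t N) (k N) i j) \<longlonglongrightarrow> symbol_coeff e b (i + j) 0"
proof -
  define M where "M = i + j + 1"
  have ev: "eventually (\<lambda>N. k N \<ge> Suc (M)) sequentially"
    using k unfolding filterlim_at_top by blast
  let ?c = "\<lambda>N i l. jacobi_coeff (A N) (d N) (t N) (k N) i (nat (int (k N) + l))"
  have "(\<lambda>N. \<Sum>l\<in>{-int M..int M}. ?c N i l * ?c N j l) \<longlonglongrightarrow> (\<Sum>l\<in>{-int M..int M}. symbol_coeff e b i l * symbol_coeff e b j l)"
    by (intro tendsto_sum tendsto_mult jacobi_coeff_tendsto assms)
  then have L: "(\<lambda>N. \<Sum>l\<in>{-int M..int M}. ?c N i l * ?c N j l) \<longlonglongrightarrow> symbol_coeff e b (i + j) 0"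
    by (subst (asm) symbol_coeff_parseval) (auto simp: M_def)
  show ?thesis
  proof (rule Lim_transform_eventually[OF L])
    show "\<forall>\<^sub>F N in sequentially. (\<Sum>l\<in>{-int M..int M}. ?c N i l * ?c N j l) = jacobi_inner (A N) (d N) (t N) (k N) i j"
      using ev
    proof eventually_elim
      case (elim N)
      have "jacobi_inner (A N) (d N) (t N) (k N) i j = (\<Sum>n\<in>{k N - M..k N + M}. jacobi_coeff (A N) (d N) (t N) (k N) i n * jacobi_coeff (A N) (d N) (t N) (k N) j n)"
        unfolding jacobi_inner_def using elim by (intro sum.mono_neutral_right) (auto intro!: jacobi_coeff_eq_0 simp: M_def)
      also have "\<dots> = (\<Sum>l\<in>{-int M..int M}. ?c N i l * ?c N j l)"
        by (rule sum.reindex_bij_witness[of _ "\<lambda>l. nat (int (k N) + l)" "\<lambda>n. int n - int (k N)"]) (use elim in auto)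
      finally show ?case ..
    qed
  qed
qed

text \<open>In the limit multiplication by \<open>z\<close> becomes symmetric, so all terms of the binomial expansion of
\<open>(z + cnj z)\<^sup>m\<close> have the same limit.\<close>

lemma jacobi_moment_tendsto:
  fixes A d :: "nat \<Rightarrow> nat \<Rightarrow> real" and k :: "nat \<Rightarrow> nat"
  assumes k: "filterlim k at_top sequentially"
    and A: "\<And>l. (\<lambda>N. A N (nat (int (k N) + l))) \<longlonglongrightarrow> b"
    and d: "\<And>l. (\<lambda>N. d N (nat (int (k N) + l))) \<longlonglongrightarrow> e"
    and t: "t \<longlonglongrightarrow> 1"
  shows "(\<lambda>N. jacobi_moment (A N) (d N) (t N) m (k N)) \<longlonglongrightarrow> symbol_coeff e b m 0"
proof -
  have "(\<lambda>N. jacobi_moment (A N) (d N) (t N) m (k N)) \<longlonglongrightarrow> (\<Sum>i\<le>m. real (m choose i) * symbol_coeff e b (i + (m - i)) 0) / 2 ^ m"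
    unfolding jacobi_moment_def by (intro tendsto_intros jacobi_inner_tendsto assms) auto
  also have "(\<Sum>i\<le>m. real (m choose i) * symbol_coeff e b (i + (m - i)) 0) = (\<Sum>i\<le>m. real (m choose i)) * symbol_coeff e b m 0"
    unfolding sum_distrib_right by (intro sum.cong) auto
  also have "(\<Sum>i\<le>m. real (m choose i)) = 2 ^ m"
    by (simp add: choose_row_sum flip: of_nat_sum)
  finally show ?thesis by simp
qed

lemma abs_jacobi_moment_le:
  assumes B: "\<And>n. n \<le> L \<Longrightarrow> \<bar>A n\<bar> + \<bar>d n\<bar> + \<bar>t\<bar> * \<bar>A (Suc n)\<bar> \<le> B" and B0: "B \<ge> 0"
    and L: "k + m \<le> L"
  shows "\<bar>jacobi_moment A d t m k\<bar> \<le> (2 * real m + 1) * B ^ m"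
proof -
  have "\<bar>\<Sum>i\<le>m. real (m choose i) * jacobi_inner A d t k i (m - i)\<bar> \<le> (\<Sum>i\<le>m. real (m choose i) * ((2 * real m + 1) * B ^ m))"
  proof (rule order_trans[OF sum_abs], rule sum_mono)
    fix i assume i: "i \<in> {..m}"
    have "\<bar>jacobi_inner A d t k i (m - i)\<bar> \<le> (2 * real i + 1) * B ^ (i + (m - i))"
      using i L by (intro abs_jacobi_inner_le[where L = L and A = A and d = d and t = t and B = B, OF B B0]) auto
    also have "\<dots> \<le> (2 * real m + 1) * B ^ m" using i B0 by (auto intro!: mult_right_mono)
    finally show "\<bar>real (m choose i) * jacobi_inner A d t k i (m - i)\<bar> \<le> real (m choose i) * ((2 * real m + 1) * B ^ m)"
      by (simp add: abs_mult mult_left_mono)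
  qed
  also have "\<dots> = (\<Sum>i\<le>m. real (m choose i)) * ((2 * real m + 1) * B ^ m)" by (simp add: sum_distrib_right)
  also have "(\<Sum>i\<le>m. real (m choose i)) = 2 ^ m"
    by (simp add: choose_row_sum flip: of_nat_sum)
  finally show ?thesis unfolding jacobi_moment_def by (simp add: abs_divide field_simps)
qed

lemma integral_uniform_Icc:
  fixes f :: "real \<Rightarrow> real"
  assumes ab: "a < b" and f[measurable]: "f \<in> borel_measurable borel"
  shows "(\<integral>t. f t \<partial>uniform_measure lborel {a..b}) = (\<integral>t. indicator {a..b} t * f t \<partial>lborel) / (b - a)"
proof -
  have "uniform_measure lborel {a..b} = density lborel (\<lambda>x. ennreal (indicator {a..b} x / (b - a)))"
    unfolding uniform_measure_def using ab divide_ennreal[of 1 "b - a"]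
    by (intro density_cong) (auto simp: indicator_def)
  then have "(\<integral>t. f t \<partial>uniform_measure lborel {a..b}) = (\<integral>t. indicator {a..b} t / (b - a) * f t \<partial>lborel)"
    using ab by (simp add: integral_real_density)
  then show ?thesis by simp
qed

lemma integral_mp_angle:
  "(\<integral>t. mp_map \<alpha> (x, t) ^ m \<partial>uniform_measure lborel {-pi..0}) = symbol_coeff (2 * x + \<alpha>) (sqrt (x * (x + \<alpha>))) m 0"
  unfolding mp_map_def by (simp, subst integral_uniform_Icc) (auto simp: symbol_coeff_def set_lebesgue_integral_def divide_inverse mult_ac)

lemma symbol_coeff_measurable [measurable]:
  "(\<lambda>x. symbol_coeff (2 * x + \<alpha>) (sqrt (x * (x + \<alpha>))) m 0) \<in> borel_measurable borel"
proof -
  interpret U2: prob_space "uniform_measure lborel {-pi..0::real}" by (rule prob_space_uniform_measure) auto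
  have "(\<lambda>x. \<integral>t. mp_map \<alpha> (x, t) ^ m \<partial>uniform_measure lborel {-pi..0}) \<in> borel_measurable borel" by measurable
  then show ?thesis unfolding integral_mp_angle .
qed

lemma mp_moment:
  assumes \<alpha>: "\<alpha> \<ge> 0"
  shows "integrable mp_sample (\<lambda>p. mp_map \<alpha> p ^ m)"
    and "(\<integral>p. mp_map \<alpha> p ^ m \<partial>mp_sample) = (\<integral>x. indicator {0<..<1} x * symbol_coeff (2 * x + \<alpha>) (sqrt (x * (x + \<alpha>))) m 0 \<partial>lborel)"
    and "\<bar>\<integral>p. mp_map \<alpha> p ^ m \<partial>mp_sample\<bar> \<le> (4 + 3 * \<alpha>) ^ m"
proof -
  let ?U1 = "uniform_measure lborel {0..1::real}" and ?U2 = "uniform_measure lborel {-pi..0::real}"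
  interpret U1: prob_space ?U1 by (rule prob_space_uniform_measure) auto
  interpret U2: prob_space ?U2 by (rule prob_space_uniform_measure) auto
  interpret P: pair_prob_space ?U1 ?U2 ..
  interpret S: prob_space mp_sample by (rule prob_space_mp_sample)
  have AE1: "AE p in mp_sample. fst p \<in> {0..1}"
  proof -
    have "AE x in ?U1. x \<in> {0..1}" by (rule AE_uniform_measureI) auto
    then have "AE x in ?U1. AE t in ?U2. fst (x, t) \<in> {0..1}" by eventually_elim simp
    moreover have "{p \<in> space (?U1 \<Otimes>\<^sub>M ?U2). fst p \<in> {0..1}} \<in> sets (?U1 \<Otimes>\<^sub>M ?U2)" by measurable
    ultimately show ?thesis unfolding mp_sample_def by (intro P.AE_pair_measure)
  qed
  have bound: "AE p in mp_sample. \<bar>mp_map \<alpha> p ^ m\<bar> \<le> (4 + 3 * \<alpha>) ^ m"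
    using AE1
  proof eventually_elim
    case (elim p)
    obtain x t where p: "p = (x, t)" by (cases p)
    have x: "0 \<le> x" "x \<le> 1" using elim p by auto
    have "x * (x + \<alpha>) \<le> 1 * (1 + \<alpha>)" using x \<alpha> by (intro mult_mono) auto
    also have "\<dots> \<le> (1 + \<alpha>)\<^sup>2" using \<alpha> by (simp add: power2_eq_square)
    finally have s: "sqrt (x * (x + \<alpha>)) \<le> 1 + \<alpha>" using \<alpha> by (intro real_le_lsqrt) auto
    have "\<bar>mp_map \<alpha> p\<bar> \<le> \<bar>2 * x\<bar> + \<bar>\<alpha>\<bar> + \<bar>2 * sqrt (x * (x + \<alpha>)) * cos t\<bar>"
      unfolding p mp_map_def by simp
    also have "\<bar>2 * sqrt (x * (x + \<alpha>)) * cos t\<bar> \<le> 2 * (1 + \<alpha>) * 1"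
      unfolding abs_mult using s x \<alpha> by (intro mult_mono) auto
    finally have "\<bar>mp_map \<alpha> p\<bar> \<le> 4 + 3 * \<alpha>" using x \<alpha> by simp
    then show ?case unfolding power_abs by (intro power_mono) auto
  qed
  have meas[measurable]: "(\<lambda>p. mp_map \<alpha> p ^ m) \<in> borel_measurable mp_sample" by measurable
  show int: "integrable mp_sample (\<lambda>p. mp_map \<alpha> p ^ m)"
    using bound by (intro S.integrable_const_bound[of _ "(4 + 3 * \<alpha>) ^ m"]) auto
  show "\<bar>\<integral>p. mp_map \<alpha> p ^ m \<partial>mp_sample\<bar> \<le> (4 + 3 * \<alpha>) ^ m"
  proof -
    have "\<bar>\<integral>p. mp_map \<alpha> p ^ m \<partial>mp_sample\<bar> \<le> (\<integral>p. \<bar>mp_map \<alpha> p ^ m\<bar> \<partial>mp_sample)" by (rule integral_abs_bound)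
    also have "\<dots> \<le> (\<integral>p. (4 + 3 * \<alpha>) ^ m \<partial>mp_sample)"
      using int bound by (intro integral_mono_AE) auto
    finally show ?thesis by (simp add: S.prob_space)
  qed
  note inner = integral_mp_angle[of \<alpha> _ m] and meas2 = symbol_coeff_measurable[of \<alpha> m]
  have "(\<integral>p. mp_map \<alpha> p ^ m \<partial>mp_sample) = (\<integral>x. symbol_coeff (2 * x + \<alpha>) (sqrt (x * (x + \<alpha>))) m 0 \<partial>?U1)"
    using P.integral_fst'[of "\<lambda>p. mp_map \<alpha> p ^ m"] int unfolding mp_sample_def inner by simp
  also have "\<dots> = (\<integral>x. indicator {0..1} x * symbol_coeff (2 * x + \<alpha>) (sqrt (x * (x + \<alpha>))) m 0 \<partial>lborel)"
    by (subst integral_uniform_Icc) (auto intro: meas2)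
  also have "\<dots> = (\<integral>x. indicator {0<..<1} x * symbol_coeff (2 * x + \<alpha>) (sqrt (x * (x + \<alpha>))) m 0 \<partial>lborel)"
  proof (rule integral_cong_AE)
    have "AE x in lborel. x \<noteq> (0::real)" "AE x in lborel. x \<noteq> (1::real)" by (auto intro: AE_lborel_singleton)
    then show "AE x in lborel. indicator {0..1} x * symbol_coeff (2 * x + \<alpha>) (sqrt (x * (x + \<alpha>))) m 0 =
        indicator {0<..<1} x * symbol_coeff (2 * x + \<alpha>) (sqrt (x * (x + \<alpha>))) m 0"
      by eventually_elim (auto simp: indicator_def)
  qed (use meas2 in measurable)
  finally show "(\<integral>p. mp_map \<alpha> p ^ m \<partial>mp_sample) = (\<integral>x. indicator {0<..<1} x * symbol_coeff (2 * x + \<alpha>) (sqrt (x * (x + \<alpha>))) m 0 \<partial>lborel)" .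
qed

section \<open>Orthonormal polynomials of the Bessel weight\<close>

context wishart_weight
begin

definition cpoly :: "nat \<Rightarrow> complex poly" where "cpoly k = map_poly complex_of_real (laguerre k)"

definition sq_norm :: "nat \<Rightarrow> real" where "sq_norm k = fact k * (1 / \<kappa>) ^ k * gamma_moment k"

lemma gamma_moment_pos: "gamma_moment n > 0"
  unfolding gamma_moment_def using \<nu> \<kappa>_pos by (auto intro!: mult_pos_pos pochhammer_pos)

lemma sq_norm_pos: "sq_norm k > 0"
  unfolding sq_norm_def using gamma_moment_pos \<kappa>_pos by simp

lemma coeff_cpoly: "coeff (cpoly k) i = of_real (coeff (laguerre k) i)"
  by (simp add: cpoly_def coeff_map_poly)

lemma degree_cpoly: "degree (cpoly k) = k"
  using laguerre_monic[of k] by (simp add: cpoly_def degree_map_poly)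

lemma cpoly_monic: "coeff (cpoly k) k = 1"
  using laguerre_monic[of k] by (simp add: coeff_cpoly)

lemma poly_cpoly: "poly (cpoly k) z = (\<Sum>i\<le>k. of_real (coeff (laguerre k) i) * z ^ i)"
  by (simp add: poly_altdef degree_cpoly coeff_cpoly)

lemma cpoly_Suc:
  "z * poly (cpoly k) z = poly (cpoly (Suc k)) z + of_real (\<tau> * (1 / \<kappa>) * (2 * real k + \<nu> + 1)) * poly (cpoly k) z
     + of_real (\<tau>\<^sup>2 * (1 / \<kappa>)\<^sup>2 * real k * (real k + \<nu>)) * poly (cpoly (k - 1)) z"
proof -
  have "cpoly (Suc k) = pCons 0 (cpoly k) - Polynomial.smult (of_real (\<tau> * (1 / \<kappa>) * (2 * real k + \<nu> + 1))) (cpoly k)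
      - Polynomial.smult (of_real (\<tau>\<^sup>2 * (1 / \<kappa>)\<^sup>2 * real k * (real k + \<nu>))) (cpoly (k - 1))"
    by (rule poly_eqI) (simp only: coeff_cpoly laguerre_Suc coeff_diff coeff_smult coeff_pCons of_real_diff of_real_mult split: nat.splits, auto)
  then show ?thesis by simp
qed

lemma integrable_law_polys: "integrable law (\<lambda>z. poly p z * cnj (poly q z))"
proof -
  have "(\<lambda>z. poly p z * cnj (poly q z)) = (\<lambda>z. \<Sum>i\<le>degree p. \<Sum>j\<le>degree q. coeff p i * cnj (coeff q j) * (z ^ i * cnj z ^ j))"
    by (simp add: poly_altdef sum_product fun_eq_iff mult_ac)
  then show ?thesis
    by (simp only:) (intro Bochner_Integration.integrable_sum integrable_mult_right law_moments)
qed

lemma law_cpoly_monom: "(\<integral>z. poly (cpoly k) z * cnj z ^ j \<partial>law) = of_real (pairing (laguerre k) j)"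
proof -
  have "(\<integral>z. poly (cpoly k) z * cnj z ^ j \<partial>law) = (\<integral>z. (\<Sum>i\<le>k. of_real (coeff (laguerre k) i) * (z ^ i * cnj z ^ j)) \<partial>law)"
    by (simp add: poly_cpoly sum_distrib_right mult.assoc)
  also have "\<dots> = (\<Sum>i\<le>k. of_real (coeff (laguerre k) i) * of_real (mixed_moment i j))"
    by (subst Bochner_Integration.integral_sum) (auto intro!: law_moments integrable_mult_right simp: law_moments)
  also have "\<dots> = of_real (pairing (laguerre k) j)"
    using laguerre_monic[of k] by (simp add: pairing_def)
  finally show ?thesis .
qed

lemma pairing_lt: assumes "j < k" shows "pairing (laguerre k) j = 0"
  using pairing_laguerre[of k j] tau01 assms by (simp add: binomial_eq_0)

lemma pairing_diag: "pairing (laguerre k) k = sq_norm k"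
  using pairing_laguerre[of k k] tau01 by (simp add: sq_norm_def)

text \<open>Since \<open>cpoly k\<close> pairs to 0 with all powers of \<open>cnj z\<close> below \<open>k\<close>, at most the leading coefficient of \<open>cpoly l\<close>
contributes.\<close>

lemma law_orth_le:
  assumes "l \<le> k"
  shows "(\<integral>z. poly (cpoly k) z * cnj (poly (cpoly l) z) \<partial>law) = (if k = l then of_real (sq_norm k) else 0)"
proof -
  have I: "integrable law (\<lambda>z. poly (cpoly k) z * cnj z ^ j)" for j
    using integrable_law_polys[of "cpoly k" "monom 1 j"] by (simp add: poly_monom)
  have "(\<integral>z. poly (cpoly k) z * cnj (poly (cpoly l) z) \<partial>law) =
     (\<integral>z. (\<Sum>j\<le>l. of_real (coeff (laguerre l) j) * (poly (cpoly k) z * cnj z ^ j)) \<partial>law)"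
    by (simp add: poly_cpoly[of l] sum_distrib_left mult_ac)
  also have "\<dots> = (\<Sum>j\<le>l. of_real (coeff (laguerre l) j) * of_real (pairing (laguerre k) j))"
    by (subst Bochner_Integration.integral_sum) (auto intro!: I integrable_mult_right simp: law_cpoly_monom)
  also have "\<dots> = (\<Sum>j\<in>(if k = l then {k} else {}). of_real (coeff (laguerre l) j) * of_real (pairing (laguerre k) j))"
    using assms by (intro sum.mono_neutral_right) (auto simp: pairing_lt)
  also have "\<dots> = (if k = l then of_real (sq_norm k) else 0)"
    using laguerre_monic[of l] by (simp add: pairing_diag)
  finally show ?thesis .
qed

lemma law_orth: "(\<integral>z. poly (cpoly k) z * cnj (poly (cpoly l) z) \<partial>law) = (if k = l then of_real (sq_norm k) else 0)"
proof (cases "l \<le> k")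
  case False
  have "(\<integral>z. poly (cpoly k) z * cnj (poly (cpoly l) z) \<partial>law) = (\<integral>z. cnj (poly (cpoly l) z * cnj (poly (cpoly k) z)) \<partial>law)"
    by (simp add: mult.commute)
  also have "\<dots> = cnj (\<integral>z. poly (cpoly l) z * cnj (poly (cpoly k) z) \<partial>law)" by (rule Bochner_Integration.integral_cnj)
  also have "\<dots> = 0" using False by (subst law_orth_le) auto
  finally show ?thesis using False by auto
qed (rule law_orth_le)

definition orthonormal :: "nat \<Rightarrow> complex \<Rightarrow> complex" where "orthonormal k z = poly (cpoly k) z / of_real (sqrt (sq_norm k))"

definition off_diag :: "nat \<Rightarrow> real" where "off_diag n = sqrt (real n * (real n + \<nu>)) / \<kappa>"
definition diag :: "nat \<Rightarrow> real" where "diag n = \<tau> * (2 * real n + \<nu> + 1) / \<kappa>"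

lemma integrable_orthonormal: "integrable law (\<lambda>z. orthonormal k z * cnj (orthonormal l z))"
  using integrable_divide[OF integrable_law_polys[of "cpoly k" "cpoly l"], of "of_real (sqrt (sq_norm k)) * of_real (sqrt (sq_norm l))"]
  by (simp add: orthonormal_def)

lemma orthonormal_orth: "(\<integral>z. orthonormal k z * cnj (orthonormal l z) \<partial>law) = (if k = l then 1 else 0)"
proof -
  have "(\<integral>z. orthonormal k z * cnj (orthonormal l z) \<partial>law) = (\<integral>z. poly (cpoly k) z * cnj (poly (cpoly l) z) / (of_real (sqrt (sq_norm k)) * of_real (sqrt (sq_norm l))) \<partial>law)"
    by (simp add: orthonormal_def)
  also have "\<dots> = (if k = l then 1 else 0)"
    using sq_norm_pos[of k] unfolding integral_divide_zero law_orth by (auto simp flip: of_real_mult)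
  finally show ?thesis .
qed

lemma sqrt_sq_norm_Suc: "sqrt (sq_norm (Suc k)) = off_diag (Suc k) * sqrt (sq_norm k)"
proof -
  have "sq_norm (Suc k) = (real (Suc k) * (real (Suc k) + \<nu>) / \<kappa>\<^sup>2) * sq_norm k"
    using \<kappa>_pos by (simp add: sq_norm_def gamma_moment_Suc field_simps power2_eq_square)
  then show ?thesis using \<kappa>_pos by (simp add: off_diag_def real_sqrt_mult real_sqrt_divide)
qed

lemma off_diag_0: "off_diag 0 = 0" by (simp add: off_diag_def)

lemma off_diag_pos: "off_diag (Suc k) > 0"
  using \<kappa>_pos \<nu> by (simp add: off_diag_def)

text \<open>The recurrence of the monic polynomials, rescaled.  The matrix of multiplication by \<open>z\<close> fails to be symmetric
exactly by the factor \<open>\<tau>\<^sup>2\<close>.\<close>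

lemma orthonormal_recurrence:
  "z * orthonormal k z = of_real (off_diag (Suc k)) * orthonormal (Suc k) z + of_real (diag k) * orthonormal k z + of_real (\<tau>\<^sup>2 * off_diag k) * orthonormal (k - 1) z"
proof -
  define h where "h j = complex_of_real (sqrt (sq_norm j))" for j
  have h: "h j \<noteq> 0" for j using sq_norm_pos[of j] by (simp add: h_def)
  have hS: "h (Suc j) = of_real (off_diag (Suc j)) * h j" for j by (simp add: h_def sqrt_sq_norm_Suc)
  have A: "of_real (off_diag (Suc j)) \<noteq> (0::complex)" for j using off_diag_pos[of j] by simp
  have last: "of_real (\<tau>\<^sup>2 * (1 / \<kappa>)\<^sup>2 * real k * (real k + \<nu>)) * poly (cpoly (k - 1)) z / h k = of_real (\<tau>\<^sup>2 * off_diag k) * orthonormal (k - 1) z"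
  proof (cases k)
    case 0
    then show ?thesis by (simp add: off_diag_0)
  next
    case (Suc j)
    have "real k * (real k + \<nu>) \<ge> 0" using \<nu> Suc by simp
    then have sq: "(off_diag k)\<^sup>2 = (1 / \<kappa>)\<^sup>2 * real k * (real k + \<nu>)"
      by (simp add: off_diag_def power_divide)
    have "\<tau>\<^sup>2 * (1 / \<kappa>)\<^sup>2 * real k * (real k + \<nu>) = \<tau>\<^sup>2 * ((1 / \<kappa>)\<^sup>2 * real k * (real k + \<nu>))"
      by (simp only: mult.assoc)
    also have "\<dots> = \<tau>\<^sup>2 * off_diag k * off_diag k" unfolding sq[symmetric] by (simp only: power2_eq_square mult.assoc)
    finally have E: "\<tau>\<^sup>2 * (1 / \<kappa>)\<^sup>2 * real k * (real k + \<nu>) = \<tau>\<^sup>2 * off_diag k * off_diag k" .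
    have "of_real (\<tau>\<^sup>2 * (1 / \<kappa>)\<^sup>2 * real k * (real k + \<nu>)) * poly (cpoly (k - 1)) z / h k =
       of_real (\<tau>\<^sup>2 * off_diag k) * (of_real (off_diag (Suc j)) * poly (cpoly j) z / (of_real (off_diag (Suc j)) * h j))"
      unfolding E using Suc by (simp add: hS)
    also have "of_real (off_diag (Suc j)) * poly (cpoly j) z / (of_real (off_diag (Suc j)) * h j) = orthonormal j z"
      using A[of j] by (simp add: orthonormal_def h_def)
    finally show ?thesis using Suc by simp
  qed
  have "z * orthonormal k z = (z * poly (cpoly k) z) / h k" by (simp add: orthonormal_def h_def)
  also have "\<dots> = poly (cpoly (Suc k)) z / h k + of_real (\<tau> * (1 / \<kappa>) * (2 * real k + \<nu> + 1)) * (poly (cpoly k) z / h k)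
      + of_real (\<tau>\<^sup>2 * (1 / \<kappa>)\<^sup>2 * real k * (real k + \<nu>)) * poly (cpoly (k - 1)) z / h k"
    unfolding cpoly_Suc by (simp add: add_divide_distrib)
  also have "poly (cpoly (Suc k)) z / h k = of_real (off_diag (Suc k)) * orthonormal (Suc k) z"
    using A[of k] by (simp add: orthonormal_def h_def[symmetric] hS)
  also have "\<tau> * (1 / \<kappa>) * (2 * real k + \<nu> + 1) = diag k" by (simp add: diag_def)
  also have "poly (cpoly k) z / h k = orthonormal k z" by (simp add: orthonormal_def h_def)
  finally show ?thesis unfolding last .
qed

abbreviation "J \<equiv> jacobi_coeff off_diag diag (\<tau>\<^sup>2)"

text \<open>Any \<open>K \<ge> k + i\<close> is allowed as the upper limit, so that two expansions can be brought to a common range.\<close>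

lemma power_orthonormal:
  assumes "k + i \<le> K"
  shows "z ^ i * orthonormal k z = (\<Sum>n\<le>K. of_real (J k i n) * orthonormal n z)"
  using assms
proof (induction i arbitrary: K)
  case 0
  have "(\<Sum>n\<le>K. of_real (J k 0 n) * orthonormal n z) = (\<Sum>n\<le>K. if n = k then orthonormal n z else 0)" by (intro sum.cong) auto
  then show ?case using 0 by simp
next
  case (Suc i)
  let ?c = "\<lambda>n. complex_of_real (J k i n)"
  have zero: "J k i K = 0" "J k i (Suc K) = 0" using Suc.prems by (auto intro!: jacobi_coeff_eq_0)
  have "z ^ Suc i * orthonormal k z = (\<Sum>n\<le>K. ?c n * (z * orthonormal n z))"
    using Suc.IH[of K] Suc.prems by (simp add: sum_distrib_left mult_ac)
  also have "\<dots> = (\<Sum>n\<le>K. ?c n * of_real (off_diag (Suc n)) * orthonormal (Suc n) z) + (\<Sum>n\<le>K. ?c n * of_real (diag n) * orthonormal n z)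
      + (\<Sum>n\<le>K. ?c n * of_real (\<tau>\<^sup>2 * off_diag n) * orthonormal (n - 1) z)"
    unfolding orthonormal_recurrence sum.distrib[symmetric] by (intro sum.cong refl) (simp only: distrib_left mult.assoc)
  also have "(\<Sum>n\<le>K. ?c n * of_real (off_diag (Suc n)) * orthonormal (Suc n) z) = (\<Sum>n\<le>K. of_real (off_diag n * J k i (n - 1)) * orthonormal n z)"
  proof -
    have "(\<Sum>n\<le>K. of_real (off_diag n * J k i (n - 1)) * orthonormal n z) = (\<Sum>n\<le>Suc K. of_real (off_diag n * J k i (n - 1)) * orthonormal n z)"
      using zero by simp
    also have "\<dots> = (\<Sum>n\<le>K. ?c n * of_real (off_diag (Suc n)) * orthonormal (Suc n) z)"
      by (subst sum.atMost_Suc_shift) (simp add: off_diag_0 mult_ac)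
    finally show ?thesis ..
  qed
  also have "(\<Sum>n\<le>K. ?c n * of_real (\<tau>\<^sup>2 * off_diag n) * orthonormal (n - 1) z) = (\<Sum>n\<le>K. of_real (\<tau>\<^sup>2 * off_diag (Suc n) * J k i (Suc n)) * orthonormal n z)"
  proof -
    have "(\<Sum>n\<le>K. ?c n * of_real (\<tau>\<^sup>2 * off_diag n) * orthonormal (n - 1) z) = (\<Sum>n\<le>Suc K. ?c n * of_real (\<tau>\<^sup>2 * off_diag n) * orthonormal (n - 1) z)"
      using zero by simp
    also have "\<dots> = (\<Sum>n\<le>K. of_real (\<tau>\<^sup>2 * off_diag (Suc n) * J k i (Suc n)) * orthonormal n z)"
      by (subst sum.atMost_Suc_shift) (simp add: off_diag_0 mult_ac)
    finally show ?thesis .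
  qed
  also have "(\<Sum>n\<le>K. of_real (off_diag n * J k i (n - 1)) * orthonormal n z) + (\<Sum>n\<le>K. ?c n * of_real (diag n) * orthonormal n z)
      + (\<Sum>n\<le>K. of_real (\<tau>\<^sup>2 * off_diag (Suc n) * J k i (Suc n)) * orthonormal n z) = (\<Sum>n\<le>K. of_real (J k (Suc i) n) * orthonormal n z)"
    unfolding sum.distrib[symmetric] by (intro sum.cong refl) (simp only: jacobi_coeff.simps of_real_add of_real_mult distrib_right distrib_left mult_ac)
  finally show ?case .
qed

lemma orthonormal_power_inner:
  "integrable law (\<lambda>z. z ^ i * orthonormal k z * cnj (z ^ j * orthonormal k z))"
  "(\<integral>z. z ^ i * orthonormal k z * cnj (z ^ j * orthonormal k z) \<partial>law) = of_real (jacobi_inner off_diag diag (\<tau>\<^sup>2) k i j)"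
proof -
  let ?K = "k + i + j + 1"
  have e: "z ^ i * orthonormal k z * cnj (z ^ j * orthonormal k z) = (\<Sum>n\<le>?K. \<Sum>n'\<le>?K. of_real (J k i n * J k j n') * (orthonormal n z * cnj (orthonormal n' z)))" for z
  proof -
    have 1: "z ^ i * orthonormal k z = (\<Sum>n\<le>?K. of_real (J k i n) * orthonormal n z)" and 2: "z ^ j * orthonormal k z = (\<Sum>n\<le>?K. of_real (J k j n) * orthonormal n z)"
      by (rule power_orthonormal; simp)+
    show ?thesis
      unfolding 1 2 cnj_sum complex_cnj_mult complex_cnj_complex_of_real sum_product
      by (intro sum.cong refl) (simp only: of_real_mult mult_ac)
  qed
  show "integrable law (\<lambda>z. z ^ i * orthonormal k z * cnj (z ^ j * orthonormal k z))"
    unfolding e by (intro Bochner_Integration.integrable_sum integrable_mult_right integrable_orthonormal)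
  have "(\<integral>z. z ^ i * orthonormal k z * cnj (z ^ j * orthonormal k z) \<partial>law) = (\<Sum>n\<le>?K. \<Sum>n'\<le>?K. of_real (J k i n * J k j n') * (\<integral>z. orthonormal n z * cnj (orthonormal n' z) \<partial>law))"
    unfolding e
    by (subst Bochner_Integration.integral_sum, (intro Bochner_Integration.integrable_sum integrable_mult_right integrable_orthonormal),
        intro sum.cong refl, subst Bochner_Integration.integral_sum, (intro integrable_mult_right integrable_orthonormal), simp)
  also have "\<dots> = (\<Sum>n\<le>?K. \<Sum>n'\<le>?K. if n' = n then of_real (J k i n * J k j n) else 0)"
    by (intro sum.cong refl) (auto simp: orthonormal_orth)
  also have "\<dots> = of_real (jacobi_inner off_diag diag (\<tau>\<^sup>2) k i j)"
    by (simp add: jacobi_inner_def)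
  finally show "(\<integral>z. z ^ i * orthonormal k z * cnj (z ^ j * orthonormal k z) \<partial>law) = of_real (jacobi_inner off_diag diag (\<tau>\<^sup>2) k i j)" .
qed

lemma Re_moment:
  "integrable law (\<lambda>z. Re z ^ n * (cmod (orthonormal k z))\<^sup>2)"
  "(\<integral>z. Re z ^ n * (cmod (orthonormal k z))\<^sup>2 \<partial>law) = jacobi_moment off_diag diag (\<tau>\<^sup>2) n k"
proof -
  have e: "complex_of_real (Re z ^ n * (cmod (orthonormal k z))\<^sup>2) =
     (\<Sum>i\<le>n. of_nat (n choose i) * (z ^ i * orthonormal k z * cnj (z ^ (n - i) * orthonormal k z))) / 2 ^ n" for z
  proof -
    have "complex_of_real (Re z) = (z + cnj z) / 2" by (simp add: complex_add_cnj)
    then have "complex_of_real (Re z ^ n * (cmod (orthonormal k z))\<^sup>2) = (z + cnj z) ^ n / 2 ^ n * (orthonormal k z * cnj (orthonormal k z))"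
      by (simp only: of_real_mult of_real_power[of "Re z"] complex_norm_square power_divide)
    also have "\<dots> = (\<Sum>i\<le>n. of_nat (n choose i) * (z ^ i * orthonormal k z * cnj (z ^ (n - i) * orthonormal k z))) / 2 ^ n"
      unfolding binomial_ring sum_divide_distrib sum_distrib_right
      by (intro sum.cong refl) (simp add: mult_ac)
    finally show ?thesis .
  qed
  have I: "integrable law (\<lambda>z. complex_of_real (Re z ^ n * (cmod (orthonormal k z))\<^sup>2))"
    unfolding e by (intro integrable_divide Bochner_Integration.integrable_sum integrable_mult_right orthonormal_power_inner)
  then show "integrable law (\<lambda>z. Re z ^ n * (cmod (orthonormal k z))\<^sup>2)" unfolding complex_of_real_integrable_eq .
  have "complex_of_real (\<integral>z. Re z ^ n * (cmod (orthonormal k z))\<^sup>2 \<partial>law) = (\<integral>z. complex_of_real (Re z ^ n * (cmod (orthonormal k z))\<^sup>2) \<partial>law)"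
    by (rule integral_complex_of_real[symmetric])
  also have "\<dots> = (\<Sum>i\<le>n. of_nat (n choose i) * of_real (jacobi_inner off_diag diag (\<tau>\<^sup>2) k i (n - i))) / 2 ^ n"
    unfolding e integral_divide_zero
    by (subst Bochner_Integration.integral_sum, (intro integrable_mult_right orthonormal_power_inner), simp add: orthonormal_power_inner(2) del: complex_cnj_mult complex_cnj_power)
  also have "\<dots> = of_real (jacobi_moment off_diag diag (\<tau>\<^sup>2) n k)" by (simp add: jacobi_moment_def)
  finally show "(\<integral>z. Re z ^ n * (cmod (orthonormal k z))\<^sup>2 \<partial>law) = jacobi_moment off_diag diag (\<tau>\<^sup>2) n k"
    by (simp only: of_real_eq_iff)
qed

end

section \<open>Convergence of moments\<close>

text \<open>Characteristic functions are compared through their Taylor polynomials of degree \<open>l\<close>.  The error is at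
most \<open>2 |t|\<^sup>l / l!\<close> times the absolute moment of order \<open>l\<close>, and the geometric bound on the moments of the
limit makes it small for large \<open>l\<close>, uniformly along the sequence.\<close>

lemma weak_conv_m_of_moments:
  fixes M :: "nat \<Rightarrow> real measure" and M' :: "real measure"
  assumes M: "\<And>n. real_distribution (M n)" and M': "real_distribution M'"
    and int: "\<And>n k. integrable (M n) (\<lambda>x. x ^ k)" and int': "\<And>k. integrable M' (\<lambda>x. x ^ k)"
    and conv: "\<And>k. (\<lambda>n. \<integral>x. x ^ k \<partial>M n) \<longlonglongrightarrow> (\<integral>x. x ^ k \<partial>M')"
    and bound: "\<And>k. \<bar>\<integral>x. x ^ k \<partial>M'\<bar> \<le> C ^ k"
  shows "weak_conv_m M M'"
proof (rule levy_continuity[OF M M'])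
  fix t :: real
  let ?m = "\<lambda>k. \<integral>x. x ^ k \<partial>M'" and ?mn = "\<lambda>n k. \<integral>x. x ^ k \<partial>M n"
  let ?T = "\<lambda>l m. \<Sum>k\<le>l. (\<i> * complex_of_real t) ^ k / fact k * complex_of_real (m k)"
  show "(\<lambda>n. char (M n) t) \<longlonglongrightarrow> char M' t"
  proof (rule LIMSEQ_I)
    fix e :: real assume e: "e > 0"
    define r where "r l = 2 * \<bar>t\<bar> ^ l / fact l * (2 * C ^ l + 1)" for l :: nat
    have z: "(\<lambda>l. x ^ l / fact l) \<longlonglongrightarrow> 0" for x :: real
      using summable_LIMSEQ_zero[OF summable_exp[of x]] by (simp add: divide_inverse mult.commute)
    have "(\<lambda>l. 4 * ((\<bar>t\<bar> * C) ^ l / fact l) + 2 * (\<bar>t\<bar> ^ l / fact l)) \<longlonglongrightarrow> 4 * 0 + 2 * 0"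
      by (intro tendsto_intros z)
    moreover have "r = (\<lambda>l. 4 * ((\<bar>t\<bar> * C) ^ l / fact l) + 2 * (\<bar>t\<bar> ^ l / fact l))"
    proof
      fix l
      have alg: "2 * u / f * (2 * v + 1) = 4 * (u * v / f) + 2 * (u / f)" for u v f :: real
        by (cases "f = 0") (simp_all add: field_simps)
      show "r l = 4 * ((\<bar>t\<bar> * C) ^ l / fact l) + 2 * (\<bar>t\<bar> ^ l / fact l)"
        unfolding r_def power_mult_distrib by (rule alg)
    qed
    ultimately have "r \<longlonglongrightarrow> 0" by simp
    then obtain l0 where l0: "\<And>l. l \<ge> l0 \<Longrightarrow> \<bar>r l\<bar> < e / 2"
      using e LIMSEQ_D[of r 0 "e / 2"] by auto
    \<comment> \<open>For even \<open>l\<close> the absolute moment of order \<open>l\<close> is the moment itself.\<close>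
    define l where "l = 2 * l0"
    have rl: "r l < e / 2" using l0[of l] by (simp add: l_def)
    have ev: "even l" by (simp add: l_def)
    have "(\<lambda>n. ?T l (?mn n)) \<longlonglongrightarrow> ?T l ?m"
      by (intro tendsto_intros conv)
    then obtain n1 where n1: "\<And>n. n \<ge> n1 \<Longrightarrow> norm (?T l (?mn n) - ?T l ?m) < e / 2"
      using LIMSEQ_D[of "\<lambda>n. ?T l (?mn n)" "?T l ?m" "e / 2"] e by auto
    obtain n2 where n2: "\<And>n. n \<ge> n2 \<Longrightarrow> norm (?mn n l - ?m l) < 1"
      using LIMSEQ_D[OF conv[of l], of 1] by auto
    have "norm (char (M n) t - char M' t) < e" if n: "n \<ge> max n1 n2" for n
    proof -
      have ab: "\<bar>x\<bar> ^ l = x ^ l" for x :: real using ev by (simp add: power_even_abs)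
      have 1: "cmod (char (M n) t - ?T l (?mn n)) \<le> 2 * \<bar>t\<bar> ^ l / fact l * ?mn n l"
        using real_distribution.char_approx1[of "M n" l t, OF M int] by (simp only: ab)
      have 2: "cmod (char M' t - ?T l ?m) \<le> 2 * \<bar>t\<bar> ^ l / fact l * ?m l"
        using real_distribution.char_approx1[of M' l t, OF M' int'] by (simp only: ab)
      have "?mn n l + ?m l \<le> 2 * C ^ l + 1"
      proof -
        have "\<bar>?mn n l - ?m l\<bar> < 1" using n2[of n] n by simp
        then show ?thesis using bound[of l] by linarith
      qed
      then have "2 * \<bar>t\<bar> ^ l / fact l * (?mn n l + ?m l) \<le> r l"
        unfolding r_def by (intro mult_left_mono) auto
      then have 3: "2 * \<bar>t\<bar> ^ l / fact l * ?mn n l + 2 * \<bar>t\<bar> ^ l / fact l * ?m l \<le> r l"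
        by (simp only: distrib_left)
      have "cmod (x - v) \<le> cmod (x - y) + cmod (y - z) + cmod (v - z)" for x y z v :: complex
        by norm
      from this[of "char (M n) t" "char M' t" "?T l (?mn n)" "?T l ?m"]
      show ?thesis using 1 2 3 rl n1[of n] n by linarith
    qed
    then show "\<exists>no. \<forall>n\<ge>no. norm (char (M n) t - char M' t) < e" by blast
  qed
qed

section \<open>The ensemble for a fixed number of particles\<close>

text \<open>The condition \<open>N > c\<^sup>2\<close> is equivalent to \<open>\<tau> > 0\<close>.\<close>

locale wishart_ensemble =
  fixes N :: nat and c \<nu> :: real
  assumes c: "c > 0" and N: "real N > c\<^sup>2" and \<nu>: "\<nu> > -1"
begin

definition a :: real where "a = (real N)\<^sup>2 / c\<^sup>2"
definition \<tau> :: real where "\<tau> = 1 - c\<^sup>2 / real N"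

lemma N0: "N > 0" using N by (cases N) auto

sublocale ww: wishart_weight a \<tau> \<nu>
proof
  show "a > 0" using c N0 by (simp add: a_def)
  show "0 < \<tau>" "\<tau> < 1" using c N N0 by (simp_all add: \<tau>_def field_simps)
qed (rule \<nu>)

lemma kappa_eq: "ww.\<kappa> = real N - c\<^sup>2 / 2"
proof -
  have "ww.\<kappa> = a / 2 * (1 - \<tau>\<^sup>2)" by (rule ww.\<kappa>_def)
  also have "\<dots> = (real N)\<^sup>2 / c\<^sup>2 / 2 * ((c\<^sup>2 / real N) * (2 - c\<^sup>2 / real N))"
    by (simp add: a_def \<tau>_def power2_eq_square algebra_simps)
  also have "\<dots> = real N - c\<^sup>2 / 2"
    using c N0 by (simp add: field_simps power2_eq_square)
  finally show ?thesis .
qed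

abbreviation "Q \<equiv> wishart_potential c \<nu> N"
definition w :: "complex \<Rightarrow> real" where "w z = exp (- real N * Q z)"

lemma Q_measurable [measurable]: "Q \<in> borel_measurable borel"
  unfolding wishart_potential_def by measurable

lemma w_measurable [measurable]: "w \<in> borel_measurable borel"
  unfolding w_def by measurable

lemma w_eq:
  assumes z: "z \<noteq> 0"
  shows "w z = bessel_K \<nu> (a * cmod z) * cmod z powr \<nu> * exp (a * \<tau> * Re z)"
proof -
  have arg: "(real N)\<^sup>2 * cmod z / c\<^sup>2 = a * cmod z" by (simp add: a_def)
  have pos: "bessel_K \<nu> (a * cmod z) * cmod z powr \<nu> > 0"
    using bessel_K_pos[of "a * cmod z" \<nu>] z ww.a by simp
  have b: "real N * (real N / c\<^sup>2 - 1) = a * \<tau>"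
    using N0 c by (simp add: a_def \<tau>_def field_simps power2_eq_square)
  have "- real N * Q z = ln (bessel_K \<nu> (a * cmod z) * cmod z powr \<nu>) + a * \<tau> * Re z"
    unfolding wishart_potential_def arg b[symmetric] using N0 by (simp add: algebra_simps)
  then show ?thesis using pos by (simp add: w_def exp_add)
qed

text \<open>The weight may be singular at the origin.\<close>

lemma w_continuous:
  assumes z: "z \<noteq> 0"
  shows "isCont w z"
proof -
  have "continuous_on (UNIV - {0}) w"
  proof (rule continuous_on_eq)
    show "continuous_on (UNIV - {0}) (\<lambda>z. bessel_K \<nu> (a * cmod z) * cmod z powr \<nu> * exp (a * \<tau> * Re z))"
      using ww.a
      by (intro continuous_intros continuous_on_compose2[OF continuous_on_bessel_K]) (auto simp: zero_less_mult_iff)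
  qed (simp add: w_eq)
  then show ?thesis using z by (simp add: continuous_on_eq_continuous_at open_delete)
qed

lemma law_density: "ww.law = density dA (\<lambda>z. ennreal (w z / ww.weight_const))"
  by (rule ww.law_eq_density[OF w_eq _ w_measurable]) (simp_all add: w_def)

lemma integrable_law_iff:
  fixes f :: "complex \<Rightarrow> 'b::{banach, second_countable_topology}"
  shows "f \<in> borel_measurable borel \<Longrightarrow> integrable ww.law f \<longleftrightarrow> integrable dA (\<lambda>z. (w z / ww.weight_const) *\<^sub>R f z)"
  unfolding law_density using ww.weight_const_pos by (intro integrable_density) (auto simp: w_def)

lemma integral_law_eq:
  fixes f :: "complex \<Rightarrow> 'b::{banach, second_countable_topology}"
  shows "f \<in> borel_measurable borel \<Longrightarrow> integral\<^sup>L ww.law f = integral\<^sup>L dA (\<lambda>z. (w z / ww.weight_const) *\<^sub>R f z)"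
  unfolding law_density using ww.weight_const_pos by (intro integral_density) (auto simp: w_def)

lemma poly_measurable [measurable]: "(\<lambda>z. poly p z) \<in> borel_measurable (borel :: complex measure)"
  by (intro borel_measurable_continuous_onI continuous_intros)

sublocale dp: orthogonal_polys N w ww.cpoly "\<lambda>k. ww.weight_const * ww.sq_norm k"
proof
  show "N > 0" by (rule N0)
  show "w \<in> borel_measurable borel" by (rule w_measurable)
  show "w z \<ge> 0" for z by (simp add: w_def)
  show "degree (ww.cpoly k) = k" "coeff (ww.cpoly k) k = 1" for k by (rule ww.degree_cpoly ww.cpoly_monic)+
  show "ww.weight_const * ww.sq_norm k > 0" for k using ww.weight_const_pos ww.sq_norm_pos by simp
  fix j k
  let ?f = "\<lambda>z. poly (ww.cpoly j) z * cnj (poly (ww.cpoly k) z)"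
  have m: "?f \<in> borel_measurable borel" by measurable
  have e: "?f z * of_real (w z) = of_real ww.weight_const * ((w z / ww.weight_const) *\<^sub>R ?f z)" for z
    using ww.weight_const_pos by (simp add: scaleR_conv_of_real)
  show "integrable dA (\<lambda>z. ?f z * of_real (w z))"
    unfolding e using ww.integrable_law_polys[of "ww.cpoly j" "ww.cpoly k"] integrable_law_iff[OF m]
    by (intro integrable_mult_right) simp
  show "(\<integral>z. ?f z * of_real (w z) \<partial>dA) = (if j = k then of_real (ww.weight_const * ww.sq_norm k) else 0)"
    unfolding e integral_mult_right_zero integral_law_eq[OF m, symmetric] ww.law_orth by simp
qed

lemma one_point_eq: "z \<noteq> 0 \<Longrightarrow> one_point N Q z = dp.intensity z"
  by (intro dp.one_point_eq_intensity w_continuous) (auto simp: w_def)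

lemma intensity_eq: "dp.intensity z = (\<Sum>k<N. (w z / ww.weight_const) * (cmod (ww.orthonormal k z))\<^sup>2)"
  unfolding dp.intensity_def sum_distrib_right
  by (intro sum.cong refl) (use ww.sq_norm_pos in \<open>simp add: ww.orthonormal_def norm_divide power_divide less_imp_le\<close>)

text \<open>The mean of the empirical measure of the particles.\<close>

definition \<mu> :: "complex measure" where "\<mu> = density dA (\<lambda>z. ennreal (dp.intensity z / real N))"

lemma sets_\<mu> [measurable_cong, simp]: "sets \<mu> = sets borel" by (simp add: \<mu>_def)

lemma orthonormal_measurable [measurable]: "ww.orthonormal k \<in> borel_measurable borel"
  unfolding ww.orthonormal_def by measurable

lemma \<mu>_moment:
  "integrable \<mu> (\<lambda>z. Re z ^ m)"
  "(\<integral>z. Re z ^ m \<partial>\<mu>) = (1 / real N) * (\<Sum>k<N. jacobi_moment ww.off_diag ww.diag (\<tau>\<^sup>2) m k)"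
proof -
  let ?g = "\<lambda>k z. Re z ^ m * (cmod (ww.orthonormal k z))\<^sup>2"
  have gamma_moment: "?g k \<in> borel_measurable borel" for k by measurable
  have gi: "integrable dA (\<lambda>z. (w z / ww.weight_const) *\<^sub>R ?g k z)" for k
    using ww.Re_moment(1)[of m k] integrable_law_iff[OF gamma_moment] by simp
  have e: "(dp.intensity z / real N) *\<^sub>R Re z ^ m = (1 / real N) * (\<Sum>k<N. (w z / ww.weight_const) *\<^sub>R ?g k z)" for z
    by (simp add: intensity_eq sum_distrib_left sum_distrib_right sum_divide_distrib mult_ac)
  have nn: "dp.intensity z / real N \<ge> 0" for z using dp.intensity_nonneg by simp
  have mm: "(\<lambda>z. Re z ^ m) \<in> borel_measurable borel" by measurable
  have "integrable dA (\<lambda>z. (dp.intensity z / real N) *\<^sub>R Re z ^ m)"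
    unfolding e using gi by (intro integrable_mult_right Bochner_Integration.integrable_sum)
  then show "integrable \<mu> (\<lambda>z. Re z ^ m)"
    unfolding \<mu>_def using nn by (subst integrable_density) auto
  have "(\<integral>z. Re z ^ m \<partial>\<mu>) = (\<integral>z. (dp.intensity z / real N) *\<^sub>R Re z ^ m \<partial>dA)"
    unfolding \<mu>_def using nn by (intro integral_density) auto
  also have "\<dots> = (1 / real N) * (\<Sum>k<N. \<integral>z. (w z / ww.weight_const) *\<^sub>R ?g k z \<partial>dA)"
    unfolding e integral_mult_right_zero using gi by (subst Bochner_Integration.integral_sum) auto
  also have "\<dots> = (1 / real N) * (\<Sum>k<N. jacobi_moment ww.off_diag ww.diag (\<tau>\<^sup>2) m k)"
    unfolding integral_law_eq[OF gamma_moment, symmetric] ww.Re_moment(2) ..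
  finally show "(\<integral>z. Re z ^ m \<partial>\<mu>) = (1 / real N) * (\<Sum>k<N. jacobi_moment ww.off_diag ww.diag (\<tau>\<^sup>2) m k)" .
qed

lemma nn_integral_intensity: "(\<integral>\<^sup>+z. ennreal (dp.intensity z) \<partial>dA) = ennreal (real N)"
proof -
  have "(\<integral>\<^sup>+z. ennreal (dp.intensity z) \<partial>dA) = ennreal (\<integral>z. dp.intensity z \<partial>dA)"
    using dp.integrable_intensity dp.intensity_nonneg by (intro nn_integral_eq_integral) auto
  also have "(\<integral>z. dp.intensity z \<partial>dA) = (\<Sum>k<N. dp.mass UNIV k / (ww.weight_const * ww.sq_norm k))"
    using dp.sum_mass[of UNIV] by simp
  also have "\<dots> = (\<Sum>k<N. 1)"
  proof (intro sum.cong refl)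
    fix k assume "k \<in> {..<N}"
    then show "dp.mass UNIV k / (ww.weight_const * ww.sq_norm k) = 1"
      using ww.weight_const_pos ww.sq_norm_pos[of k] by (simp add: dp.mass_UNIV)
  qed
  finally show ?thesis by simp
qed

lemma prob_space_\<mu>: "prob_space \<mu>"
proof
  have "emeasure \<mu> (space \<mu>) = (\<integral>\<^sup>+z. ennreal (1 / real N) * ennreal (dp.intensity z) \<partial>dA)"
    unfolding \<mu>_def using dp.intensity_nonneg
    by (subst emeasure_density) (auto intro!: nn_integral_cong simp: ennreal_mult[symmetric])
  also have "\<dots> = ennreal (1 / real N) * ennreal (real N)"
    by (subst nn_integral_cmult) (auto simp: nn_integral_intensity)
  also have "\<dots> = 1" using N0 by (simp add: ennreal_mult[symmetric])
  finally show "emeasure \<mu> (space \<mu>) = 1" .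
qed

abbreviation "scaled_section \<equiv> \<lambda>\<xi>. (1 / pi) * cross_section N Q \<xi>"

lemma section_eq: "\<xi> \<noteq> 0 \<Longrightarrow> scaled_section \<xi> = 1 / (pi * real N) * (\<integral>\<eta>. dp.intensity (Complex \<xi> \<eta>) \<partial>lborel)"
proof -
  assume \<xi>: "\<xi> \<noteq> 0"
  then have "one_point N Q (Complex \<xi> \<eta>) = dp.intensity (Complex \<xi> \<eta>)" for \<eta>
    by (intro one_point_eq) (simp add: complex_eq_iff)
  then show ?thesis by (simp add: cross_section_def)
qed

lemma intensity_Complex_measurable [measurable]: "(\<lambda>(x, y). dp.intensity (Complex x y)) \<in> borel_measurable (borel \<Otimes>\<^sub>M borel)"
  using measurable_compose[OF measurable_Complex dp.intensity_measurable] by (simp add: case_prod_beta)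

lemma section_measurable [measurable]: "scaled_section \<in> borel_measurable borel"
proof -
  have [measurable]: "(\<lambda>\<xi>. \<integral>\<eta>. dp.intensity (Complex \<xi> \<eta>) \<partial>lborel) \<in> borel_measurable borel"
    by (rule lborel.borel_measurable_lebesgue_integral) measurable
  have "scaled_section = (\<lambda>\<xi>. if \<xi> = 0 then scaled_section 0 else 1 / (pi * real N) * (\<integral>\<eta>. dp.intensity (Complex \<xi> \<eta>) \<partial>lborel))"
    using section_eq by auto
  also have "\<dots> \<in> borel_measurable borel" by measurable
  finally show ?thesis .
qed

text \<open>Tonelli's theorem in Cartesian coordinates.  The line \<open>\<xi> = 0\<close> contains the origin, where the one-point
function is not given by the intensity; being a single value of \<open>\<xi>\<close>, it is negligible.\<close>

lemma density_measure_section: "density_measure scaled_section = distr \<mu> borel Re"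
proof (rule measure_eqI)
  fix A assume "A \<in> sets (density_measure scaled_section)"
  then have A[measurable]: "A \<in> sets borel" by (simp add: density_measure_def)
  have fin: "(\<integral>\<^sup>+x. \<integral>\<^sup>+y. ennreal (dp.intensity (Complex x y)) \<partial>lborel \<partial>lborel) < \<infinity>"
  proof -
    have "ennreal (1 / pi) * (\<integral>\<^sup>+x. \<integral>\<^sup>+y. ennreal (dp.intensity (Complex x y)) \<partial>lborel \<partial>lborel) = ennreal (real N)"
      using nn_integral_intensity by (subst (asm) nn_integral_dA) (auto simp: nn_integral_complex)
    then have "ennreal (1 / pi) * (\<integral>\<^sup>+x. \<integral>\<^sup>+y. ennreal (dp.intensity (Complex x y)) \<partial>lborel \<partial>lborel) < \<infinity>" by simp
    then show ?thesis by (auto simp: ennreal_mult_less_top)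
  qed
  \<comment> \<open>Where the inner integral is infinite, the cross-section would be 0 by convention.\<close>
  have AEfin: "AE x in lborel. (\<integral>\<^sup>+y. ennreal (dp.intensity (Complex x y)) \<partial>lborel) \<noteq> \<infinity>"
    using fin by (intro nn_integral_PInf_AE) auto
  have "emeasure (distr \<mu> borel Re) A = (\<integral>\<^sup>+z. ennreal (dp.intensity z / real N) * indicator A (Re z) \<partial>dA)"
  proof -
    have "emeasure (distr \<mu> borel Re) A = (\<integral>\<^sup>+x. indicator A x \<partial>distr \<mu> borel Re)" by simp
    also have "\<dots> = (\<integral>\<^sup>+z. indicator A (Re z) \<partial>\<mu>)" by (subst nn_integral_distr) auto
    also have "\<dots> = (\<integral>\<^sup>+z. ennreal (dp.intensity z / real N) * indicator A (Re z) \<partial>dA)"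
      unfolding \<mu>_def by (subst nn_integral_density) auto
    finally show ?thesis .
  qed
  also have "\<dots> = ennreal (1 / pi) * (\<integral>\<^sup>+x. \<integral>\<^sup>+y. ennreal (dp.intensity (Complex x y) / real N) * indicator A x \<partial>lborel \<partial>lborel)"
    by (subst nn_integral_dA) (auto simp: nn_integral_complex)
  also have "\<dots> = (\<integral>\<^sup>+x. ennreal (1 / pi) * (\<integral>\<^sup>+y. ennreal (dp.intensity (Complex x y) / real N) * indicator A x \<partial>lborel) \<partial>lborel)"
    by (rule nn_integral_cmult[symmetric]) measurable
  also have "\<dots> = (\<integral>\<^sup>+x. ennreal (scaled_section x) * indicator A x \<partial>lborel)"
  proof (rule nn_integral_cong_AE)
    have "AE x in lborel. x \<noteq> (0::real)" by (rule AE_lborel_singleton)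
    then show "AE x in lborel. ennreal (1 / pi) * (\<integral>\<^sup>+y. ennreal (dp.intensity (Complex x y) / real N) * indicator A x \<partial>lborel) = ennreal (scaled_section x) * indicator A x"
      using AEfin
    proof eventually_elim
      case (elim x)
      have [measurable]: "(\<lambda>y. dp.intensity (Complex x y)) \<in> borel_measurable borel" by measurable
      have int: "integrable lborel (\<lambda>y. dp.intensity (Complex x y))"
        using elim(2) dp.intensity_nonneg by (intro integrableI_nonneg) (auto simp: less_top)
      have "(\<integral>\<^sup>+y. ennreal (dp.intensity (Complex x y) / real N) * indicator A x \<partial>lborel)
          = (\<integral>\<^sup>+y. ennreal (dp.intensity (Complex x y) / real N) \<partial>lborel) * indicator A x"
        by (rule nn_integral_multc) measurable
      also have "(\<integral>\<^sup>+y. ennreal (dp.intensity (Complex x y) / real N) \<partial>lborel) = ennreal (\<integral>y. dp.intensity (Complex x y) / real N \<partial>lborel)"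
        using int dp.intensity_nonneg by (intro nn_integral_eq_integral) auto
      finally have e: "(\<integral>\<^sup>+y. ennreal (dp.intensity (Complex x y) / real N) * indicator A x \<partial>lborel) =
          ennreal (\<integral>y. dp.intensity (Complex x y) / real N \<partial>lborel) * indicator A x" .
      have nn: "0 \<le> (\<integral>y. dp.intensity (Complex x y) / real N \<partial>lborel)"
        using dp.intensity_nonneg by (intro Bochner_Integration.integral_nonneg) simp
      have "1 / pi * (\<integral>y. dp.intensity (Complex x y) / real N \<partial>lborel) = scaled_section x"
        unfolding section_eq[OF elim(1)] by simp
      then have "ennreal (1 / pi) * ennreal (\<integral>y. dp.intensity (Complex x y) / real N \<partial>lborel) = ennreal (scaled_section x)"
        using nn by (subst ennreal_mult[symmetric]) auto
      then show ?case unfolding e by (simp only: mult.assoc[symmetric])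
    qed
  qed
  also have "\<dots> = emeasure (density_measure scaled_section) A"
    unfolding density_measure_def by (rule emeasure_density[symmetric]) measurable
  finally show "emeasure (density_measure scaled_section) A = emeasure (distr \<mu> borel Re) A" ..
qed (simp add: density_measure_def)

lemma real_distribution_section: "real_distribution (density_measure scaled_section)"
proof -
  interpret prob_space \<mu> by (rule prob_space_\<mu>)
  show ?thesis unfolding density_measure_section by (intro real_distribution_distr) simp
qed

lemma section_moment:
  "integrable (density_measure scaled_section) (\<lambda>x. x ^ m)"
  "(\<integral>x. x ^ m \<partial>density_measure scaled_section) = (1 / real N) * (\<Sum>k<N. jacobi_moment ww.off_diag ww.diag (\<tau>\<^sup>2) m k)"
proof -
  have [measurable]: "Re \<in> borel_measurable \<mu>" by simp
  show "integrable (density_measure scaled_section) (\<lambda>x. x ^ m)"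
    unfolding density_measure_section by (subst integrable_distr_eq) (auto intro: \<mu>_moment)
  show "(\<integral>x. x ^ m \<partial>density_measure scaled_section) = (1 / real N) * (\<Sum>k<N. jacobi_moment ww.off_diag ww.diag (\<tau>\<^sup>2) m k)"
    unfolding density_measure_section by (subst integral_distr) (auto simp: \<mu>_moment)
qed

end

section \<open>Asymptotics\<close>

definition off_diag_coeff :: "real \<Rightarrow> real \<Rightarrow> nat \<Rightarrow> nat \<Rightarrow> real" where
  "off_diag_coeff c v N n = sqrt (real n * (real n + v)) / (real N - c\<^sup>2 / 2)"

definition diag_coeff :: "real \<Rightarrow> real \<Rightarrow> nat \<Rightarrow> nat \<Rightarrow> real" where
  "diag_coeff c v N n = (1 - c\<^sup>2 / real N) * (2 * real n + v + 1) / (real N - c\<^sup>2 / 2)"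

text \<open>The factor \<open>\<tau>\<^sup>2\<close> in the recurrence.\<close>

definition asymmetry_coeff :: "real \<Rightarrow> nat \<Rightarrow> real" where
  "asymmetry_coeff c N = (1 - c\<^sup>2 / real N)\<^sup>2"

lemma (in wishart_ensemble) section_moment_explicit:
  "(\<integral>x. x ^ m \<partial>density_measure scaled_section) = (1 / real N) * (\<Sum>k<N. jacobi_moment (off_diag_coeff c \<nu> N) (diag_coeff c \<nu> N) (asymmetry_coeff c N) m k)"
proof -
  have "ww.off_diag = off_diag_coeff c \<nu> N" by (simp add: fun_eq_iff ww.off_diag_def off_diag_coeff_def kappa_eq)
  moreover have "ww.diag = diag_coeff c \<nu> N" 
    by (rule ext) (simp only: ww.diag_def diag_coeff_def kappa_eq, simp only: \<tau>_def)
  ultimately show ?thesis using section_moment(2)[of m] by (simp add: asymmetry_coeff_def \<tau>_def)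
qed

lemma floor_index_tendsto:
  assumes x: "0 < x"
  shows "(\<lambda>N. real (nat (int (nat \<lfloor>real N * x\<rfloor>) + l)) / real N) \<longlonglongrightarrow> x"
proof -
  have "(\<lambda>N. real (nat (int (nat \<lfloor>real N * x\<rfloor>) + l)) / real N - x) \<longlonglongrightarrow> 0"
  proof (rule Lim_null_comparison)
    show "(\<lambda>N. (\<bar>real_of_int l\<bar> + 1) * (1 / real N)) \<longlonglongrightarrow> 0"
      using tendsto_mult_right_zero[OF lim_1_over_n, of "\<bar>real_of_int l\<bar> + 1"] by simp
    have "eventually (\<lambda>N::nat. N > 0) sequentially" by (rule eventually_gt_at_top)
    then show "\<forall>\<^sub>F N in sequentially. norm (real (nat (int (nat \<lfloor>real N * x\<rfloor>) + l)) / real N - x) \<le> (\<bar>real_of_int l\<bar> + 1) * (1 / real N)"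
    proof eventually_elim
      case (elim N)
      let ?n = "nat (int (nat \<lfloor>real N * x\<rfloor>) + l)"
      have "real N * x \<ge> 0" using x by simp
      then have f: "real (nat \<lfloor>real N * x\<rfloor>) \<le> real N * x" "real N * x < real (nat \<lfloor>real N * x\<rfloor>) + 1"
        by linarith+
      have "\<bar>real ?n - real (nat \<lfloor>real N * x\<rfloor>)\<bar> \<le> \<bar>real_of_int l\<bar>" by linarith
      then have "\<bar>real ?n - real N * x\<bar> \<le> \<bar>real_of_int l\<bar> + 1" using f by linarith
      moreover have "real ?n / real N - x = (real ?n - real N * x) / real N" using elim by (simp add: field_simps)
      ultimately show ?case using elim by (simp add: abs_divide divide_right_mono)
    qed
  qed
  then show ?thesis by (simp add: LIM_zero_iff)
qed

lemma floor_index_at_top: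
  assumes x: "0 < x"
  shows "filterlim (\<lambda>N. nat \<lfloor>real N * x\<rfloor>) at_top sequentially"
  unfolding filterlim_at_top
proof
  fix Z :: nat
  obtain N0 :: nat where N0: "real Z / x \<le> real N0" using real_arch_simple by blast
  show "\<forall>\<^sub>F N in sequentially. Z \<le> nat \<lfloor>real N * x\<rfloor>"
    using eventually_ge_at_top[of N0]
  proof eventually_elim
    case (elim N)
    have "real Z \<le> real N0 * x" using N0 x by (simp add: field_simps)
    also have "\<dots> \<le> real N * x" using elim x by simp
    finally show ?case by (simp add: le_nat_iff le_floor_iff)
  qed
qed

text \<open>The average over \<open>k < N\<close> is the integral of a step function of \<open>x\<close> with \<open>k = \<lfloor>N x\<rfloor>\<close>.  Its pointwise limit is
\<open>jacobi_moment_tendsto\<close>, and the recurrence coefficients are bounded for indices up to a multiple of \<open>N\<close>,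
which gives a constant majorant.\<close>

lemma moments_tendsto:
  fixes c \<alpha> :: real and \<nu> :: "nat \<Rightarrow> real"
  assumes c: "c > 0" and \<alpha>: "\<alpha> \<ge> 0" and lim: "(\<lambda>N. \<nu> N / real N) \<longlonglongrightarrow> \<alpha>"
    and ev: "\<forall>\<^sub>F N in sequentially. \<nu> N > -1"
  shows "(\<lambda>N. (1 / real N) * (\<Sum>k<N. jacobi_moment (off_diag_coeff c (\<nu> N) N) (diag_coeff c (\<nu> N) N) (asymmetry_coeff c N) m k))
     \<longlonglongrightarrow> (\<integral>x. indicator {0<..<1} x * symbol_coeff (2 * x + \<alpha>) (sqrt (x * (x + \<alpha>))) m 0 \<partial>lborel)"
proof -
  let ?S = "\<lambda>x. symbol_coeff (2 * x + \<alpha>) (sqrt (x * (x + \<alpha>))) m 0"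
  let ?k = "\<lambda>N x. nat \<lfloor>real N * x\<rfloor>"
  let ?J = "\<lambda>N k. jacobi_moment (off_diag_coeff c (\<nu> N) N) (diag_coeff c (\<nu> N) N) (asymmetry_coeff c N) m k"
  have inv: "(\<lambda>N. C * (1 / real N)) \<longlonglongrightarrow> 0" for C :: real
    using tendsto_mult_right_zero[OF lim_1_over_n, of C] by simp
  have t: "asymmetry_coeff c \<longlonglongrightarrow> 1"
  proof -
    have "(\<lambda>N. (1 - c\<^sup>2 * (1 / real N))\<^sup>2) \<longlonglongrightarrow> (1 - 0)\<^sup>2" by (intro tendsto_intros inv)
    then show ?thesis by (simp add: asymmetry_coeff_def[abs_def])
  qed
  have pos: "eventually (\<lambda>N::nat. N > 0) sequentially" by (rule eventually_gt_at_top)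
  have pt: "(\<lambda>N. ?J N (?k N x)) \<longlonglongrightarrow> ?S x" if x: "0 < x" for x
  proof (rule jacobi_moment_tendsto[OF floor_index_at_top[OF x] _ _ t])
    fix l
    let ?n = "\<lambda>N. nat (int (?k N x) + l)"
    let ?a = "\<lambda>N. sqrt (real (?n N) / real N * (real (?n N) / real N + \<nu> N / real N)) / (1 - c\<^sup>2 / 2 * (1 / real N))"
    let ?d = "\<lambda>N. (1 - c\<^sup>2 * (1 / real N)) * (2 * (real (?n N) / real N) + \<nu> N / real N + 1 * (1 / real N)) / (1 - c\<^sup>2 / 2 * (1 / real N))"
    note n = floor_index_tendsto[OF x, of l]
    have "(\<lambda>N. ?a N) \<longlonglongrightarrow> sqrt (x * (x + \<alpha>)) / (1 - 0)"
      by (intro tendsto_intros n lim inv) simp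
    then have L: "(\<lambda>N. ?a N) \<longlonglongrightarrow> sqrt (x * (x + \<alpha>))" by simp
    show "(\<lambda>N. off_diag_coeff c (\<nu> N) N (?n N)) \<longlonglongrightarrow> sqrt (x * (x + \<alpha>))"
    proof (rule Lim_transform_eventually[OF L])
      show "\<forall>\<^sub>F N in sequentially. ?a N = off_diag_coeff c (\<nu> N) N (?n N)"
        using pos
      proof eventually_elim
        case (elim N)
        let ?k = "real (?n N)"
        have "?k / real N * (?k / real N + \<nu> N / real N) = ?k * (?k + \<nu> N) / (real N)\<^sup>2"
          using elim by (simp add: field_simps power2_eq_square)
        then have 1: "sqrt (?k / real N * (?k / real N + \<nu> N / real N)) = sqrt (?k * (?k + \<nu> N)) / real N"
          by (simp add: real_sqrt_divide)
        have 2: "1 - c\<^sup>2 / 2 * (1 / real N) = (real N - c\<^sup>2 / 2) / real N" using elim by (simp add: field_simps)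
        show ?case unfolding 1 2 off_diag_coeff_def using elim by simp
      qed
    qed
    have "(\<lambda>N. ?d N) \<longlonglongrightarrow> (1 - 0) * (2 * x + \<alpha> + 0) / (1 - 0)"
      by (intro tendsto_intros n lim inv) simp
    then have L: "(\<lambda>N. ?d N) \<longlonglongrightarrow> 2 * x + \<alpha>" by simp
    show "(\<lambda>N. diag_coeff c (\<nu> N) N (?n N)) \<longlonglongrightarrow> 2 * x + \<alpha>"
    proof (rule Lim_transform_eventually[OF L])
      show "\<forall>\<^sub>F N in sequentially. ?d N = diag_coeff c (\<nu> N) N (?n N)"
        using pos
      proof eventually_elim
        case (elim N)
        let ?k = "real (?n N)"
        have 1: "2 * (?k / real N) + \<nu> N / real N + 1 * (1 / real N) = (2 * ?k + \<nu> N + 1) / real N"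
          by (simp add: add_divide_distrib)
        have 2: "1 - c\<^sup>2 / 2 * (1 / real N) = (real N - c\<^sup>2 / 2) / real N" using elim by (simp add: field_simps)
        show ?case unfolding 1 2 diag_coeff_def using elim by simp
      qed
    qed
  qed
  \<comment> \<open>Twice the bound \<open>2 (4 + \<alpha>)\<close> for the off-diagonal coefficients plus \<open>2 (6 + \<alpha>)\<close> for the diagonal is below this.\<close>
  define B where "B = 32 + 6 * \<alpha>"
  have B0: "B \<ge> 0" using \<alpha> by (simp add: B_def)
  have evb: "\<forall>\<^sub>F N in sequentially. \<nu> N / real N < \<alpha> + 1"
    using lim by (rule order_tendstoD) simp
  obtain Nc :: nat where Nc: "c\<^sup>2 < real Nc" using reals_Archimedean2 by blast
  have "\<forall>\<^sub>F N in sequentially. N > 0 \<and> N \<ge> m \<and> real N > c\<^sup>2 \<and> \<nu> N > -1 \<and> \<nu> N / real N < \<alpha> + 1"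
    using pos eventually_ge_at_top[of m] eventually_ge_at_top[of Nc] ev evb
    by eventually_elim (use Nc in auto)
  then obtain N0 where N0: "\<And>N. N \<ge> N0 \<Longrightarrow> N > 0 \<and> N \<ge> m \<and> real N > c\<^sup>2 \<and> \<nu> N > -1 \<and> \<nu> N / real N < \<alpha> + 1"
    by (auto simp: eventually_sequentially)
  have bound: "\<bar>?J N k\<bar> \<le> (2 * real m + 1) * B ^ m" if N: "N \<ge> N0" and k: "k < N" for N k
  proof (rule abs_jacobi_moment_le[where L = "2 * N"])
    note h = N0[OF N]
    have v: "\<nu> N \<le> (\<alpha> + 1) * real N" using h pos_divide_less_eq[of "real N" "\<nu> N" "\<alpha> + 1"] by auto
    have \<kappa>: "real N - c\<^sup>2 / 2 \<ge> real N / 2" "real N - c\<^sup>2 / 2 > 0" using h by linarith+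
    have N1: "real N \<ge> 1" using h by simp
    have A: "\<bar>off_diag_coeff c (\<nu> N) N n\<bar> \<le> 2 * (4 + \<alpha>)" if n: "n \<le> 3 * N" for n
    proof -
      have nr: "real n \<le> 3 * real N" using n by (metis of_nat_le_iff of_nat_mult of_nat_numeral)
      have nn: "0 \<le> real n * (real n + \<nu> N)" using h by (cases n) auto
      have "real n * (real n + \<nu> N) \<le> ((4 + \<alpha>) * real N)\<^sup>2"
      proof (cases "n = 0")
        case False
        then have "real n + \<nu> N \<ge> 0" using h by (cases n) auto
        then have "real n * (real n + \<nu> N) \<le> ((4 + \<alpha>) * real N) * ((4 + \<alpha>) * real N)"
        proof (intro mult_mono)
          have a: "\<alpha> * real N \<ge> 0" using \<alpha> by simp
          show "real n \<le> (4 + \<alpha>) * real N" using nr a N1 by (simp add: distrib_right)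
          show "real n + \<nu> N \<le> (4 + \<alpha>) * real N" using nr v by (simp add: distrib_right)
        qed (use \<alpha> in auto)
        then show ?thesis by (simp add: power2_eq_square)
      qed simp
      then have "sqrt (real n * (real n + \<nu> N)) \<le> (4 + \<alpha>) * real N"
        using \<alpha> by (intro real_le_lsqrt) auto
      then have "sqrt (real n * (real n + \<nu> N)) / (real N - c\<^sup>2 / 2) \<le> ((4 + \<alpha>) * real N) / (real N / 2)"
        using \<kappa> N1 \<alpha> nn by (intro frac_le) auto
      also have "\<dots> = 2 * (4 + \<alpha>)" using N1 by simp
      finally show ?thesis using \<kappa> nn by (simp add: off_diag_coeff_def)
    qed
    have t1: "0 \<le> 1 - c\<^sup>2 / real N" "1 - c\<^sup>2 / real N \<le> 1" using h by (simp_all add: field_simps)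
    have t: "\<bar>asymmetry_coeff c N\<bar> \<le> 1" unfolding asymmetry_coeff_def using t1 by (simp add: power_le_one)
    fix n assume n: "n \<le> 2 * N"
    have d: "\<bar>diag_coeff c (\<nu> N) N n\<bar> \<le> 2 * (6 + \<alpha>)"
    proof -
      have nr: "real n \<le> 2 * real N" using n by (metis of_nat_le_iff of_nat_mult of_nat_numeral)
      have s: "0 \<le> 2 * real n + \<nu> N + 1" "2 * real n + \<nu> N + 1 \<le> (6 + \<alpha>) * real N"
        using h nr v N1 by (simp_all add: distrib_right)
      have "(1 - c\<^sup>2 / real N) * (2 * real n + \<nu> N + 1) \<le> 1 * ((6 + \<alpha>) * real N)"
        using s t1 by (intro mult_mono) auto
      then have "(1 - c\<^sup>2 / real N) * (2 * real n + \<nu> N + 1) / (real N - c\<^sup>2 / 2) \<le> ((6 + \<alpha>) * real N) / (real N / 2)"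
        using \<kappa> N1 \<alpha> by (intro frac_le) auto
      also have "\<dots> = 2 * (6 + \<alpha>)" using N1 by simp
      finally show ?thesis using s t1 \<kappa> by (simp add: diag_coeff_def)
    qed
    have "\<bar>asymmetry_coeff c N\<bar> * \<bar>off_diag_coeff c (\<nu> N) N (Suc n)\<bar> \<le> 1 * (2 * (4 + \<alpha>))"
      using t A[of "Suc n"] n h by (intro mult_mono) auto
    then show "\<bar>off_diag_coeff c (\<nu> N) N n\<bar> + \<bar>diag_coeff c (\<nu> N) N n\<bar> + \<bar>asymmetry_coeff c N\<bar> * \<bar>off_diag_coeff c (\<nu> N) N (Suc n)\<bar> \<le> B"
      using A[of n] d n by (simp add: B_def)
  qed (use B0 k N0[OF N] in auto)
  have "(\<lambda>N. \<integral>x. indicator {0<..<1} x * ?J (N + N0) (?k (N + N0) x) \<partial>lborel) \<longlonglongrightarrow>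
      (\<integral>x. indicator {0<..<1} x * ?S x \<partial>lborel)"
  proof (rule integral_dominated_convergence[where w = "\<lambda>x. indicator {0<..<1} x * ((2 * real m + 1) * B ^ m)"])
    show "AE x in lborel. (\<lambda>N. indicator {0<..<1} x * ?J (N + N0) (?k (N + N0) x)) \<longlonglongrightarrow>
       indicator {0<..<1} x * ?S x"
    proof (rule AE_I2)
      fix x :: real
      show "(\<lambda>N. indicator {0<..<1} x * ?J (N + N0) (?k (N + N0) x)) \<longlonglongrightarrow>
         indicator {0<..<1} x * ?S x"
      proof (cases "x \<in> {0<..<1}")
        case True
        then have "(\<lambda>N. ?J N (?k N x)) \<longlonglongrightarrow> ?S x" by (intro pt) auto
        from LIMSEQ_ignore_initial_segment[OF this, of N0] show ?thesis by (intro tendsto_mult_left)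
      qed simp
    qed
    show "AE x in lborel. norm (indicator {0<..<1} x * ?J (N + N0) (?k (N + N0) x)) \<le> indicator {0<..<1} x * ((2 * real m + 1) * B ^ m)" for N
    proof (rule AE_I2)
      fix x :: real
      show "norm (indicator {0<..<1} x * ?J (N + N0) (?k (N + N0) x)) \<le> indicator {0<..<1} x * ((2 * real m + 1) * B ^ m)"
      proof (cases "x \<in> {0<..<1}")
        case True
        have "N + N0 > 0" using N0[of "N + N0"] by simp
        then have "real (N + N0) > 0" by (simp only: of_nat_0_less_iff)
        then have "real (N + N0) * x < real (N + N0) * 1" using True by (intro mult_strict_left_mono) auto
        then have "real (N + N0) * x < real (N + N0)" by (simp only: mult_1_right)
        moreover have "real (N + N0) * x \<ge> 0" using True by simp
        ultimately have "?k (N + N0) x < N + N0" by linarith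
        then show ?thesis using True bound[of "N + N0"] by simp
      qed simp
    qed
    show "integrable lborel (\<lambda>x::real. indicator {0<..<1} x * ((2 * real m + 1) * B ^ m) :: real)"
      by (intro integrable_mult_left) simp
  qed measurable
  then have "(\<lambda>N. (1 / real (N + N0)) * (\<Sum>k<N + N0. ?J (N + N0) k)) \<longlonglongrightarrow>
      (\<integral>x. indicator {0<..<1} x * ?S x \<partial>lborel)"
    using N0 by (subst sum_eq_integral_floor) auto
  then show ?thesis by (rule LIMSEQ_offset)
qed

theorem theorem8p1:
  fixes c \<alpha> :: real and \<nu> :: "nat \<Rightarrow> real"
  assumes "c > 0" and "\<alpha> \<ge> 0"
    and "(\<lambda>N. \<nu> N / real N) \<longlonglongrightarrow> \<alpha>"
    and "\<forall>\<^sub>F N in sequentially. \<nu> N > -1"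
  shows "densities_converge_weakly
           (\<lambda>N \<xi>. (1 / pi) * cross_section N (wishart_potential c (\<nu> N) N) \<xi>)
           (mp_density \<alpha>)"
proof -
  let ?s = "\<lambda>N \<xi>. (1 / pi) * cross_section N (wishart_potential c (\<nu> N) N) \<xi>"
  let ?M = "\<lambda>N. density_measure (?s N)"
  \<comment> \<open>Only for large \<open>N\<close> is the ensemble covered by the analysis, so the sequence is shifted.\<close>
  obtain Nc :: nat where Nc: "c\<^sup>2 < real Nc" using reals_Archimedean2 by blast
  have ev: "\<forall>\<^sub>F N in sequentially. wishart_ensemble N c (\<nu> N)"
    using assms(4) eventually_ge_at_top[of Nc]
    by eventually_elim (use Nc assms(1) in \<open>auto simp: wishart_ensemble_def\<close>)
  then obtain N0 where N0: "\<And>N. N \<ge> N0 \<Longrightarrow> wishart_ensemble N c (\<nu> N)"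
    by (auto simp: eventually_sequentially)
  have mp: "density_measure (mp_density \<alpha>) = distr mp_sample borel (mp_map \<alpha>)"
    by (rule density_measure_mp_eq_distr[OF assms(2)])
  have [measurable]: "mp_map \<alpha> \<in> borel_measurable mp_sample" by measurable
  have mp_int: "(\<integral>x. x ^ m \<partial>density_measure (mp_density \<alpha>)) = (\<integral>p. mp_map \<alpha> p ^ m \<partial>mp_sample)" for m
    unfolding mp by (subst integral_distr) auto
  have "weak_conv_m (\<lambda>N. ?M (N + N0)) (density_measure (mp_density \<alpha>))"
  proof (rule weak_conv_m_of_moments)
    show "real_distribution (?M (N + N0))" for N
      using wishart_ensemble.real_distribution_section[OF N0[of "N + N0"]] by simp
    show "real_distribution (density_measure (mp_density \<alpha>))"
      unfolding mp by (intro prob_space.real_distribution_distr prob_space_mp_sample) measurable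
    show "integrable (?M (N + N0)) (\<lambda>x. x ^ k)" for N k
      using wishart_ensemble.section_moment(1)[OF N0[of "N + N0"]] by simp
    show "integrable (density_measure (mp_density \<alpha>)) (\<lambda>x. x ^ k)" for k
      unfolding mp using mp_moment(1)[OF assms(2)] by (subst integrable_distr_eq) auto
    show "\<bar>\<integral>x. x ^ k \<partial>density_measure (mp_density \<alpha>)\<bar> \<le> (4 + 3 * \<alpha>) ^ k" for k
      unfolding mp_int by (rule mp_moment(3)[OF assms(2)])
    show "(\<lambda>N. \<integral>x. x ^ k \<partial>?M (N + N0)) \<longlonglongrightarrow> (\<integral>x. x ^ k \<partial>density_measure (mp_density \<alpha>))" for k
    proof -
      have "(\<integral>x. x ^ k \<partial>?M (N + N0)) = (1 / real (N + N0)) * (\<Sum>j<N + N0. jacobi_moment (off_diag_coeff c (\<nu> (N + N0)) (N + N0)) (diag_coeff c (\<nu> (N + N0)) (N + N0)) (asymmetry_coeff c (N + N0)) k j)" for N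
        by (rule wishart_ensemble.section_moment_explicit[OF N0]) simp
      then show ?thesis
        unfolding mp_int mp_moment(2)[OF assms(2)]
        using LIMSEQ_ignore_initial_segment[OF moments_tendsto[OF assms], of N0] by simp
    qed
  qed
  then have shifted: "isCont (cdf (density_measure (mp_density \<alpha>))) x \<Longrightarrow>
      (\<lambda>N. cdf (?M (N + N0)) x) \<longlonglongrightarrow> cdf (density_measure (mp_density \<alpha>)) x" for x
    by (simp only: weak_conv_m_def weak_conv_def)
  have "weak_conv_m ?M (density_measure (mp_density \<alpha>))"
    unfolding weak_conv_m_def weak_conv_def
  proof (intro allI impI)
    fix x assume "isCont (cdf (density_measure (mp_density \<alpha>))) x"
    from shifted[OF this] show "(\<lambda>N. cdf (?M N) x) \<longlonglongrightarrow> cdf (density_measure (mp_density \<alpha>)) x"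
      by (rule LIMSEQ_offset)
  qed
  moreover have "\<forall>\<^sub>F N in sequentially. real_distribution (?M N)"
    using ev by eventually_elim (rule wishart_ensemble.real_distribution_section)
  ultimately show ?thesis unfolding densities_converge_weakly_def by simp
qed

end
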